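(* Let $S \subseteq \overline{\mathbb{Z}}$. The following are equivalent. (1) $\mathrm{Int}_{\mathbb{Q}}(S,\overline{\mathbb{Z}})$ is nontrivial. (2) There exists a prime $p$ such that $\mathrm{Int}_{\mathbb{Q}}(S, \overline{\mathbb{Z}_{(p)}})$ is nontrivial. (3) There exists a prime $p$ such that $\mathrm{Int}_{\mathbb{Q}_p}(\Sigma_p(S), \overline{\mathbb{Z}_p})$ is nontrivial. (4) There exists a prime $p$ such that $\mathrm{Int}_{\overline{\mathbb{Q}_p}}(\Sigma_p(S), \overline{\mathbb{Z}_p})$ is nontrivial.
   Context: $\overline{\mathbb{Q}}$ is a fixed algebraic closure of $\mathbb{Q}$; $\overline{\mathbb{Z}}$ and $\overline{\mathbb{Z}_{(p)}}$ are the integral closures of $\mathbb{Z}$ and of $\mathbb{Z}_{(p)}$ (localization of $\mathbb{Z}$ at $p\mathbb{Z}$) in $\overline{\mathbb{Q}}$. $\overline{\mathbb{Q}_p}$ is an algebraic closure of the field $\mathbb{Q}_p$ of $p$-adic numbers and $\overline{\mathbb{Z}_p}$ is the integral closure of $\mathbb{Z}_p$ in $\overline{\mathbb{Q}_p}$. For an integral domain $D$, a field $L\supseteq D$, a subfield $F$ of $L$, and a set $S$ (of elements at which polynomials over $F$ are evaluated) contained in $D$, $\mathrm{Int}_F(S,D)=\{f\in F[X]\mid f(S)\subseteq D\}$. It contains $(D\cap F)[X]$; it is called trivial if it equals $(D\cap F)[X]$, and nontrivial otherwise. So in (1)-(4) triviality means equality with $\mathbb{Z}[X]$, $\mathbb{Z}_{(p)}[X]$,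 $\mathbb{Z}_p[X]$, $\overline{\mathbb{Z}_p}[X]$ respectively. For $S\subseteq\overline{\mathbb{Z}_{(p)}}$, let $\mathcal{P}(S)\subseteq\mathbb{Z}_{(p)}[X]$ be the set of minimal polynomials over $\mathbb{Q}$ of all elements of $S$; $\Sigma_p(S)$ is the set of roots in $\overline{\mathbb{Z}_p}$ of the polynomials in $\mathcal{P}(S)$. *)

theory Defs
  imports Complex_Main "HOL-Algebra.Algebraic_Closure_Type"
begin

abbreviation rat_ring :: "rat ring" where
  "rat_ring \<equiv> ring_of_type_algebra"

definition is_alg_closure :: "'a ring \<Rightarrow> 'b ring \<Rightarrow> ('a \<Rightarrow> 'b) \<Rightarrow> bool" where
  "is_alg_closure K L j \<longleftrightarrow> j \<in> ring_hom K L \<and> algebraic_closure L (j ` carrier K)"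

text \<open>
  Integral closure in \<open>L\<close> of a subring \<open>R\<close> of \<open>L\<close>. Polynomials in HOL-Algebra are coefficient
  lists, leading coefficient first; the zero polynomial is the empty list.
\<close>
definition integral_closure :: "'a ring \<Rightarrow> 'a set \<Rightarrow> 'a set" where
  "integral_closure L R =
     {x \<in> carrier L. \<exists>f \<in> carrier (univ_poly L R).
        f \<noteq> [] \<and> hd f = \<one>\<^bsub>L\<^esub> \<and> ring.eval L f x = \<zero>\<^bsub>L\<^esub>}"

definition Int_poly :: "'a ring \<Rightarrow> 'a set \<Rightarrow> 'a set \<Rightarrow> 'a set \<Rightarrow> 'a list set" where
  "Int_poly L F S D = {f \<in> carrier (univ_poly L F). \<forall>s \<in> S. ring.eval L f s \<in> D}"

definition Int_nontrivial :: "'a ring \<Rightarrow> 'a set \<Rightarrow> 'a set \<Rightarrow> 'a set \<Rightarrow> bool" where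
  "Int_nontrivial L F S D \<longleftrightarrow> Int_poly L F S D \<noteq> carrier (univ_poly L (D \<inter> F))"

definition Z_loc :: "nat \<Rightarrow> rat set" where
  "Z_loc p = {q. \<not> int p dvd snd (quotient_of q)}"

definition padic_val :: "nat \<Rightarrow> rat \<Rightarrow> int" where
  "padic_val p q = int (multiplicity (int p) (fst (quotient_of q)))
                 - int (multiplicity (int p) (snd (quotient_of q)))"

definition padic_abs :: "nat \<Rightarrow> rat \<Rightarrow> real" where
  "padic_abs p q = (if q = 0 then 0 else real p powi (- padic_val p q))"

text \<open>
  The field of \<open>p\<close>-adic numbers is the completion of the rationals for the \<open>p\<close>-adic absolute
  value: the ring of rational Cauchy sequences modulo the ideal of null sequences. An element is
  a coset, that is, a set of rational sequences.
\<close>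
definition padic_cauchy :: "nat \<Rightarrow> (nat \<Rightarrow> rat) \<Rightarrow> bool" where
  "padic_cauchy p a \<longleftrightarrow> (\<forall>e>0. \<exists>N. \<forall>m\<ge>N. \<forall>n\<ge>N. padic_abs p (a m - a n) < e)"

definition cauchy_ring :: "nat \<Rightarrow> (nat \<Rightarrow> rat) ring" where
  "cauchy_ring p = \<lparr>carrier = {a. padic_cauchy p a},
     monoid.mult = (\<lambda>a b n. a n * b n), one = (\<lambda>n. 1),
     ring.zero = (\<lambda>n. 0), add = (\<lambda>a b n. a n + b n)\<rparr>"

definition null_seqs :: "nat \<Rightarrow> (nat \<Rightarrow> rat) set" where
  "null_seqs p = {a. (\<lambda>n. padic_abs p (a n)) \<longlonglongrightarrow> 0}"

definition padic_field :: "nat \<Rightarrow> (nat \<Rightarrow> rat) set ring" where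
  "padic_field p = cauchy_ring p Quot null_seqs p"

definition rat_to_padic :: "nat \<Rightarrow> rat \<Rightarrow> (nat \<Rightarrow> rat) set" where
  "rat_to_padic p q = null_seqs p +>\<^bsub>cauchy_ring p\<^esub> (\<lambda>n. q)"

text \<open>
  The unit ball of the \<open>p\<close>-adic field. Outside the zero class, the sequence of absolute values
  of a representative is eventually constant, equal to the absolute value of the class; so a
  class lies in the unit ball iff it has a representative all of whose terms do.
\<close>
definition padic_integers :: "nat \<Rightarrow> (nat \<Rightarrow> rat) set set" where
  "padic_integers p = {x \<in> carrier (padic_field p). \<exists>a \<in> x. \<forall>n. padic_abs p (a n) \<le> 1}"

text \<open>
  Minimal polynomials over the rationals of the elements of \<open>S\<close>, with \<open>j\<close> the embedding of the
  rationals in \<open>L\<close>. They are returned with rational coefficients, so that they can be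
  carried to another field.
\<close>
definition min_polys :: "'a ring \<Rightarrow> (rat \<Rightarrow> 'a) \<Rightarrow> 'a set \<Rightarrow> rat list set" where
  "min_polys L j S = {f. \<exists>s \<in> S. map j f = ring.Irr L (range j) s}"

text \<open>Here \<open>k\<close> is the embedding of the \<open>p\<close>-adic field in \<open>M\<close>.\<close>
definition Sigma_p ::
  "'a ring \<Rightarrow> (rat \<Rightarrow> 'a) \<Rightarrow> nat \<Rightarrow> 'b ring \<Rightarrow> ((nat \<Rightarrow> rat) set \<Rightarrow> 'b) \<Rightarrow> 'a set \<Rightarrow> 'b set" where
  "Sigma_p L j p M k S =
     {x \<in> integral_closure M (k ` padic_integers p).
        \<exists>f \<in> min_polys L j S. ring.eval M (map (\<lambda>q. k (rat_to_padic p q)) f) x = \<zero>\<^bsub>M\<^esub>}"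

end

theory Submission
  imports Defs
begin

text \<open>
  An integer-valued polynomial is nontrivial when one of its coefficients escapes the ring that its
  values lie in. All four conditions are therefore statements about which elements of a field are
  integral over a subring, and the organising principle is Krull's theorem: the integral closure of
  a subring of a field is the intersection of the valuation rings that contain it
  (\<open>integral_closure_eq_Inter\<close>). Testing integrality on one valuation ring at a time turns
  questions about integral equations into questions about divisibility.

  Passing between the integers and the localisations is then clearing denominators. A
  non-integral rational coefficient is non-integral at some prime. Conversely, let \<open>f\<close> be nontrivial
  at \<open>p\<close>, and multiply it by the part \<open>m\<close> prime to \<open>p\<close> of a common denominator. On a valuation ring
  of the algebraic closure over the localisation the values of \<open>m f\<close> are integral by hypothesis, and
  every other valuation ring contains \<open>1/p\<close> (\<open>Int_nontrivial_iff_local\<close>).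

  From the rational to the \<open>p\<close>-adic side, a conjugate \<open>x\<close> of \<open>s\<close> in \<open>S\<close> receives a homomorphism from
  \<open>\<rat>(s)\<close> sending \<open>s\<close> to \<open>x\<close>, which carries integral values to integral values. Enlarging the
  coefficient field to the whole algebraic closure keeps the coefficients, hence the witness.

  The way back to the rationals is the heart of the proof. Let \<open>f\<close>, with coefficients in the algebraic
  closure of the \<open>p\<close>-adic field, be integral on all conjugates of \<open>S\<close>, with a coefficient
  \<open>c\<^sub>0\<close> that is not integral, and choose a valuation ring \<open>V\<close> over the \<open>p\<close>-adic integers that
  avoids \<open>c\<^sub>0\<close>. Splitting \<open>f\<close> into linear factors shows that on \<open>V\<close> it is a constant outside \<open>V\<close>
  times a unit times a product of factors \<open>x - a\<close> with \<open>a\<close> in \<open>V\<close>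
  (\<open>valuation_factorization\<close>). So \<open>f x\<close> can lie in \<open>V\<close> only if the product is divisible
  by a fixed nonunit \<open>t\<close>: the residues of the conjugates of \<open>S\<close> fall into the finite set of residues of
  the \<open>a\<close>, and they do so uniformly. The residue field of \<open>V\<close> is algebraic over the prime field, so
  some integer polynomial \<open>h\<close>, nonzero modulo \<open>p\<close>, vanishes modulo \<open>p\<close> at every \<open>a\<close>. The value
  group has rank one, so a power of \<open>t\<close> is divisible by \<open>p\<close>. Hence some power of \<open>h\<close> divided by \<open>p\<close>
  takes values in \<open>V\<close> on all conjugates of \<open>S\<close> (\<open>separating_polynomial\<close>). It has rational
  coefficients, and since \<open>V\<close> sees every conjugate over \<open>\<rat>\<close> of its value at \<open>s\<close>, the minimal polynomial
  of that value has \<open>p\<close>-integral coefficients (\<open>integral_if_conjugate_values\<close>). A single valuation ring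
  suffices because all conjugates are tested in it at once.
\<close>

section \<open>Integral closure and valuation rings\<close>

text \<open>
  The integral closure is defined for plain ring records only, so the field is fixed
  as one; the locale \<^locale>\<open>field\<close> allows record extensions.
\<close>
locale plain_field = field R for R :: "'a ring" (structure)
begin

lemma inverse_props:
  assumes "x \<in> carrier R" "x \<noteq> \<zero>"
  shows "inv x \<in> carrier R" "inv x \<otimes> x = \<one>" "x \<otimes> inv x = \<one>" "inv x \<noteq> \<zero>" "inv (inv x) = x"
proof -
  have "x \<in> Units R" using assms by (simp add: field_Units)
  then show "inv x \<in> carrier R" "inv x \<otimes> x = \<one>" and 1: "x \<otimes> inv x = \<one>" and "inv (inv x) = x" by auto
  show "inv x \<noteq> \<zero>" using 1 assms by auto
qed

lemma inverse_pow: "x \<in> carrier R \<Longrightarrow> x \<noteq> \<zero> \<Longrightarrow> inv x [^] (n::nat) \<otimes> x [^] n = \<one>"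
  using nat_pow_distrib[of "inv x" x n] inverse_props[of x] by simp

text \<open>
  Spans of the powers of \<open>x\<close> below \<open>x\<^sup>n\<close>, indexed by the number of coefficients rather than the degree:
  an integral equation of degree \<open>n\<close> says that \<open>x\<^sup>n\<close> lies in this set, and leading zeros
  make the sets increase with \<open>n\<close>.
\<close>
definition poly_values :: "'a set \<Rightarrow> 'a \<Rightarrow> nat \<Rightarrow> 'a set" where
  "poly_values A x n = {eval q x | q. set q \<subseteq> A \<and> length q = n}"

lemma poly_values_0: "poly_values A x 0 = {\<zero>}"
  by (auto simp: poly_values_def)

lemma poly_values_Suc: "poly_values A x (Suc n) = {a \<otimes> x [^] n \<oplus> b | a b. a \<in> A \<and> b \<in> poly_values A x n}"
proof safe
  fix u assume "u \<in> poly_values A x (Suc n)"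
  then obtain q where q: "set q \<subseteq> A" "length q = Suc n" "u = eval q x" by (auto simp: poly_values_def)
  then obtain a r where "q = a # r" by (cases q) auto
  then show "\<exists>a b. u = a \<otimes> x [^] n \<oplus> b \<and> a \<in> A \<and> b \<in> poly_values A x n"
    using q by (auto simp: poly_values_def)
next
  fix a b assume "a \<in> A" "b \<in> poly_values A x n"
  then obtain r where "set r \<subseteq> A" "length r = n" "b = eval r x" by (auto simp: poly_values_def)
  then have "eval (a # r) x = a \<otimes> x [^] n \<oplus> b" "set (a # r) \<subseteq> A" "length (a # r) = Suc n"
    using \<open>a \<in> A\<close> by auto
  then show "a \<otimes> x [^] n \<oplus> b \<in> poly_values A x (Suc n)" unfolding poly_values_def by (metis (mono_tags, lifting) mem_Collect_eq)
qed

lemma poly_values_carrier: "\<lbrakk>A \<subseteq> carrier R; x \<in> carrier R; u \<in> poly_values A x n\<rbrakk> \<Longrightarrow> u \<in> carrier R"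
  unfolding poly_values_def using eval_in_carrier by blast

lemma poly_values_add:
  assumes A: "subring A R" and x: "x \<in> carrier R"
  shows "\<lbrakk>u \<in> poly_values A x n; v \<in> poly_values A x n\<rbrakk> \<Longrightarrow> u \<oplus> v \<in> poly_values A x n"
proof (induction n arbitrary: u v)
  case 0 then show ?case by (simp add: poly_values_0)
next
  case (Suc n)
  note AE = subringE[OF A]
  obtain a b where u: "u = a \<otimes> x [^] n \<oplus> b" "a \<in> A" "b \<in> poly_values A x n" using Suc.prems by (auto simp: poly_values_Suc)
  obtain c d where v: "v = c \<otimes> x [^] n \<oplus> d" "c \<in> A" "d \<in> poly_values A x n" using Suc.prems by (auto simp: poly_values_Suc)
  have car: "a \<in> carrier R" "c \<in> carrier R" "b \<in> carrier R" "d \<in> carrier R" "x [^] n \<in> carrier R"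
    using AE(1) u v poly_values_carrier[OF AE(1) x] x by auto
  have "u \<oplus> v = (a \<oplus> c) \<otimes> x [^] n \<oplus> (b \<oplus> d)"
    unfolding u v using car by algebra
  then show ?case using Suc.IH[OF u(3) v(3)] AE(7)[OF u(2) v(2)] by (auto simp: poly_values_Suc)
qed

lemma poly_values_smult:
  assumes A: "subring A R" and x: "x \<in> carrier R" and a: "a \<in> A"
  shows "u \<in> poly_values A x n \<Longrightarrow> a \<otimes> u \<in> poly_values A x n"
proof (induction n arbitrary: u)
  case 0 then show ?case using a subringE(1)[OF A] by (auto simp: poly_values_0)
next
  case (Suc n)
  note AE = subringE[OF A]
  obtain c b where u: "u = c \<otimes> x [^] n \<oplus> b" "c \<in> A" "b \<in> poly_values A x n" using Suc.prems by (auto simp: poly_values_Suc)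
  have car: "a \<in> carrier R" "c \<in> carrier R" "b \<in> carrier R" "x [^] n \<in> carrier R"
    using AE(1) u a poly_values_carrier[OF AE(1) x] x by auto
  have "a \<otimes> u = (a \<otimes> c) \<otimes> x [^] n \<oplus> (a \<otimes> b)"
    unfolding u using car by algebra
  then show ?case using Suc.IH[OF u(3)] AE(6)[OF a u(2)] by (auto simp: poly_values_Suc)
qed

lemma poly_values_mult_var:
  assumes A: "subring A R" and x: "x \<in> carrier R" and a: "a \<in> A" and u: "u \<in> poly_values A x n"
  shows "u \<otimes> x \<oplus> a \<in> poly_values A x (Suc n)"
proof -
  obtain q where q: "set q \<subseteq> A" "length q = n" "u = eval q x" using u by (auto simp: poly_values_def)
  have "eval (q @ [a]) x = u \<otimes> x \<oplus> a"
    unfolding q by (rule eval_append_aux) (use q a x subringE(1)[OF A] in auto)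
  moreover have "set (q @ [a]) \<subseteq> A" "length (q @ [a]) = Suc n" using q a by auto
  ultimately show ?thesis unfolding poly_values_def by (metis (mono_tags, lifting) mem_Collect_eq)
qed

lemma poly_values_incr:
  assumes A: "subring A R" and x: "x \<in> carrier R" and u: "u \<in> poly_values A x n" and le: "n \<le> m"
  shows "u \<in> poly_values A x m"
  using le
proof (induction m rule: dec_induct)
  case base then show ?case using u .
next
  case (step m)
  then have "\<zero> \<otimes> x [^] m \<oplus> u \<in> poly_values A x (Suc m)" using subringE(2)[OF A] unfolding poly_values_Suc by blast
  then show ?case using x poly_values_carrier[OF subringE(1)[OF A] x step.IH] by simp
qed

lemma poly_values_base: "subring A R \<Longrightarrow> x \<in> carrier R \<Longrightarrow> a \<in> A \<Longrightarrow> a \<in> poly_values A x (Suc n)"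
  using poly_values_mult_var[of A x a \<zero> 0] poly_values_incr[of A x a "Suc 0" "Suc n"] subringE(1)[of A R]
  by (auto simp: poly_values_0)

lemma poly_values_closed:
  assumes A: "subring A R" and x: "x \<in> A" and u: "u \<in> poly_values A x n"
  shows "u \<in> A"
  using u
proof (induction n arbitrary: u)
  case 0 then show ?case using subringE(2)[OF A] by (simp add: poly_values_0)
next
  case (Suc n)
  have "x [^] n \<in> A" for n :: nat
    by (induction n) (use x subringE[OF A] in auto)
  then show ?case using Suc subringE(6,7)[OF A] by (auto simp: poly_values_Suc)
qed

lemma simple_extension_poly_values:
  assumes A: "subring A R" and x: "x \<in> carrier R"
  shows "simple_extension A x = (\<Union>n. poly_values A x n)"
proof safe
  fix u assume "u \<in> simple_extension A x"
  then show "u \<in> (\<Union>n. poly_values A x n)"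
  proof induction
    case zero then show ?case using poly_values_0 by blast
  next
    case (lin k1 k2) then show ?case using poly_values_mult_var[OF A x] by blast
  qed
next
  fix u n assume "u \<in> poly_values A x n"
  then show "u \<in> simple_extension A x"
    using poly_values_closed[OF simple_extension_is_subring[OF A x] simple_extension_mem[OF A x], of u n]
      simple_extension_incl[OF subringE(1)[OF A] x] unfolding poly_values_def by blast
qed

text \<open>
  Reversing the coefficient list: a polynomial of degree \<open>n\<close> in \<open>x\<close>, divided by \<open>x\<^sup>n\<close>, is a polynomial
  of degree \<open>n\<close> in the inverse of \<open>x\<close>.
\<close>
lemma poly_values_flip:
  assumes A: "subring A R" and x: "x \<in> carrier R" "x \<noteq> \<zero>"
  shows "u \<in> poly_values A x (Suc n) \<Longrightarrow> inv x [^] n \<otimes> u \<in> poly_values A (inv x) (Suc n)"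
proof (induction n arbitrary: u)
  case 0
  then obtain a where a: "a \<in> A" "u = a \<otimes> \<one> \<oplus> \<zero>" by (auto simp: poly_values_Suc poly_values_0)
  then have "\<one> \<otimes> u = a" using subringE(1)[OF A] by auto
  then show ?case using a poly_values_base[OF A inverse_props(1)[OF x], of a 0] by simp
next
  case (Suc n)
  note AE = subringE[OF A]
  have ix: "inv x \<in> carrier R" using x by (simp add: inverse_props)
  obtain a b where u: "u = a \<otimes> x [^] (Suc n) \<oplus> b" "a \<in> A" "b \<in> poly_values A x (Suc n)"
    using Suc.prems poly_values_Suc[of A x "Suc n"] by auto
  have car: "a \<in> carrier R" "b \<in> carrier R" "x [^] n \<in> carrier R" "inv x [^] n \<in> carrier R"
    using AE(1) u poly_values_carrier[OF AE(1) x(1)] x ix by auto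
  have 1: "inv x [^] Suc n \<otimes> x [^] Suc n = \<one>" by (rule inverse_pow[OF x])
  have "inv x [^] Suc n \<otimes> u = a \<otimes> (inv x [^] Suc n \<otimes> x [^] Suc n) \<oplus> inv x [^] Suc n \<otimes> b"
    unfolding u using car x ix by (simp add: r_distr m_ac)
  also have "\<dots> = (inv x [^] n \<otimes> b) \<otimes> inv x \<oplus> a"
    unfolding 1 using car ix by (simp add: m_ac a_ac)
  finally show ?case using poly_values_mult_var[OF A ix u(2) Suc.IH[OF u(3)]] by simp
qed

lemma integral_closure_iff:
  assumes A: "subring A R"
  shows "x \<in> integral_closure R A \<longleftrightarrow> x \<in> carrier R \<and> (\<exists>n. x [^] n \<in> poly_values A x n)"
proof (intro iffI conjI)
  note AE = subringE[OF A]
  assume "x \<in> integral_closure R A"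
  then obtain f where x: "x \<in> carrier R" and f: "polynomial A f" "f \<noteq> []" "hd f = \<one>" "eval f x = \<zero>"
    unfolding integral_closure_def univ_poly_carrier by auto
  show "x \<in> carrier R" by fact
  obtain q where q: "f = \<one> # q" using f by (cases f) auto
  have qA: "set q \<subseteq> A" using f(1) unfolding polynomial_def q by auto
  have qc: "eval q x \<in> carrier R" using qA AE(1) x by (intro eval_in_carrier) auto
  have "x [^] length q \<oplus> eval q x = \<zero>" using f(4) x unfolding q by simp
  then have "x [^] length q = \<ominus> \<one> \<otimes> eval q x"
    using x qc by (simp add: l_minus minus_equality add.inv_solve_right' sum_zero_eq_neg)
  also have "\<dots> \<in> poly_values A x (length q)"
    by (rule poly_values_smult[OF A x]) (use AE qA in \<open>auto simp: poly_values_def\<close>)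
  finally show "\<exists>n. x [^] n \<in> poly_values A x n" ..
next
  note AE = subringE[OF A]
  assume "x \<in> carrier R \<and> (\<exists>n. x [^] n \<in> poly_values A x n)"
  then obtain n where x: "x \<in> carrier R" and "x [^] n \<in> poly_values A x n" by auto
  then have "\<ominus> \<one> \<otimes> x [^] n \<in> poly_values A x n" using poly_values_smult[OF A x] AE by blast
  then obtain q where q: "set q \<subseteq> A" "length q = n" "\<ominus> \<one> \<otimes> x [^] n = eval q x" by (auto simp: poly_values_def)
  have "eval (\<one> # q) x = \<zero>" using x q(2,3)[symmetric] by (simp add: l_minus r_neg)
  moreover have "polynomial A (\<one> # q)" using q AE by (auto simp: polynomial_def)
  ultimately show "x \<in> integral_closure R A"
    using x unfolding integral_closure_def univ_poly_carrier by force
qed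

lemma integral_closure_mono:
  assumes "A \<subseteq> B" shows "integral_closure R A \<subseteq> integral_closure R B"
proof -
  have "carrier (univ_poly R A) \<subseteq> carrier (univ_poly R B)"
    using assms unfolding univ_poly_def polynomial_def by auto
  then show ?thesis unfolding integral_closure_def by blast
qed

lemma integral_closure_carrier: "x \<in> integral_closure R A \<Longrightarrow> x \<in> carrier R"
  by (simp add: integral_closure_def)

text \<open>
  Dividing an integral equation of degree \<open>n\<close> by \<open>x\<^sup>n\<^sup>-\<^sup>1\<close> writes \<open>x\<close> as a polynomial in its inverse. This
  makes valuation rings integrally closed, and it decides the integrality of rational and \<open>p\<close>-adic numbers.
\<close>
lemma integral_inverse_mem:
  assumes A: "subring A R" and x: "x \<in> integral_closure R A" "inv x \<in> A" "x \<noteq> \<zero>"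
  shows "x \<in> A"
proof -
  obtain n where n: "x [^] n \<in> poly_values A x n" and xc: "x \<in> carrier R"
    using x integral_closure_iff[OF A] by auto
  obtain m where m: "n = Suc m" using n xc by (cases n) (auto simp: poly_values_0)
  have ix: "inv x \<in> carrier R" using xc x by (simp add: inverse_props)
  have 1: "inv x [^] m \<otimes> x [^] m = \<one>" by (rule inverse_pow[OF xc x(3)])
  have "inv x [^] m \<otimes> x [^] n \<in> A"
    using poly_values_closed[OF A x(2)] poly_values_flip[OF A xc x(3)] n unfolding m by blast
  also have "inv x [^] m \<otimes> x [^] n = x"
    using 1 xc ix unfolding m by (simp add: m_assoc[symmetric])
  finally show ?thesis .
qed

lemma subring_subset_integral_closure:
  assumes A: "subring A R" shows "A \<subseteq> integral_closure R A"
proof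
  fix a assume a: "a \<in> A"
  then have "a \<in> carrier R" using subringE(1)[OF A] by auto
  moreover have "a [^] Suc 0 \<in> poly_values A a (Suc 0)" using poly_values_base[OF A] a calculation by simp
  ultimately show "a \<in> integral_closure R A" unfolding integral_closure_iff[OF A] by blast
qed

definition valuation_ring :: "'a set \<Rightarrow> bool" where
  "valuation_ring V \<longleftrightarrow> subring V R \<and> (\<forall>x \<in> carrier R. x \<notin> V \<longrightarrow> inv x \<in> V)"

lemma valuation_ring_integrally_closed:
  assumes "valuation_ring V" shows "integral_closure R V \<subseteq> V"
  using assms integral_inverse_mem[of V] integral_closure_carrier subringE(2)[of V R]
  unfolding valuation_ring_def by (metis subsetI)

text \<open>
  Once the power \<open>x\<^sup>m\<close> is a combination of lower powers, so is every higher power.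
\<close>
lemma poly_values_reduce:
  assumes A: "subring A R" and x: "x \<in> carrier R"
    and red: "x [^] m \<in> poly_values A x m" and mn: "m \<le> n" and u: "u \<in> poly_values A x (Suc n)"
  shows "u \<in> poly_values A x n"
proof -
  have xn: "x [^] n \<in> poly_values A x n" using mn
  proof (induction n rule: dec_induct)
    case base then show ?case by (rule red)
  next
    case (step n)
    show ?case using poly_values_mult_var[OF A x subringE(2)[OF A] step.IH] x by simp
  qed
  show ?thesis using u poly_values_add[OF A x poly_values_smult[OF A x _ xn]] by (auto simp: poly_values_Suc)
qed

text \<open>
  Krull's existence theorem. If \<open>c\<close> is not integral over \<open>A\<close>, it does not lie in \<open>A[d]\<close> for its
  inverse \<open>d\<close>, and a subring maximal among those that contain \<open>A\<close> and \<open>d\<close> but not \<open>c\<close> is a valuation ring.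
  Indeed, if neither \<open>y\<close> nor its inverse is in such a subring \<open>V\<close>, then \<open>c\<close> is a polynomial over
  \<open>V\<close> in each of them. Take both degrees minimal. The shorter of the two expressions
  rewrites the top power of the longer one in lower powers, against minimality.
\<close>
lemma valuation_ring_avoiding_nonintegral:
  assumes A: "subring A R" and c: "c \<in> carrier R" "c \<notin> integral_closure R A"
  obtains V where "valuation_ring V" "A \<subseteq> V" "c \<notin> V"
proof -
  have c0: "c \<noteq> \<zero>" using c A subring_subset_integral_closure[OF A] subringE(2)[OF A] by auto
  define d where "d = inv c"
  have d: "d \<in> carrier R" "d \<otimes> c = \<one>" "c \<otimes> d = \<one>" "d \<noteq> \<zero>" "inv d = c"
    using c0 c(1) unfolding d_def by (simp_all add: inverse_props)
  define P where "P = {V. subring V R \<and> A \<subseteq> V \<and> d \<in> V \<and> c \<notin> V}"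
  have "c \<notin> simple_extension A d"
  proof
    assume "c \<in> simple_extension A d"
    then obtain n where n: "c \<in> poly_values A d n" unfolding simple_extension_poly_values[OF A d(1)] by auto
    then have "inv d [^] n \<otimes> c \<in> poly_values A (inv d) (Suc n)"
      using poly_values_flip[OF A d(1) d(4) poly_values_incr[OF A d(1) n]] by simp
    then have "c [^] Suc n \<in> poly_values A c (Suc n)" using d by simp
    then show False using c integral_closure_iff[OF A] by blast
  qed
  then have "simple_extension A d \<in> P"
    using simple_extension_is_subring[OF A d(1)] simple_extension_incl[OF subringE(1)[OF A] d(1)]
      simple_extension_mem[OF A d(1)] by (auto simp: P_def)
  then have "\<exists>M\<in>P. \<forall>W\<in>P. M \<subseteq> W \<longrightarrow> W = M"
  proof (intro subset_Zorn_nonempty)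
    fix C assume C: "C \<noteq> {}" "subset.chain P C"
    then have CP: "C \<subseteq> P" and ch: "\<And>W Y. W \<in> C \<Longrightarrow> Y \<in> C \<Longrightarrow> W \<subseteq> Y \<or> Y \<subseteq> W"
      by (auto simp: subset_chain_def)
    have sub: "\<And>W. W \<in> C \<Longrightarrow> subring W R" using CP by (auto simp: P_def)
    have pair: "\<exists>W\<in>C. a \<in> W \<and> b \<in> W" if "a \<in> \<Union>C" "b \<in> \<Union>C" for a b
      using that ch by blast
    have "subring (\<Union>C) R"
    proof (rule subringI)
      show "\<Union>C \<subseteq> carrier R" using sub subringE(1) by blast
      show "\<one> \<in> \<Union>C" using sub subringE(3) C(1) by blast
      show "\<ominus> h \<in> \<Union>C" if "h \<in> \<Union>C" for h
        using pair[OF that that] subringE(5)[OF sub] by (metis UnionI)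
      show "h \<otimes> k \<in> \<Union>C" if "h \<in> \<Union>C" "k \<in> \<Union>C" for h k
        using pair[OF that] subringE(6)[OF sub] by (metis UnionI)
      show "h \<oplus> k \<in> \<Union>C" if "h \<in> \<Union>C" "k \<in> \<Union>C" for h k
        using pair[OF that] subringE(7)[OF sub] by (metis UnionI)
    qed
    then show "\<Union>C \<in> P" using CP C(1) unfolding P_def by blast
  qed blast
  then obtain V where V: "V \<in> P" and max: "\<And>W. W \<in> P \<Longrightarrow> V \<subseteq> W \<Longrightarrow> W = V" by blast
  have Vs: "subring V R" and AV: "A \<subseteq> V" and dV: "d \<in> V" and cV: "c \<notin> V" using V by (auto simp: P_def)
  note VE = subringE[OF Vs]
  have ext: "c \<in> simple_extension V y" if "y \<in> carrier R" "y \<notin> V" for y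
  proof (rule ccontr)
    assume "c \<notin> simple_extension V y"
    then have "simple_extension V y \<in> P"
      using simple_extension_is_subring[OF Vs that(1)] simple_extension_incl[OF VE(1) that(1)] AV dV
      by (auto simp: P_def)
    then show False using max simple_extension_incl[OF VE(1) that(1)] simple_extension_mem[OF Vs that(1)] that by blast
  qed
  \<comment> \<open>The maximal subring behaves like a local ring with \<open>d\<close> in the maximal ideal: were the inverse of
    \<open>w = 1 - d b\<close> missing, some \<open>w\<^sup>n c\<close> would lie in \<open>V\<close>, and \<open>c w = c - b\<close> strips the factors \<open>w\<close>.\<close>
  have unit: "inv (\<one> \<ominus> d \<otimes> b) \<in> V" "\<one> \<ominus> d \<otimes> b \<noteq> \<zero>" if b: "b \<in> V" for b
  proof -
    define w where "w = \<one> \<ominus> d \<otimes> b"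
    have bc: "b \<in> carrier R" using b VE by auto
    have w: "w \<in> V" "w \<in> carrier R" unfolding w_def a_minus_def using VE(6)[OF dV b] VE(3,5,7) VE(1) by blast+
    have "c \<otimes> w \<oplus> (c \<otimes> d) \<otimes> b = c" unfolding w_def using c(1) d(1) bc by algebra
    then have cw: "c \<otimes> w \<oplus> b = c" using d bc by simp
    show w0: "\<one> \<ominus> d \<otimes> b \<noteq> \<zero>"
      using cw b bc c(1) cV unfolding w_def[symmetric] by auto
    show "inv (\<one> \<ominus> d \<otimes> b) \<in> V"
    proof (rule ccontr)
      assume "inv (\<one> \<ominus> d \<otimes> b) \<notin> V"
      then have wi: "inv w \<notin> V" "inv w \<in> carrier R" "w \<noteq> \<zero>" and iiw: "inv (inv w) = w"
        unfolding w_def[symmetric] using w0[folded w_def] w inverse_props[of w] by auto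
      have iw0: "inv w \<noteq> \<zero>" using VE(2) wi(1) by metis
      obtain n where "c \<in> poly_values V (inv w) n" using ext[OF wi(2,1)] unfolding simple_extension_poly_values[OF Vs wi(2)] by auto
      then have "inv (inv w) [^] n \<otimes> c \<in> poly_values V (inv (inv w)) (Suc n)"
        using poly_values_flip[OF Vs wi(2) iw0 poly_values_incr[OF Vs wi(2)]] by simp
      then have "w [^] n \<otimes> c \<in> V" using poly_values_closed[OF Vs w(1)] unfolding iiw by blast
      moreover have "w [^] n \<otimes> c \<in> V \<Longrightarrow> c \<in> V" for n :: nat
      proof (induction n)
        case 0 then show ?case using c by simp
      next
        case (Suc n)
        have wn: "w [^] n \<in> V" for n :: nat by (induction n) (use w VE in auto)
        then have wnc: "w [^] n \<in> carrier R" using VE by auto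
        have "w [^] n \<otimes> (c \<otimes> w \<oplus> b) = w [^] Suc n \<otimes> c \<oplus> w [^] n \<otimes> b"
          using wnc w bc c(1) by (simp add: r_distr m_ac)
        also have "\<dots> \<in> V" using Suc.prems wn b VE by auto
        finally show ?case using Suc.IH unfolding cw by simp
      qed
      ultimately show False using cV by blast
    qed
  qed
  \<comment> \<open>An expression of \<open>c\<close> of degree \<open>m\<close> in the inverse of \<open>y\<close> yields an equation for \<open>y\<^sup>m\<close>: its constant
    term is moved to the left, where the unit above absorbs it, and everything is multiplied by \<open>y\<^sup>m\<close>.\<close>
  have red: "y [^] m \<in> poly_values V y m"
    if y: "y \<in> carrier R" "y \<noteq> \<zero>" and cy: "c \<in> poly_values V (inv y) (Suc m)" for y m
  proof -
    have iy: "inv y \<in> carrier R" "inv y \<noteq> \<zero>" "inv (inv y) = y" using y by (auto simp: inverse_props)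
    obtain q where q: "set q \<subseteq> V" "length q = Suc m" "c = eval q (inv y)" using cy by (auto simp: poly_values_def)
    obtain r b where rb: "q = r @ [b]" using q(2) by (cases q rule: rev_cases) auto
    define e where "e = eval r (inv y)"
    have b: "b \<in> V" "b \<in> carrier R" and r: "set r \<subseteq> V" "length r = m" using q VE unfolding rb by auto
    have e: "e \<in> poly_values V (inv y) m" "e \<in> carrier R" using r VE iy unfolding e_def poly_values_def by (auto intro!: eval_in_carrier)
    have ce: "c = e \<otimes> inv y \<oplus> b"
      unfolding q(3) rb e_def using r b VE iy by (intro eval_append_aux) auto
    define w where "w = \<one> \<ominus> d \<otimes> b"
    have w: "inv w \<in> V" "w \<noteq> \<zero>" "w \<in> carrier R" using unit[OF b(1)] b d(1) by (auto simp: w_def)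
    have "c \<otimes> w = c \<ominus> (c \<otimes> d) \<otimes> b" unfolding w_def using c d(1) b by algebra
    also have "\<dots> = c \<ominus> b" using d b c by simp
    also have "\<dots> = e \<otimes> inv y" unfolding ce using e(2) b(2) iy(1) by algebra
    finally have cw: "c \<otimes> w = e \<otimes> inv y" .
    have iw: "inv w \<in> carrier R" "w \<otimes> inv w = \<one>" using w by (auto simp: inverse_props)
    have "(d \<otimes> inv w) \<otimes> (c \<otimes> w) = (d \<otimes> c) \<otimes> (w \<otimes> inv w)" using c d(1) w iw(1) by (simp add: m_ac)
    then have one: "(d \<otimes> inv w) \<otimes> (e \<otimes> inv y) = \<one>" using cw d iw by simp
    have m: "m \<noteq> 0"
    proof
      assume "m = 0"
      then have "e = \<zero>" using e by (simp add: poly_values_0)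
      then show False using one c d iw iy by simp
    qed
    then obtain k where k: "m = Suc k" by (cases m) auto
    have fe: "y [^] k \<otimes> e \<in> poly_values V y m" using poly_values_flip[OF Vs iy(1,2), of e k] e unfolding k iy by simp
    have dw: "d \<otimes> inv w \<in> V" using dV w VE by auto
    have "y [^] m = y [^] m \<otimes> ((d \<otimes> inv w) \<otimes> (e \<otimes> inv y))" using one y by simp
    also have "\<dots> = ((d \<otimes> inv w) \<otimes> (y [^] k \<otimes> e)) \<otimes> (y \<otimes> inv y)"
      unfolding k using y iy(1) iw(1) e d(1) by (simp add: m_ac)
    also have "\<dots> = (d \<otimes> inv w) \<otimes> (y [^] k \<otimes> e)" using y iy(1) iw(1) e d(1) by (simp add: field_Units)
    also have "\<dots> \<in> poly_values V y m" by (rule poly_values_smult[OF Vs y(1) dw fe])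
    finally show ?thesis .
  qed
  have "valuation_ring V"
    unfolding valuation_ring_def
  proof (intro conjI ballI impI)
    show "subring V R" by fact
    fix y assume y: "y \<in> carrier R" "y \<notin> V"
    show "inv y \<in> V"
    proof (rule ccontr)
      assume iyV: "inv y \<notin> V"
      have y0: "y \<noteq> \<zero>" using y VE by auto
      have iy: "inv y \<in> carrier R" "inv y \<noteq> \<zero>" "inv (inv y) = y" using y y0 by (auto simp: inverse_props)
      have ex: "\<exists>n. c \<in> poly_values V z (Suc n)" if "z \<in> carrier R" "z \<notin> V" for z
        using ext[OF that] poly_values_incr[OF Vs that(1)] unfolding simple_extension_poly_values[OF Vs that(1)]
        by (metis UN_iff le_SucI order_refl)
      define n where "n = (LEAST n. c \<in> poly_values V y (Suc n))"
      define m where "m = (LEAST n. c \<in> poly_values V (inv y) (Suc n))"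
      have n: "c \<in> poly_values V y (Suc n)" unfolding n_def by (rule LeastI_ex) (rule ex[OF y])
      have m: "c \<in> poly_values V (inv y) (Suc m)" unfolding m_def by (rule LeastI_ex) (rule ex[OF iy(1) iyV])
      have nl: "c \<notin> poly_values V y n"
      proof
        assume a: "c \<in> poly_values V y n"
        then obtain k where k: "n = Suc k" using c0 by (cases n) (auto simp: poly_values_0)
        then show False using Least_le[of "\<lambda>n. c \<in> poly_values V y (Suc n)" k] a unfolding n_def[symmetric] by simp
      qed
      have ml: "c \<notin> poly_values V (inv y) m"
      proof
        assume a: "c \<in> poly_values V (inv y) m"
        then obtain k where k: "m = Suc k" using c0 by (cases m) (auto simp: poly_values_0)
        then show False using Least_le[of "\<lambda>n. c \<in> poly_values V (inv y) (Suc n)" k] a unfolding m_def[symmetric] by simp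
      qed
      show False
      proof (cases "m \<le> n")
        case True
        then show False using poly_values_reduce[OF Vs y(1) red[OF y(1) y0 m] True n] nl by blast
      next
        case False
        have "c \<in> poly_values V (inv (inv y)) (Suc n)" using n iy by simp
        then show False using poly_values_reduce[OF Vs iy(1) red[OF iy(1,2), of n], of m c] m ml False by simp
      qed
    qed
  qed
  then show ?thesis using that AV cV by blast
qed

lemma integral_closure_eq_Inter:
  assumes A: "subring A R"
  shows "integral_closure R A = \<Inter>{V. valuation_ring V \<and> A \<subseteq> V}"
proof
  show "integral_closure R A \<subseteq> \<Inter>{V. valuation_ring V \<and> A \<subseteq> V}"
    using valuation_ring_integrally_closed integral_closure_mono by blast
  have "valuation_ring (carrier R)"
    unfolding valuation_ring_def using carrier_is_subring by auto
  then have "x \<in> carrier R" if "x \<in> \<Inter>{V. valuation_ring V \<and> A \<subseteq> V}" for x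
    using that subringE(1)[OF A] by auto
  then show "\<Inter>{V. valuation_ring V \<and> A \<subseteq> V} \<subseteq> integral_closure R A"
    using valuation_ring_avoiding_nonintegral[OF A] by blast
qed

lemma integral_closure_subring:
  assumes A: "subring A R"
  shows "subring (integral_closure R A) R"
proof -
  have "valuation_ring (carrier R)"
    unfolding valuation_ring_def using carrier_is_subring by auto
  then show ?thesis
    unfolding integral_closure_eq_Inter[OF A]
    using subringE(1)[OF A] by (intro subring_Inter) (auto simp: valuation_ring_def)
qed

end

section \<open>Extending homomorphisms to algebraically closed fields\<close>

text \<open>
  Evaluating transported polynomials at \<open>x\<close> is a homomorphism on \<open>F[X]\<close> that kills the minimal
  polynomial of \<open>s\<close>, hence factors through evaluation at \<open>s\<close>, whose image is the simple extension.
\<close>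
lemma extend_hom_simple_extension:
  assumes L: "field L" and K: "field K" and F: "subfield F L"
    and s: "s \<in> carrier L" "(ring.algebraic L over F) s"
    and \<phi>: "\<phi> \<in> ring_hom (L\<lparr>carrier := F\<rparr>) K"
    and x: "x \<in> carrier K" "ring.eval K (map \<phi> (ring.Irr L F s)) x = \<zero>\<^bsub>K\<^esub>"
  obtains \<psi> where "\<psi> \<in> ring_hom (L\<lparr>carrier := ring.simple_extension L F s\<rparr>) K"
    "\<And>a. a \<in> F \<Longrightarrow> \<psi> a = \<phi> a" "\<psi> s = x"
proof -
  interpret L: field L by fact
  interpret K: field K by fact
  have Fs: "subring F L" using subfieldE(1)[OF F] .
  interpret P: domain "F[X]\<^bsub>L\<^esub>" using L.univ_poly_is_domain[OF Fs] .
  interpret phi: ring_hom_ring "L\<lparr>carrier := F\<rparr>" K \<phi>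
    by (rule ring_hom_ringI2[OF L.subring_is_ring[OF Fs] K.ring_axioms \<phi>])
  define ev where "ev p = K.eval (map \<phi> p) x" for p
  have set: "set p \<subseteq> F" if "p \<in> carrier (F[X]\<^bsub>L\<^esub>)" for p
    using that unfolding univ_poly_carrier[symmetric] polynomial_def by auto
  have img: "set (map \<phi> p) \<subseteq> carrier K" if "set p \<subseteq> F" for p using that phi.hom_closed by auto
  have evm: "ev (p \<otimes>\<^bsub>F[X]\<^bsub>L\<^esub>\<^esub> q) = ev p \<otimes>\<^bsub>K\<^esub> ev q"
    if p: "p \<in> carrier (F[X]\<^bsub>L\<^esub>)" and q: "q \<in> carrier (F[X]\<^bsub>L\<^esub>)" for p q
  proof -
    have "ev (L.poly_mult p q) = K.eval (K.normalize (map \<phi> (L.poly_mult p q))) x"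
      unfolding ev_def using set[OF P.m_closed[OF p q]] x img
      by (intro K.eval_normalize[symmetric]) (auto simp: univ_poly_mult)
    also have "\<dots> = K.eval (K.poly_mult (map \<phi> p) (map \<phi> q)) x"
      using phi.poly_mult_hom'[of p q] set[OF p] set[OF q] by (simp add: L.poly_mult_consistent[OF Fs])
    also have "\<dots> = ev p \<otimes>\<^bsub>K\<^esub> ev q"
      unfolding ev_def using img[OF set[OF p]] img[OF set[OF q]] x(1) by (intro K.eval_poly_mult)
    finally show ?thesis by (simp add: univ_poly_mult)
  qed
  have eva: "ev (p \<oplus>\<^bsub>F[X]\<^bsub>L\<^esub>\<^esub> q) = ev p \<oplus>\<^bsub>K\<^esub> ev q"
    if p: "p \<in> carrier (F[X]\<^bsub>L\<^esub>)" and q: "q \<in> carrier (F[X]\<^bsub>L\<^esub>)" for p q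
  proof -
    have "ev (L.poly_add p q) = K.eval (K.normalize (map \<phi> (L.poly_add p q))) x"
      unfolding ev_def using set[OF P.a_closed[OF p q]] x img
      by (intro K.eval_normalize[symmetric]) (auto simp: univ_poly_add)
    also have "\<dots> = K.eval (K.poly_add (map \<phi> p) (map \<phi> q)) x"
      using phi.poly_add_hom'[of p q] set[OF p] set[OF q] by (simp add: L.poly_add_consistent[OF Fs])
    also have "\<dots> = ev p \<oplus>\<^bsub>K\<^esub> ev q"
      unfolding ev_def using img[OF set[OF p]] img[OF set[OF q]] x(1) by (intro K.eval_poly_add)
    finally show ?thesis by (simp add: univ_poly_add)
  qed
  have ev1: "ev \<one>\<^bsub>F[X]\<^bsub>L\<^esub>\<^esub> = \<one>\<^bsub>K\<^esub>"
    unfolding ev_def univ_poly_one using x(1) phi.hom_one by simp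
  have evh: "ev \<in> ring_hom (F[X]\<^bsub>L\<^esub>) K"
  proof (rule ring_hom_memI)
    show "ev p \<in> carrier K" if "p \<in> carrier (F[X]\<^bsub>L\<^esub>)" for p
      unfolding ev_def by (rule K.eval_in_carrier[OF img[OF set[OF that]] x(1)])
  qed (use evm eva ev1 in auto)
  interpret ev: ring_hom_ring "F[X]\<^bsub>L\<^esub>" K ev
    by (rule ring_hom_ringI2[OF P.ring_axioms K.ring_axioms evh])
  interpret es: ring_hom_ring "F[X]\<^bsub>L\<^esub>" L "\<lambda>p. L.eval p s" by (rule L.eval_ring_hom[OF Fs s(1)])
  have ker: "ev p = \<zero>\<^bsub>K\<^esub>" if p: "p \<in> carrier (F[X]\<^bsub>L\<^esub>)" "L.eval p s = \<zero>\<^bsub>L\<^esub>" for p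
  proof -
    note I = L.IrrE[OF F s]
    have "L.Irr F s pdivides\<^bsub>L\<^esub> p" by (rule L.Irr_minimal[OF F s p])
    then have "L.Irr F s divides\<^bsub>F[X]\<^bsub>L\<^esub>\<^esub> p" using L.pdivides_iff_shell[OF F I(1) p(1)] by simp
    then obtain q where q: "q \<in> carrier (F[X]\<^bsub>L\<^esub>)" "p = L.Irr F s \<otimes>\<^bsub>F[X]\<^bsub>L\<^esub>\<^esub> q"
      unfolding factor_def by auto
    have "ev (L.Irr F s) = \<zero>\<^bsub>K\<^esub>" using x(2) by (simp add: ev_def)
    then show ?thesis unfolding q(2) using evm[OF I(1) q(1)] ev.hom_closed[OF q(1)] by simp
  qed
  have wd: "ev p = ev q" if p: "p \<in> carrier (F[X]\<^bsub>L\<^esub>)" and q: "q \<in> carrier (F[X]\<^bsub>L\<^esub>)"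
    and e: "L.eval p s = L.eval q s" for p q
  proof -
    have "L.eval (p \<oplus>\<^bsub>F[X]\<^bsub>L\<^esub>\<^esub> (\<ominus>\<^bsub>F[X]\<^bsub>L\<^esub>\<^esub> q)) s = \<zero>\<^bsub>L\<^esub>"
      using p q e es.hom_closed[OF q] by (simp add: L.r_neg)
    then have "ev (p \<oplus>\<^bsub>F[X]\<^bsub>L\<^esub>\<^esub> (\<ominus>\<^bsub>F[X]\<^bsub>L\<^esub>\<^esub> q)) = \<zero>\<^bsub>K\<^esub>" using ker p q by simp
    then have "ev p \<oplus>\<^bsub>K\<^esub> (\<ominus>\<^bsub>K\<^esub> ev q) = \<zero>\<^bsub>K\<^esub>" using p q by simp
    then show ?thesis using ev.hom_closed[OF p] ev.hom_closed[OF q] by (metis K.add.inv_closed K.minus_equality K.minus_minus)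
  qed
  \<comment> \<open>Any polynomial representing \<open>u\<close> at \<open>s\<close> will do, by the well-definedness just shown.\<close>
  define \<psi> where "\<psi> u = ev (SOME p. p \<in> carrier (F[X]\<^bsub>L\<^esub>) \<and> L.eval p s = u)" for u
  have \<psi>: "\<psi> (L.eval p s) = ev p" if "p \<in> carrier (F[X]\<^bsub>L\<^esub>)" for p
  proof -
    have "(SOME q. q \<in> carrier (F[X]\<^bsub>L\<^esub>) \<and> L.eval q s = L.eval p s) \<in> carrier (F[X]\<^bsub>L\<^esub>) \<and>
      L.eval (SOME q. q \<in> carrier (F[X]\<^bsub>L\<^esub>) \<and> L.eval q s = L.eval p s) s = L.eval p s"
      by (rule someI[of _ p]) (use that in simp)
    then show ?thesis unfolding \<psi>_def using wd that by blast
  qed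
  have E: "L.simple_extension F s = (\<lambda>p. L.eval p s) ` carrier (F[X]\<^bsub>L\<^esub>)"
    by (rule L.simple_extension_as_eval_img[OF subringE(1)[OF Fs] s(1)])
  have "\<psi> \<in> ring_hom (L\<lparr>carrier := L.simple_extension F s\<rparr>) K"
  proof (rule ring_hom_memI)
    fix u v assume "u \<in> carrier (L\<lparr>carrier := L.simple_extension F s\<rparr>)" "v \<in> carrier (L\<lparr>carrier := L.simple_extension F s\<rparr>)"
    then obtain p q where p: "p \<in> carrier (F[X]\<^bsub>L\<^esub>)" "u = L.eval p s" and q: "q \<in> carrier (F[X]\<^bsub>L\<^esub>)" "v = L.eval q s"
      unfolding E by auto
    show "\<psi> u \<in> carrier K" using p by (simp add: \<psi>)
    have "u \<otimes>\<^bsub>L\<^esub> v = L.eval (p \<otimes>\<^bsub>F[X]\<^bsub>L\<^esub>\<^esub> q) s" using p q by simp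
    then show "\<psi> (u \<otimes>\<^bsub>L\<lparr>carrier := L.simple_extension F s\<rparr>\<^esub> v) = \<psi> u \<otimes>\<^bsub>K\<^esub> \<psi> v"
      using \<psi>[OF P.m_closed[OF p(1) q(1)]] p q by (simp add: \<psi>)
    have "u \<oplus>\<^bsub>L\<^esub> v = L.eval (p \<oplus>\<^bsub>F[X]\<^bsub>L\<^esub>\<^esub> q) s" using p q by simp
    then show "\<psi> (u \<oplus>\<^bsub>L\<lparr>carrier := L.simple_extension F s\<rparr>\<^esub> v) = \<psi> u \<oplus>\<^bsub>K\<^esub> \<psi> v"
      using \<psi>[OF P.a_closed[OF p(1) q(1)]] p q by (simp add: \<psi>)
  next
    show "\<psi> \<one>\<^bsub>L\<lparr>carrier := L.simple_extension F s\<rparr>\<^esub> = \<one>\<^bsub>K\<^esub>"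
      using \<psi>[OF P.one_closed] ev1 by simp
  qed
  moreover have "\<psi> a = \<phi> a" if a: "a \<in> F" for a
  proof (cases "a = \<zero>\<^bsub>L\<^esub>")
    case True
    have z: "\<phi> \<zero>\<^bsub>L\<^esub> = \<zero>\<^bsub>K\<^esub>" using phi.hom_zero by simp
    have "[] \<in> carrier (F[X]\<^bsub>L\<^esub>)" by (auto simp: univ_poly_carrier[symmetric] polynomial_def)
    from \<psi>[OF this] show ?thesis using True z by (simp add: ev_def)
  next
    case False
    then have "[a] \<in> carrier (F[X]\<^bsub>L\<^esub>)" using a by (auto simp: univ_poly_carrier[symmetric] polynomial_def)
    from \<psi>[OF this] show ?thesis
      using a subringE(1)[OF Fs] s(1) x(1) phi.hom_closed[of a] by (auto simp: ev_def)
  qed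
  moreover have "\<psi> s = x"
  proof -
    have "[\<one>\<^bsub>L\<^esub>, \<zero>\<^bsub>L\<^esub>] \<in> carrier (F[X]\<^bsub>L\<^esub>)"
      using subringE(2,3)[OF Fs] by (auto simp: univ_poly_carrier[symmetric] polynomial_def)
    from \<psi>[OF this] show ?thesis using s(1) x(1) phi.hom_zero phi.hom_one by (simp add: ev_def)
  qed
  ultimately show ?thesis using that by blast
qed

text \<open>
  Sending \<open>\<alpha>\<close> to any of its conjugates can be continued to \<open>s\<close>, because the image of the minimal polynomial
  of \<open>s\<close> over \<open>F(\<alpha>)\<close> has a root in an algebraically closed field. When \<open>\<alpha> = g(s)\<close>, this shows that
  every conjugate of \<open>\<alpha>\<close> is \<open>g\<close> evaluated at a conjugate of \<open>s\<close>.
\<close>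
lemma extend_hom_root:
  assumes L: "field L" and K: "algebraically_closed K" and F: "subfield F L"
    and s: "s \<in> carrier L" "(ring.algebraic L over F) s"
    and \<alpha>: "\<alpha> \<in> carrier L" "(ring.algebraic L over F) \<alpha>"
    and \<phi>: "\<phi> \<in> ring_hom (L\<lparr>carrier := F\<rparr>) K"
    and y: "y \<in> carrier K" "ring.eval K (map \<phi> (ring.Irr L F \<alpha>)) y = \<zero>\<^bsub>K\<^esub>"
  obtains E \<psi> where "subring E L" "F \<subseteq> E" "s \<in> E" "\<alpha> \<in> E" "\<psi> \<in> ring_hom (L\<lparr>carrier := E\<rparr>) K"
    "\<And>a. a \<in> F \<Longrightarrow> \<psi> a = \<phi> a" "\<psi> \<alpha> = y"
proof -
  interpret L: field L by fact
  interpret K: algebraically_closed K by fact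
  have Fs: "subring F L" using subfieldE(1)[OF F] .
  define G where "G = L.simple_extension F \<alpha>"
  obtain \<psi>1 where \<psi>1: "\<psi>1 \<in> ring_hom (L\<lparr>carrier := G\<rparr>) K" "\<And>a. a \<in> F \<Longrightarrow> \<psi>1 a = \<phi> a" "\<psi>1 \<alpha> = y"
    using extend_hom_simple_extension[OF L K.field_axioms F \<alpha> \<phi> y] unfolding G_def by blast
  have G: "subfield G L" unfolding G_def using L.simple_extension_is_subfield[OF F \<alpha>(1)] \<alpha>(2) by simp
  have FG: "F \<subseteq> G" "\<alpha> \<in> G" unfolding G_def
    using L.simple_extension_incl[OF subringE(1)[OF Fs] \<alpha>(1)] L.simple_extension_mem[OF Fs \<alpha>(1)] by auto
  have sG: "(L.algebraic over G) s" by (rule L.algebraic_mono[OF FG(1) s(2)])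
  have Gs: "subring G L" using subfieldE(1)[OF G] .
  note I = L.IrrE[OF G s(1) sG]
  define D where "D = map \<psi>1 (L.Irr G s)"
  have Ip: "L.Irr G s \<in> carrier (poly_ring (L\<lparr>carrier := G\<rparr>))"
    using I(1) L.univ_poly_consistent[OF Gs] by simp
  have D: "D \<in> carrier (poly_ring K)" unfolding D_def
    by (rule polynomial_hom[OF \<psi>1(1) _ K.field_axioms Ip]) (use L.subfield_iff(2)[OF G] in simp)
  have deg: "length D - 1 > 0" unfolding D_def using L.pirreducible_degree[OF G I(1,2)] by simp
  have "K.splitted D" by (rule K.roots_over_carrier[OF D])
  then have "K.roots D \<noteq> {#}" using deg unfolding K.splitted_def by auto
  then obtain x where "x \<in># K.roots D" by blast
  then have x: "x \<in> carrier K" "K.eval D x = \<zero>\<^bsub>K\<^esub>"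
    using K.roots_mem_iff_is_root[OF D] unfolding K.is_root_def by auto
  obtain \<psi> where \<psi>: "\<psi> \<in> ring_hom (L\<lparr>carrier := L.simple_extension G s\<rparr>) K" "\<And>a. a \<in> G \<Longrightarrow> \<psi> a = \<psi>1 a"
    using extend_hom_simple_extension[OF L K.field_axioms G s(1) sG \<psi>1(1) x(1)] x(2) unfolding D_def by blast
  have GE: "G \<subseteq> L.simple_extension G s" "s \<in> L.simple_extension G s"
    using L.simple_extension_incl[OF subringE(1)[OF Gs] s(1)] L.simple_extension_mem[OF Gs s(1)] by auto
  show ?thesis
    by (rule that[OF L.simple_extension_is_subring[OF Gs s(1)] _ _ _ \<psi>(1)])
      (use GE FG \<psi>(2) \<psi>1 in auto)
qed

lemma hom_integral:
  assumes L: "field L" and K: "field K" and E: "subring E L"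
    and \<psi>: "\<psi> \<in> ring_hom (L\<lparr>carrier := E\<rparr>) K"
    and A: "A \<subseteq> E" and B: "\<psi> ` A \<subseteq> B" and u: "u \<in> integral_closure L A" "u \<in> E"
  shows "\<psi> u \<in> integral_closure K B"
proof -
  interpret L: field L by fact
  interpret K: field K by fact
  interpret h: ring_hom_ring "L\<lparr>carrier := E\<rparr>" K \<psi>
    by (rule ring_hom_ringI2[OF L.subring_is_ring[OF E] K.ring_axioms \<psi>])
  obtain f where f: "polynomial\<^bsub>L\<^esub> A f" "f \<noteq> []" "hd f = \<one>\<^bsub>L\<^esub>" "L.eval f u = \<zero>\<^bsub>L\<^esub>"
    using u(1) unfolding integral_closure_def univ_poly_carrier by auto
  have fA: "set f \<subseteq> A" using f(1) unfolding polynomial_def by auto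
  have "\<psi> (L.eval f u) = K.eval (map \<psi> f) (\<psi> u)"
    using h.eval_hom'[of u f] u(2) fA A by (auto simp: L.eval_consistent[OF E])
  then have "K.eval (map \<psi> f) (\<psi> u) = \<zero>\<^bsub>K\<^esub>" using f(4) h.hom_zero by simp
  moreover have hd: "hd (map \<psi> f) = \<one>\<^bsub>K\<^esub>" using f(2,3) h.hom_one by (cases f) auto
  moreover have "polynomial\<^bsub>K\<^esub> B (map \<psi> f)" using fA B hd f(2) unfolding polynomial_def by auto
  moreover have "\<psi> u \<in> carrier K" using h.hom_closed u(2) by simp
  ultimately show ?thesis using f(2) unfolding integral_closure_def univ_poly_carrier by auto
qed

section \<open>Units and polynomials over a valuation ring\<close>

context plain_field begin

text \<open>
  The condition \<open>u \<noteq> \<zero>\<close> is essential, since \<open>inv \<zero>\<close> is an unspecified element.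
\<close>
definition vunit :: "'a set \<Rightarrow> 'a \<Rightarrow> bool" where
  "vunit V u \<longleftrightarrow> u \<in> V \<and> u \<noteq> \<zero> \<and> inv u \<in> V"

lemma valuation_ringD: 
  assumes "valuation_ring V"
  shows "subring V R" "x \<in> carrier R \<Longrightarrow> x \<notin> V \<Longrightarrow> inv x \<in> V"
  using assms by (auto simp: valuation_ring_def)

lemma vunit_mult_left:
  assumes V: "subring V R" and a: "a \<in> V" and b: "b \<in> V" and u: "vunit V (a \<otimes> b)"
  shows "vunit V a"
proof -
  note VE = subringE[OF V]
  have car: "a \<in> carrier R" "b \<in> carrier R" using a(1) b(1) VE(1) by auto
  have a0: "a \<noteq> \<zero>" using u car unfolding vunit_def by auto
  have w: "inv (a \<otimes> b) \<in> V" "inv (a \<otimes> b) \<in> carrier R" "(a \<otimes> b) \<otimes> inv (a \<otimes> b) = \<one>"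
    using u inverse_props[of "a \<otimes> b"] car VE unfolding vunit_def by auto
  have "a \<otimes> (b \<otimes> inv (a \<otimes> b)) = \<one>" using w car by (simp add: m_assoc)
  then have "inv a = b \<otimes> inv (a \<otimes> b)" using car w comm_inv_char[of a "b \<otimes> inv (a \<otimes> b)"] by auto
  then show ?thesis using a a0 b w VE by (auto simp: vunit_def)
qed

lemma inverse_mult:
  assumes "a \<in> carrier R" "a \<noteq> \<zero>" "b \<in> carrier R" "b \<noteq> \<zero>"
  shows "inv (a \<otimes> b) = inv a \<otimes> inv b"
proof -
  note ia = inverse_props[OF assms(1,2)] and ib = inverse_props[OF assms(3,4)]
  have "(a \<otimes> b) \<otimes> (inv a \<otimes> inv b) = (a \<otimes> inv a) \<otimes> (b \<otimes> inv b)"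
    using assms(1,3) ia(1) ib(1) by (simp add: m_ac)
  then have "(a \<otimes> b) \<otimes> (inv a \<otimes> inv b) = \<one>" using ia(3) ib(3) by simp
  then show ?thesis using comm_inv_char[of "a \<otimes> b" "inv a \<otimes> inv b"] assms(1,3) ia(1) ib(1) by simp
qed

lemma vunit_mult:
  assumes V: "subring V R" and a: "vunit V a" and b: "vunit V b"
  shows "vunit V (a \<otimes> b)"
proof -
  note VE = subringE[OF V]
  have car: "a \<in> carrier R" "b \<in> carrier R" "a \<noteq> \<zero>" "b \<noteq> \<zero>" using a b VE by (auto simp: vunit_def)
  have "inv (a \<otimes> b) = inv a \<otimes> inv b" using inverse_mult car by blast
  then show ?thesis using a b VE(6) integral[OF _ car(1,2)] car(3,4) unfolding vunit_def by metis
qed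

lemma vunit_one: "subring V R \<Longrightarrow> vunit V \<one>"
  using subringE(3)[of V R] by (auto simp: vunit_def)

lemma vunit_minus: 
  assumes V: "subring V R" and a: "vunit V a" shows "vunit V (\<ominus> a)"
proof -
  note VE = subringE[OF V]
  have "vunit V (\<ominus> \<one>)" 
    unfolding vunit_def using VE(5)[OF VE(3)] inv_neg_one by auto
  moreover have "\<ominus> a = \<ominus> \<one> \<otimes> a" using a VE(1) by (auto simp: vunit_def l_minus)
  ultimately show ?thesis using vunit_mult[OF V _ a] by simp
qed

text \<open>
  A valuation ring is local: of two nonzero elements one divides the other, and the sum is
  a multiple of that one.
\<close>
lemma nonunit_add:
  assumes V: "valuation_ring V" and a: "a \<in> V" "\<not> vunit V a" and b: "b \<in> V" "\<not> vunit V b"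
  shows "\<not> vunit V (a \<oplus> b)"
proof -
  have Vs: "subring V R" using valuation_ringD(1)[OF V] .
  note VE = subringE[OF Vs]
  have *: "\<not> vunit V (c \<oplus> d)"
    if c: "c \<in> V" "\<not> vunit V c" "c \<noteq> \<zero>" and d: "d \<in> V" and q: "inv c \<otimes> d \<in> V" for c d
  proof
    assume u: "vunit V (c \<oplus> d)"
    have car: "c \<in> carrier R" "d \<in> carrier R" using c(1) d VE(1) by auto
    have "c \<otimes> (\<one> \<oplus> inv c \<otimes> d) = c \<oplus> (c \<otimes> inv c) \<otimes> d"
      using car inverse_props(1)[OF car(1) c(3)] by (simp add: r_distr m_assoc)
    also have "\<dots> = c \<oplus> d" using car inverse_props[OF car(1) c(3)] by simp
    finally have "vunit V (c \<otimes> (\<one> \<oplus> inv c \<otimes> d))" using u by simp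
    then show False using vunit_mult_left[OF Vs c(1)] VE(7)[OF VE(3) q] c(2) by blast
  qed
  have car: "a \<in> carrier R" "b \<in> carrier R" using a(1) b(1) VE(1) by auto
  show ?thesis
  proof (cases "a = \<zero> \<or> b = \<zero>")
    case True then show ?thesis using a b car by auto
  next
    case False
    then have ia: "inv a \<in> carrier R" "inv b \<in> carrier R" "inv (inv a) = a" "inv a \<noteq> \<zero>" using inverse_props[of a] inverse_props[of b] car by auto
    show ?thesis
    proof (cases "inv a \<otimes> b \<in> V")
      case True then show ?thesis using * a b False by blast
    next
      case F: False
      then have "inv (inv a \<otimes> b) \<in> V" using valuation_ringD(2)[OF V] ia car by auto
      also have "inv (inv a \<otimes> b) = inv b \<otimes> a"
        using ia car False inverse_mult[of "inv a" b] by (simp add: m_comm)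
      finally have "\<not> vunit V (b \<oplus> a)" using * a b False by blast
      then show ?thesis using car by (simp add: a_comm)
    qed
  qed
qed

lemma vunit_add_nonunit:
  assumes V: "valuation_ring V" and u: "vunit V u" and t: "t \<in> V" "\<not> vunit V t"
  shows "vunit V (u \<oplus> t)"
proof (rule ccontr)
  have Vs: "subring V R" using valuation_ringD(1)[OF V] .
  note VE = subringE[OF Vs]
  have car: "t \<in> carrier R" "u \<in> carrier R" "u \<in> V" using u t VE by (auto simp: vunit_def)
  assume n: "\<not> vunit V (u \<oplus> t)"
  have "\<not> vunit V (\<ominus> t)" using vunit_minus[OF Vs, of "\<ominus> t"] t car by auto
  then have "\<not> vunit V ((u \<oplus> t) \<oplus> \<ominus> t)" using nonunit_add[OF V VE(7)[OF car(3) t(1)] n VE(5)[OF t(1)]] by blast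
  moreover have "(u \<oplus> t) \<oplus> \<ominus> t = u" using car by algebra
  ultimately show False using u by simp
qed

lemma nonunit_mult:
  assumes V: "subring V R" and t: "t \<in> V" "\<not> vunit V t" and a: "a \<in> V"
  shows "\<not> vunit V (t \<otimes> a)" "t \<otimes> a \<in> V"
  using vunit_mult_left[OF V t(1) a] t subringE(6)[OF V] a by auto

lemma inv_nonunit:
  assumes V: "valuation_ring V" and x: "x \<in> carrier R" "x \<notin> V"
  shows "inv x \<in> V" "\<not> vunit V (inv x)" "x \<noteq> \<zero>"
proof -
  have Vs: "subring V R" using valuation_ringD(1)[OF V] .
  show x0: "x \<noteq> \<zero>" using x subringE(2)[OF Vs] by auto
  show "inv x \<in> V" using valuation_ringD(2)[OF V] x by auto
  show "\<not> vunit V (inv x)" using inverse_props[OF x(1) x0] x by (auto simp: vunit_def)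
qed

end

locale plain_closed_field = plain_field R + algebraically_closed R for R :: "'a ring" (structure)
begin

lemma linear_factor:
  assumes f: "f \<in> carrier (poly_ring R)" and len: "length f = Suc (Suc n)"
  obtains a q where "a \<in> carrier R" "q \<in> carrier (poly_ring R)" "length q = Suc n"
    "f = [\<one>, \<ominus> a] \<otimes>\<^bsub>poly_ring R\<^esub> q" "hd f = hd q" "eval f a = \<zero>"
proof -
  have "splitted f" by (rule roots_over_carrier[OF f])
  then have ne: "roots f \<noteq> {#}" using len unfolding splitted_def by auto
  obtain a where a: "a \<in> carrier R" "a \<in># roots f" "[\<one>, \<ominus> a] \<in> carrier (poly_ring R)" "[\<one>, \<ominus> a] pdivides f"
    by (rule not_empty_rootsE[OF f ne]) blast
  obtain q where q: "q \<in> carrier (poly_ring R)" "f = [\<one>, \<ominus> a] \<otimes>\<^bsub>poly_ring R\<^esub> q"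
    using a(4) unfolding pdivides_def factor_def by auto
  interpret P: domain "poly_ring R" by (rule univ_poly_is_domain[OF carrier_is_subring])
  have q0: "q \<noteq> []" using q len a(3) P.r_null[of "[\<one>, \<ominus> a]"] unfolding univ_poly_zero by auto
  have pols: "polynomial (carrier R) [\<one>, \<ominus> a]" "polynomial (carrier R) q"
    using a(3) q(1) unfolding univ_poly_carrier by auto
  have "length f - 1 = 1 + (length q - 1)"
    unfolding q(2) univ_poly_mult poly_mult_degree_eq[OF carrier_is_subring pols] using q0 by simp
  then have "length q = Suc n" using len q0 by (cases q) auto
  moreover have "hd f = hd q"
    unfolding q(2) univ_poly_mult using poly_mult_lead_coeff[OF carrier_is_subring pols] q0 pols
    by (auto simp: polynomial_def intro!: l_one)
  moreover have "eval f a = \<zero>" using a(2) roots_mem_iff_is_root[OF f] unfolding is_root_def by auto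
  ultimately show ?thesis using that a(1) q by blast
qed

lemma eval_linear_factor:
  assumes "a \<in> carrier R" "q \<in> carrier (poly_ring R)" "x \<in> carrier R"
  shows "eval ([\<one>, \<ominus> a] \<otimes>\<^bsub>poly_ring R\<^esub> q) x = (x \<ominus> a) \<otimes> eval q x"
proof -
  have "set q \<subseteq> carrier R" using assms(2) by (auto simp: univ_poly_carrier[symmetric] polynomial_def)
  then show ?thesis using assms by (simp add: univ_poly_mult eval_poly_mult a_minus_def del: poly_mult.simps)
qed

lemma poly_mult_coeffs:
  assumes V: "subring V R" and p: "polynomial V p" and q: "polynomial (carrier R) q" "set q \<subseteq> V"
  shows "set (p \<otimes>\<^bsub>poly_ring R\<^esub> q) \<subseteq> V"
proof -
  have "polynomial V q" using q by (auto simp: polynomial_def)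
  then have "polynomial V (poly_mult p q)" by (rule poly_mult_closed[OF V p])
  then show ?thesis by (auto simp: polynomial_def univ_poly_mult)
qed

text \<open>
  Up to sign, the coefficients are sums of products of the roots; the induction peels off one linear
  factor at a time.
\<close>
lemma monic_coeffs_from_roots:
  assumes V: "subring V R"
  shows "\<lbrakk>f \<in> carrier (poly_ring R); length f = Suc n; hd f = \<one>;
    \<And>a. a \<in> carrier R \<Longrightarrow> eval f a = \<zero> \<Longrightarrow> a \<in> V\<rbrakk> \<Longrightarrow> set f \<subseteq> V"
proof (induction n arbitrary: f)
  case 0
  then show ?case using subringE(3)[OF V] by (cases f) auto
next
  case (Suc n)
  note VE = subringE[OF V]
  obtain a q where q: "a \<in> carrier R" "q \<in> carrier (poly_ring R)" "length q = Suc n"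
    "f = [\<one>, \<ominus> a] \<otimes>\<^bsub>poly_ring R\<^esub> q" "hd f = hd q" "eval f a = \<zero>"
    using linear_factor[OF Suc.prems(1,2)] .
  have qs: "set q \<subseteq> carrier R" using q(2) by (auto simp: univ_poly_carrier[symmetric] polynomial_def)
  have "set q \<subseteq> V"
  proof (rule Suc.IH[OF q(2,3)])
    show "hd q = \<one>" using q(5) Suc.prems(3) by simp
    fix b assume b: "b \<in> carrier R" "eval q b = \<zero>"
    then have "eval f b = \<zero>" unfolding q(4) using eval_linear_factor[OF q(1,2) b(1)] q(1) by simp
    then show "b \<in> V" using Suc.prems(4) b by blast
  qed
  moreover have "a \<in> V" using Suc.prems(4) q by blast
  then have "polynomial V [\<one>, \<ominus> a]" using VE by (auto simp: polynomial_def)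
  moreover have "polynomial (carrier R) q" using q(2) unfolding univ_poly_carrier .
  ultimately show ?case unfolding q(4) by (intro poly_mult_coeffs[OF V])
qed

text \<open>
  A Gauss lemma in terms of values. A root \<open>a\<close> in \<open>V\<close> contributes the factor \<open>x - a\<close>. For a root \<open>a\<close> outside
  \<open>V\<close> one writes \<open>x - a = -a (1 - x/a)\<close>, where \<open>1/a\<close> is a nonunit and so the bracket is a unit for every \<open>x\<close>
  in \<open>V\<close>; the factor \<open>-a\<close> joins the constant. The remaining factors have coefficients in \<open>V\<close>, so a
  coefficient of \<open>f\<close> outside \<open>V\<close> forces the constant out of \<open>V\<close>.
\<close>
lemma valuation_factorization:
  assumes V: "valuation_ring V"
  shows "\<lbrakk>f \<in> carrier (poly_ring R); length f = Suc n\<rbrakk> \<Longrightarrow>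
    \<exists>c as. c \<in> carrier R \<and> c \<noteq> \<zero> \<and> set as \<subseteq> V \<and> (c \<in> V \<longrightarrow> set f \<subseteq> V) \<and>
      (\<forall>x\<in>V. \<exists>u. vunit V u \<and> eval f x = c \<otimes> u \<otimes> foldr (\<lambda>a y. (x \<ominus> a) \<otimes> y) as \<one>)"
proof (induction n arbitrary: f)
  case 0
  have Vs: "subring V R" using valuation_ringD(1)[OF V] .
  note VE = subringE[OF Vs]
  obtain c where f: "f = [c]" using 0 by (cases f) auto
  then have c: "c \<in> carrier R" "c \<noteq> \<zero>"
    using 0(1) by (auto simp: univ_poly_carrier[symmetric] polynomial_def)
  show ?case
    by (intro exI[of _ c] exI[of _ "[]"] conjI ballI exI[of _ \<one>])
      (use c vunit_one[OF Vs] f VE(1) in auto)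
next
  case (Suc n)
  have Vs: "subring V R" using valuation_ringD(1)[OF V] .
  note VE = subringE[OF Vs]
  interpret P: domain "poly_ring R" by (rule univ_poly_is_domain[OF carrier_is_subring])
  obtain a q where q: "a \<in> carrier R" "q \<in> carrier (poly_ring R)" "length q = Suc n"
    "f = [\<one>, \<ominus> a] \<otimes>\<^bsub>poly_ring R\<^esub> q"
    using linear_factor[OF Suc.prems(1,2)] by metis
  have prodV: "foldr (\<lambda>a y. (x \<ominus> a) \<otimes> y) as \<one> \<in> carrier R" if "x \<in> V" "set as \<subseteq> V" for x as
    using that(2) by (induction as) (use that(1) VE(1) in auto)
  show ?case
  proof (cases "a \<in> V")
    case True
    obtain c as where ih: "c \<in> carrier R" "c \<noteq> \<zero>" "set as \<subseteq> V" "c \<in> V \<longrightarrow> set q \<subseteq> V"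
      "\<And>x. x\<in>V \<Longrightarrow> \<exists>u. vunit V u \<and> eval q x = c \<otimes> u \<otimes> foldr (\<lambda>a y. (x \<ominus> a) \<otimes> y) as \<one>"
      using Suc.IH[OF q(2,3)] by blast
    have "set f \<subseteq> V" if "c \<in> V"
    proof -
      have "polynomial (carrier R) q" using q(2) unfolding univ_poly_carrier .
      moreover have "polynomial V [\<one>, \<ominus> a]" using True VE(3,5) by (auto simp: polynomial_def)
      ultimately show ?thesis unfolding q(4) using that ih(4) by (intro poly_mult_coeffs[OF Vs]) auto
    qed
    moreover have "\<exists>u. vunit V u \<and> eval f x = c \<otimes> u \<otimes> foldr (\<lambda>a y. (x \<ominus> a) \<otimes> y) (a # as) \<one>" if x: "x \<in> V" for x
    proof -
      obtain u where u: "vunit V u" "eval q x = c \<otimes> u \<otimes> foldr (\<lambda>a y. (x \<ominus> a) \<otimes> y) as \<one>" using ih(5)[OF x] by blast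
      have car: "x \<in> carrier R" "u \<in> carrier R" "x \<ominus> a \<in> carrier R" using x u VE(1) q(1) by (auto simp: vunit_def)
      have "eval f x = c \<otimes> u \<otimes> foldr (\<lambda>a y. (x \<ominus> a) \<otimes> y) (a # as) \<one>"
        unfolding q(4) eval_linear_factor[OF q(1,2) car(1)] u(2)
        using car ih(1) prodV[OF x ih(3)] by (simp add: m_ac)
      then show ?thesis using u(1) by blast
    qed
    ultimately show ?thesis using ih(1,2,3) True by (intro exI[of _ c] exI[of _ "a # as"]) auto
  next
    case False
    note ia = inv_nonunit[OF V q(1) False]
    have iac: "inv a \<in> carrier R" "a \<otimes> inv a = \<one>" "inv a \<noteq> \<zero>" using inverse_props[OF q(1) ia(3)] by auto
    have ma: "\<ominus> a \<noteq> \<zero>" "\<ominus> a \<in> carrier R" "\<ominus> (inv a) \<noteq> \<zero>" using ia(3) q(1) iac by (auto simp: local.add.inv_eq_1_iff)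
    have cp: "[\<ominus> a] \<in> carrier (poly_ring R)" "[\<ominus> (inv a), \<one>] \<in> carrier (poly_ring R)"
      using ma iac by (auto simp: univ_poly_carrier[symmetric] polynomial_def)
    \<comment> \<open>The induction hypothesis is applied to \<open>-a\<close> times the quotient, so that its constant already
      includes the factor \<open>-a\<close> and still controls the coefficients.\<close>
    define q' where "q' = [\<ominus> a] \<otimes>\<^bsub>poly_ring R\<^esub> q"
    have q's: "q' = map (\<lambda>b. \<ominus> a \<otimes> b) q"
      unfolding q'_def univ_poly_mult using poly_mult_const(1)[OF carrier_is_subring, of q "\<ominus> a"] q(2) ma
      by (simp add: univ_poly_carrier del: poly_mult.simps)
    have q': "q' \<in> carrier (poly_ring R)" "length q' = Suc n"
      using P.m_closed[OF cp(1) q(2)] q(3) q's unfolding q'_def by simp_all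
    have "[\<ominus> (inv a), \<one>] \<otimes>\<^bsub>poly_ring R\<^esub> [\<ominus> a] = map (\<lambda>b. \<ominus> a \<otimes> b) [\<ominus> (inv a), \<one>]"
      unfolding univ_poly_mult using poly_mult_const(2)[OF carrier_is_subring, of "[\<ominus> (inv a), \<one>]" "\<ominus> a"] cp ma
      by (simp add: univ_poly_carrier del: poly_mult.simps)
    also have "\<dots> = [\<one>, \<ominus> a]" using iac q(1) by (simp add: l_minus r_minus m_comm)
    finally have "f = [\<ominus> (inv a), \<one>] \<otimes>\<^bsub>poly_ring R\<^esub> q'"
      unfolding q'_def q(4) using cp q(2) by (simp add: P.m_assoc[symmetric])
    note f = this
    obtain c as where ih: "c \<in> carrier R" "c \<noteq> \<zero>" "set as \<subseteq> V" "c \<in> V \<longrightarrow> set q' \<subseteq> V"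
      "\<And>x. x\<in>V \<Longrightarrow> \<exists>u. vunit V u \<and> eval q' x = c \<otimes> u \<otimes> foldr (\<lambda>a y. (x \<ominus> a) \<otimes> y) as \<one>"
      using Suc.IH[OF q'] by blast
    have "set f \<subseteq> V" if "c \<in> V"
    proof -
      have "polynomial (carrier R) q'" using q'(1) unfolding univ_poly_carrier .
      moreover have "polynomial V [\<ominus> (inv a), \<one>]" using ia(1) ma(3) VE(3,5) by (auto simp: polynomial_def)
      ultimately show ?thesis unfolding f using that ih(4) by (intro poly_mult_coeffs[OF Vs]) auto
    qed
    moreover have "\<exists>u. vunit V u \<and> eval f x = c \<otimes> u \<otimes> foldr (\<lambda>a y. (x \<ominus> a) \<otimes> y) as \<one>" if x: "x \<in> V" for x
    proof -
      obtain u where u: "vunit V u" "eval q' x = c \<otimes> u \<otimes> foldr (\<lambda>a y. (x \<ominus> a) \<otimes> y) as \<one>" using ih(5)[OF x] by blast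
      have car: "x \<in> carrier R" "u \<in> carrier R" using x u VE(1) by (auto simp: vunit_def)
      define w where "w = \<one> \<oplus> inv a \<otimes> \<ominus> x"
      have w: "vunit V w" unfolding w_def
        using vunit_add_nonunit[OF V vunit_one[OF Vs]] nonunit_mult[OF Vs ia(1,2) VE(5)[OF x]] by blast
      then have wc: "w \<in> carrier R" using VE(1) by (auto simp: vunit_def)
      have qs': "set q' \<subseteq> carrier R" using q'(1) by (auto simp: univ_poly_carrier[symmetric] polynomial_def)
      have "eval f x = eval [\<ominus> (inv a), \<one>] x \<otimes> eval q' x"
        unfolding f univ_poly_mult by (rule eval_poly_mult) (use qs' car iac in auto)
      also have "eval [\<ominus> (inv a), \<one>] x = w" unfolding w_def using iac car by (simp add: l_minus r_minus a_ac)
      finally have "eval f x = c \<otimes> (w \<otimes> u) \<otimes> foldr (\<lambda>a y. (x \<ominus> a) \<otimes> y) as \<one>"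
        unfolding u(2) using car wc ih(1) prodV[OF x ih(3)] by (simp add: m_ac)
      then show ?thesis using vunit_mult[OF Vs w u(1)] by blast
    qed
    ultimately show ?thesis using ih(1,2,3) by blast
  qed
qed

end

section \<open>Localising integer-valued polynomials at a prime\<close>

lemma Z_locI:
  assumes "q = of_int a / of_int b" "\<not> int p dvd b"
  shows "q \<in> Z_loc p"
proof -
  have b0: "b \<noteq> 0" using assms(2) by auto
  obtain c d where cd: "quotient_of q = (c, d)" by force
  then have q: "q = of_int c / of_int d" "d > 0" "coprime c d"
    using quotient_of_div quotient_of_denom_pos quotient_of_coprime by auto
  have "(of_int (c * b) :: rat) = of_int (a * d)" using assms(1) q b0 by (simp add: field_simps)
  then have "c * b = a * d" by (simp only: of_int_eq_iff)
  then have "d dvd c * b" by simp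
  then have "d dvd b" using q(3) by (simp add: coprime_commute coprime_dvd_mult_right_iff)
  then have "\<not> int p dvd d" using assms(2) dvd_trans by blast
  then show ?thesis using cd by (simp add: Z_loc_def)
qed

lemma Z_locE:
  assumes "q \<in> Z_loc p"
  obtains a b where "q = of_int a / of_int b" "\<not> int p dvd b" "b \<noteq> 0"
proof -
  obtain c d where cd: "quotient_of q = (c, d)" by force
  then show ?thesis using assms that[of c d] quotient_of_div[OF cd] quotient_of_denom_pos[OF cd]
    by (auto simp: Z_loc_def)
qed

lemma Z_loc_of_int: "Factorial_Ring.prime p \<Longrightarrow> of_int n \<in> Z_loc p"
  by (rule Z_locI[of _ n 1]) (auto dest: not_prime_unit)

text \<open>
  A rational number outside the localisation has \<open>p\<close> in its reduced denominator, so it is the inverse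
  of a multiple of \<open>p\<close> there.
\<close>
lemma Z_loc_inverse:
  assumes p: "Factorial_Ring.prime p" and q: "q \<notin> Z_loc p"
  shows "inverse (of_nat p * q) \<in> Z_loc p" "q \<noteq> 0" "inverse q \<in> Z_loc p"
proof -
  show q0: "q \<noteq> 0" using q Z_loc_of_int[OF p, of 0] by auto
  obtain c d where cd: "quotient_of q = (c, d)" by force
  then have qq: "q = of_int c / of_int d" "d > 0" "coprime c d"
    using quotient_of_div quotient_of_denom_pos quotient_of_coprime by auto
  have pd: "int p dvd d" using q cd by (simp add: Z_loc_def)
  then obtain e where e: "d = int p * e" by auto
  have pc: "\<not> int p dvd c"
  proof
    assume "int p dvd c"
    then have "int p dvd 1" using pd qq(3) coprime_common_divisor by blast
    then show False using p by (auto dest: not_prime_unit)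
  qed
  have p0: "p \<noteq> 0" using p by auto
  have c0: "c \<noteq> 0" using pc by auto
  have e0: "e \<noteq> 0" using e qq(2) by auto
  show "inverse (of_nat p * q) \<in> Z_loc p"
    by (rule Z_locI[OF _ pc, of _ e]) (use c0 p0 e0 in \<open>simp add: qq(1) e divide_simps\<close>)
  show "inverse q \<in> Z_loc p"
    by (rule Z_locI[OF _ pc, of _ d]) (use qq(1) in \<open>simp add: field_simps\<close>)
qed

lemma Z_loc_closed:
  assumes p: "Factorial_Ring.prime p" and x: "x \<in> Z_loc p" and y: "y \<in> Z_loc p"
  shows "x + y \<in> Z_loc p" "x * y \<in> Z_loc p"
proof -
  obtain a b where x: "x = of_int a / of_int b" "\<not> int p dvd b" "b \<noteq> 0" using x by (rule Z_locE)
  obtain c d where y: "y = of_int c / of_int d" "\<not> int p dvd d" "d \<noteq> 0" using y by (rule Z_locE)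
  have pi: "Factorial_Ring.prime (int p)" using p by simp
  have bd: "\<not> int p dvd b * d" using x(2) y(2) prime_dvd_mult_iff[OF pi] by blast
  show "x + y \<in> Z_loc p" by (rule Z_locI[OF _ bd, of _ "a * d + c * b"]) (use x y in \<open>simp add: field_simps\<close>)
  show "x * y \<in> Z_loc p" by (rule Z_locI[OF _ bd, of _ "a * c"]) (use x y in \<open>simp add: field_simps\<close>)
qed

lemma Z_loc_minus: "x \<in> Z_loc p \<Longrightarrow> - x \<in> Z_loc p"
  by (metis Z_locE Z_locI minus_divide_left of_int_minus)

lemma not_Ints_imp_not_Z_loc:
  assumes "q \<notin> \<int>" obtains p where "Factorial_Ring.prime p" "q \<notin> Z_loc p"
proof -
  obtain c d where cd: "quotient_of q = (c, d)" by force
  then have q: "q = of_int c / of_int d" "d > 0"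
    using quotient_of_div quotient_of_denom_pos by auto
  have "d \<noteq> 1" using assms q by auto
  then have "nat d \<noteq> 1" using q(2) by simp
  then obtain p where p: "Factorial_Ring.prime p" "p dvd nat d" using prime_factor_nat by blast
  then have "int p dvd d" using q(2) by (simp add: int_dvd_int_iff[symmetric])
  then show ?thesis using that p cd by (auto simp: Z_loc_def)
qed

lemma int_div_prime_notin_Z_loc: "Factorial_Ring.prime p \<Longrightarrow> \<not> int p dvd c \<Longrightarrow> of_int c / of_nat p \<notin> Z_loc p"
proof
  assume p: "Factorial_Ring.prime p" "\<not> int p dvd c" and "of_int c / of_nat p \<in> Z_loc p"
  then obtain a b where ab: "of_int c / of_nat p = (of_int a / of_int b :: rat)" "\<not> int p dvd b" "b \<noteq> 0" by (auto elim: Z_locE)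
  have p0: "p \<noteq> 0" using p by auto
  have "(of_int (c * b) :: rat) = of_int (int p * a)" using ab(1,3) p0 by (simp add: field_simps)
  then have "c * b = int p * a" by (simp only: of_int_eq_iff)
  then have "int p dvd c * b" by simp
  moreover have "Factorial_Ring.prime (int p)" using p by simp
  ultimately show False using p ab(2) prime_dvd_mult_iff by blast
qed

context plain_field begin

lemma eval_subring: "subring A R \<Longrightarrow> set f \<subseteq> A \<Longrightarrow> x \<in> A \<Longrightarrow> eval f x \<in> A"
  by (rule poly_values_closed[of A x _ "length f"]) (auto simp: poly_values_def)

text \<open>
  Polynomials with coefficients in \<open>D\<close> always map \<open>S\<close> to \<open>D\<close>, so nontriviality is witnessed by
  a coefficient outside \<open>D\<close>.
\<close>
lemma Int_nontrivial_iff_coefficient: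
  assumes D: "subring D R" and S: "S \<subseteq> D"
  shows "Int_nontrivial R F S D \<longleftrightarrow> (\<exists>f\<in>Int_poly R F S D. \<not> set f \<subseteq> D)"
proof -
  have 1: "carrier (univ_poly R (D \<inter> F)) = {f \<in> carrier (univ_poly R F). set f \<subseteq> D}"
    by (auto simp: univ_poly_carrier[symmetric] polynomial_def)
  have "{f \<in> carrier (univ_poly R F). set f \<subseteq> D} \<subseteq> Int_poly R F S D"
    unfolding Int_poly_def using eval_subring[OF D] S by blast
  then show ?thesis unfolding Int_nontrivial_def 1 unfolding Int_poly_def by blast
qed

end

locale rat_embedded = plain_field R for R :: "'a ring" (structure) +
  fixes j :: "rat \<Rightarrow> 'a"
  assumes j_hom: "j \<in> ring_hom rat_ring R"
begin

lemma j_carrier [simp]: "j q \<in> carrier R"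
  and j_mult: "j (a * b) = j a \<otimes> j b"
  and j_add: "j (a + b) = j a \<oplus> j b"
  and j_one [simp]: "j 1 = \<one>"
  using ring_hom_memE[OF j_hom] by (auto simp: ring_of_type_algebra_def)

lemma j_zero [simp]: "j 0 = \<zero>"
  using j_add[of 0 0] by (metis add.l_cancel_one j_carrier add.r_cancel_one add_0)

lemma j_minus: "j (- a) = \<ominus> j a"
  using j_add[of a "- a"] by (metis add.right_inverse a_comm j_carrier j_zero minus_equality)

lemma j_inverse: assumes "a \<noteq> 0" shows "j (inverse a) = inv (j a)" "j a \<noteq> \<zero>"
proof -
  have 1: "j a \<otimes> j (inverse a) = \<one>" using assms j_mult[of a "inverse a"] by simp
  then show "j a \<noteq> \<zero>" by (metis j_carrier l_null zero_not_one)
  show "j (inverse a) = inv (j a)" using 1 comm_inv_char[of "j a" "j (inverse a)"] by simp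
qed

lemma j_inj: "j a = j b \<longleftrightarrow> a = b"
proof
  assume "j a = j b"
  then have "j (a - b) = \<zero>" using j_add[of a "- b"] j_minus[of b] by (simp add: r_neg)
  then show "a = b" using j_inverse(2)[of "a - b"] by auto
qed simp

lemma subring_image:
  assumes "1 \<in> A" "\<And>x y. x \<in> A \<Longrightarrow> y \<in> A \<Longrightarrow> x + y \<in> A \<and> x * y \<in> A \<and> - x \<in> A"
  shows "subring (j ` A) R"
  by (rule subringI) (use assms in \<open>auto simp: j_mult[symmetric] j_add[symmetric] j_minus[symmetric] intro: image_eqI[of _ j 1]\<close>)

lemma subring_Ints: "subring (j ` \<int>) R"
  by (rule subring_image) auto

lemma subring_Z_loc: "Factorial_Ring.prime p \<Longrightarrow> subring (j ` Z_loc p) R"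
  by (rule subring_image) (use Z_loc_of_int[of p 1] Z_loc_closed Z_loc_minus in auto)

lemma subfield_range: "subfield (range j) R"
proof (rule subfieldI')
  show "subring (range j) R" by (rule subring_image) auto
  show "inv k \<in> range j" if "k \<in> range j - {\<zero>}" for k
  proof -
    from that obtain a where a: "k = j a" by auto
    then have a0: "a \<noteq> 0" using that by auto
    show ?thesis unfolding a using j_inverse(1)[OF a0] by (metis rangeI)
  qed
qed

lemma Ints_subset_Z_loc: "Factorial_Ring.prime p \<Longrightarrow> j ` \<int> \<subseteq> j ` Z_loc p"
  using Z_loc_of_int by (auto elim!: Ints_cases)

lemma subring_contains_Ints:
  assumes V: "subring V R" shows "j ` \<int> \<subseteq> V"
proof -
  note VE = subringE[OF V]
  have n: "j (of_nat n) \<in> V" for n by (induction n) (use VE in \<open>auto simp: j_add\<close>)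
  have "j (of_int z) \<in> V" for z
    by (cases z rule: int_cases2) (use n VE(5) in \<open>auto simp: j_minus\<close>)
  then show ?thesis by (auto elim!: Ints_cases)
qed

lemma not_integral_if_not_Z_loc:
  assumes p: "Factorial_Ring.prime p" and q: "q \<notin> Z_loc p"
  shows "j q \<notin> integral_closure R (j ` Z_loc p)"
proof
  assume "j q \<in> integral_closure R (j ` Z_loc p)"
  moreover have "inv (j q) \<in> j ` Z_loc p" using Z_loc_inverse(2,3)[OF p q] j_inverse(1)[of q] by (metis imageI)
  ultimately have "j q \<in> j ` Z_loc p"
    using integral_inverse_mem[OF subring_Z_loc[OF p]] j_inverse(2) Z_loc_inverse(2)[OF p q] by blast
  then show False using q j_inj by auto
qed

text \<open>
  The quotient of \<open>1/p\<close> by \<open>q\<close> belongs to the localisation, so adjoining \<open>q\<close> inverts \<open>p\<close>.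
\<close>
lemma inverse_p_mem:
  assumes p: "Factorial_Ring.prime p" and V: "subring V R" "j ` Z_loc p \<subseteq> V" and q: "q \<notin> Z_loc p" "j q \<in> V"
  shows "j (inverse (of_nat p)) \<in> V"
proof -
  have "inverse (of_nat p) = q * inverse (of_nat p * q)" using Z_loc_inverse(2)[OF p q(1)] by simp
  then have "j (inverse (of_nat p)) = j q \<otimes> j (inverse (of_nat p * q))" by (simp only: j_mult)
  then show ?thesis using q(2) V(2) Z_loc_inverse(1)[OF p q(1)] subringE(6)[OF V(1)] by auto
qed

text \<open>
  A valuation ring is centred at no more than one rational prime: if neither
  an integer \<open>b\<close> prime to \<open>p\<close> nor \<open>p\<close> itself were invertible, Bezout would make 1 a nonunit.
\<close>
lemma valuation_ring_over_Z:
  assumes p: "Factorial_Ring.prime p" and V: "valuation_ring V" and n: "\<not> j ` Z_loc p \<subseteq> V"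
  shows "j (inverse (of_nat p)) \<in> V"
proof (rule ccontr)
  assume np: "j (inverse (of_nat p)) \<notin> V"
  have Vs: "subring V R" using valuation_ringD(1)[OF V] .
  note VE = subringE[OF Vs]
  have iV: "j (of_int z) \<in> V" for z using subring_contains_Ints[OF Vs] by auto
  obtain q where "q \<in> Z_loc p" "j q \<notin> V" using n by auto
  then obtain a b where ab: "j (of_int a / of_int b) \<notin> V" "\<not> int p dvd b" "b \<noteq> 0" by (metis Z_locE)
  have "j (inverse (of_int b)) \<notin> V"
    using ab(1) VE(6)[OF iV[of a]] by (metis divide_inverse j_mult)
  then have nb: "\<not> vunit V (j (of_int b))" using j_inverse(1)[of "of_int b"] ab(3) by (simp add: vunit_def)
  have p0: "p \<noteq> 0" using p by auto
  have npp: "\<not> vunit V (j (of_int (int p)))" using j_inverse(1)[of "of_nat p"] np p0 by (simp add: vunit_def)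
  have "coprime (int p) b" using ab(2) p by (simp add: prime_imp_coprime)
  then obtain u v where uv: "u * int p + v * b = 1" using bezout_int[of "int p" b] by (auto simp: coprime_iff_gcd_eq_1)
  have "\<not> vunit V (j (of_int (int p)) \<otimes> j (of_int u) \<oplus> j (of_int b) \<otimes> j (of_int v))"
    by (intro nonunit_add[OF V] nonunit_mult[OF Vs] iV nb npp)
  also have "j (of_int (int p)) \<otimes> j (of_int u) \<oplus> j (of_int b) \<otimes> j (of_int v) = j (of_int (u * int p + v * b))"
    by (simp add: j_add j_mult m_comm)
  finally show False using vunit_one[OF Vs] unfolding uv by simp
qed

lemma common_denominator:
  assumes "set f \<subseteq> range j"
  obtains n :: nat where "n > 0" "\<And>c. c \<in> set f \<Longrightarrow> j (of_nat n) \<otimes> c \<in> j ` \<int>"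
proof -
  have "\<exists>n::nat. n > 0 \<and> (\<forall>c\<in>set f. j (of_nat n) \<otimes> c \<in> j ` \<int>)" using assms
  proof (induction f)
    case Nil then show ?case by (intro exI[of _ 1]) auto
  next
    case (Cons c f)
    then obtain n :: nat where n: "n > 0" "\<forall>c\<in>set f. j (of_nat n) \<otimes> c \<in> j ` \<int>" by auto
    obtain q where q: "c = j q" using Cons.prems by auto
    obtain a b where ab: "quotient_of q = (a, b)" by force
    then have qq: "q = of_int a / of_int b" "b > 0" using quotient_of_div quotient_of_denom_pos by auto
    have "j (of_nat (n * nat b)) \<otimes> c = j (of_int (int n * a))"
      unfolding q j_mult[symmetric] using qq by simp
    moreover have "j (of_nat (n * nat b)) \<otimes> d \<in> j ` \<int>" if d: "d \<in> set f" for d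
    proof -
      obtain z where z: "z \<in> \<int>" "j (of_nat n) \<otimes> d = j z" using n(2) d by auto
      have dc: "d \<in> carrier R" using Cons.prems d by auto
      have "j (of_nat (n * nat b)) \<otimes> d = j (of_nat (nat b)) \<otimes> (j (of_nat n) \<otimes> d)"
        using dc by (simp add: j_mult m_ac)
      also have "\<dots> = j (of_nat (nat b) * z)" unfolding z(2) by (simp add: j_mult)
      finally show ?thesis using z(1) by auto
    qed
    ultimately show ?case using n(1) qq(2) by (intro exI[of _ "n * nat b"]) auto
  qed
  then show ?thesis using that by blast
qed

lemma eval_scale:
  assumes "set f \<subseteq> carrier R" "a \<in> carrier R" "x \<in> carrier R"
  shows "eval (map (\<lambda>c. a \<otimes> c) f) x = a \<otimes> eval f x"
  using assms(1) by (induction f) (use assms(2,3) in \<open>auto simp: r_distr m_assoc eval_in_carrier\<close>)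

text \<open>
  A coefficient that is not an integer has a prime in its denominator. Given nontriviality at \<open>p\<close>,
  a common denominator is split as \<open>n = p\<^sup>e m\<close> with \<open>m\<close> prime to \<open>p\<close>. Multiplication by \<open>m\<close> keeps a
  coefficient outside the localisation and makes the values integral in every valuation ring: over the localisation they
  were integral before, and elsewhere \<open>1/p\<close> is available to turn \<open>n f\<close> into \<open>m f\<close>.
\<close>
lemma Int_nontrivial_iff_local:
  assumes S: "S \<subseteq> integral_closure R (j ` \<int>)"
  shows "Int_nontrivial R (range j) S (integral_closure R (j ` \<int>)) \<longleftrightarrow>
    (\<exists>p. Factorial_Ring.prime p \<and> Int_nontrivial R (range j) S (integral_closure R (j ` Z_loc p)))"
proof
  let ?Z = "integral_closure R (j ` \<int>)"
  have sub: "?Z \<subseteq> integral_closure R (j ` Z_loc p)" if "Factorial_Ring.prime p" for p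
    by (rule integral_closure_mono[OF Ints_subset_Z_loc[OF that]])
  {
    assume "Int_nontrivial R (range j) S ?Z"
    then obtain f where f: "f \<in> Int_poly R (range j) S ?Z" "\<not> set f \<subseteq> ?Z"
      unfolding Int_nontrivial_iff_coefficient[OF integral_closure_subring[OF subring_Ints] S] by blast
    then obtain c where c: "c \<in> set f" "c \<notin> ?Z" by auto
    then have "c \<in> range j" using f(1) unfolding Int_poly_def by (auto simp: univ_poly_carrier[symmetric] polynomial_def)
    then obtain q where q: "c = j q" by auto
    then have "q \<notin> \<int>" using c(2) subring_subset_integral_closure[OF subring_Ints] by auto
    then obtain p where p: "Factorial_Ring.prime p" "q \<notin> Z_loc p" by (rule not_Ints_imp_not_Z_loc)
    have "c \<notin> integral_closure R (j ` Z_loc p)" unfolding q by (rule not_integral_if_not_Z_loc[OF p])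
    moreover have "f \<in> Int_poly R (range j) S (integral_closure R (j ` Z_loc p))"
      using f(1) sub[OF p(1)] unfolding Int_poly_def by auto
    moreover have "S \<subseteq> integral_closure R (j ` Z_loc p)" using S sub[OF p(1)] by blast
    ultimately show "\<exists>p. Factorial_Ring.prime p \<and> Int_nontrivial R (range j) S (integral_closure R (j ` Z_loc p))"
      using Int_nontrivial_iff_coefficient[OF integral_closure_subring[OF subring_Z_loc[OF p(1)]]] c(1) p(1) by blast
  next
    assume "\<exists>p. Factorial_Ring.prime p \<and> Int_nontrivial R (range j) S (integral_closure R (j ` Z_loc p))"
    then obtain p where p: "Factorial_Ring.prime p"
      and nt: "Int_nontrivial R (range j) S (integral_closure R (j ` Z_loc p))" by blast
    let ?D = "integral_closure R (j ` Z_loc p)"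
    have SD: "S \<subseteq> ?D" using S sub[OF p] by blast
    obtain f where f: "f \<in> Int_poly R (range j) S ?D" "\<not> set f \<subseteq> ?D"
      using nt Int_nontrivial_iff_coefficient[OF integral_closure_subring[OF subring_Z_loc[OF p]] SD] by blast
    have fp: "set f \<subseteq> range j" "f \<noteq> [] \<Longrightarrow> hd f \<noteq> \<zero>"
      using f(1) unfolding Int_poly_def by (auto simp: univ_poly_carrier[symmetric] polynomial_def)
    then have fc: "set f \<subseteq> carrier R" by auto
    obtain n :: nat where n: "n > 0" "\<And>c. c \<in> set f \<Longrightarrow> j (of_nat n) \<otimes> c \<in> j ` \<int>"
      using common_denominator[OF fp(1)] by blast
    obtain m e where m: "n = p ^ e * m" "\<not> p dvd m"
      using multiplicity_decompose'[of n p] n(1) p by (metis not_gr_zero not_prime_unit)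
    have m0: "m \<noteq> 0" using m(2) by (metis dvd_0_right)
    have mp: "\<not> int p dvd int m" using m(2) by simp
    have p0: "p \<noteq> 0" using p by auto
    define f' where "f' = map (\<lambda>c. j (of_nat m) \<otimes> c) f"
    have jm: "j (of_nat m) \<noteq> \<zero>" using j_inverse(2)[of "of_nat m"] m0 by simp
    obtain q where q: "j q \<in> set f" "j q \<notin> ?D" using f(2) fp(1) by auto
    have "\<exists>f\<in>Int_poly R (range j) S ?Z. \<not> set f \<subseteq> ?Z"
    proof (rule bexI[of _ f'])
      have "j (of_nat m * q) \<notin> ?Z"
      proof
        assume a: "j (of_nat m * q) \<in> ?Z"
        have im: "j (inverse (of_nat m)) \<in> ?D"
          using subring_subset_integral_closure[OF subring_Z_loc[OF p]] Z_locI[of "inverse (of_nat m)" 1 "int m" p] mp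
          by (auto simp: field_simps)
        have "j q = j (of_nat m * q) \<otimes> j (inverse (of_nat m))"
          unfolding j_mult[symmetric] using m0 by (simp add: field_simps)
        then have "j q \<in> ?D"
          using subringE(6)[OF integral_closure_subring[OF subring_Z_loc[OF p]]] a sub[OF p] im by auto
        then show False using q by simp
      qed
      then show "\<not> set f' \<subseteq> ?Z" using q(1) unfolding f'_def by (auto simp: j_mult)
      have "f' \<in> carrier (univ_poly R (range j))"
        unfolding univ_poly_carrier[symmetric] polynomial_def f'_def
        using fp fc jm by (cases f) (auto simp: j_mult[symmetric] integral_iff)
      moreover have "eval f' s \<in> ?Z" if s: "s \<in> S" for s
      proof -
        have sZ: "s \<in> ?Z" and sc: "s \<in> carrier R" using S s integral_closure_carrier by auto
        have ev: "eval f' s = j (of_nat m) \<otimes> eval f s"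
          unfolding f'_def by (rule eval_scale[OF fc j_carrier sc])
        have fsc: "eval f s \<in> carrier R" using eval_in_carrier[OF fc sc] .
        have "eval f' s \<in> V" if V: "valuation_ring V" "j ` \<int> \<subseteq> V" for V
        proof (cases "j ` Z_loc p \<subseteq> V")
          case True
          have "eval f s \<in> ?D" using f(1) s unfolding Int_poly_def by auto
          then have "eval f s \<in> V" using V True integral_closure_eq_Inter[OF subring_Z_loc[OF p]] by blast
          moreover have "j (of_nat m) \<in> V" using V(2) by auto
          ultimately show ?thesis unfolding ev using subringE(6)[OF valuation_ringD(1)[OF V(1)]] by blast
        next
          case False
          have Vs: "subring V R" using valuation_ringD(1)[OF V(1)] .
          have ip: "j (inverse (of_nat p)) \<in> V" by (rule valuation_ring_over_Z[OF p V(1) False])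
          have ipe: "j (inverse (of_nat p) ^ e) \<in> V"
            by (induction e) (use ip subringE(3,6)[OF Vs] in \<open>auto simp: j_mult\<close>)
          have sV: "s \<in> V" using sZ V integral_closure_eq_Inter[OF subring_Ints] by blast
          have "eval (map (\<lambda>c. j (of_nat n) \<otimes> c) f) s \<in> V"
            by (rule eval_subring[OF Vs _ sV]) (use n(2) V(2) in auto)
          then have "j (of_nat n) \<otimes> eval f s \<in> V" by (simp add: eval_scale[OF fc j_carrier sc])
          then have "j (inverse (of_nat p) ^ e) \<otimes> (j (of_nat n) \<otimes> eval f s) \<in> V"
            using ipe subringE(6)[OF Vs] by blast
          also have "j (inverse (of_nat p) ^ e) \<otimes> (j (of_nat n) \<otimes> eval f s) = j (inverse (of_nat p) ^ e * of_nat n) \<otimes> eval f s"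
            using fsc by (simp add: j_mult m_assoc)
          also have "inverse (of_nat p) ^ e * of_nat n = (of_nat m :: rat)"
            unfolding m(1) using p0 by (simp add: power_inverse field_simps)
          finally show ?thesis unfolding ev .
        qed
        then show ?thesis unfolding integral_closure_eq_Inter[OF subring_Ints] by blast
      qed
      ultimately show "f' \<in> Int_poly R (range j) S ?Z" unfolding Int_poly_def by auto
    qed
    then show "Int_nontrivial R (range j) S ?Z"
      unfolding Int_nontrivial_iff_coefficient[OF integral_closure_subring[OF subring_Ints] S] .
  }
qed

end

section \<open>Separating polynomials over a \<open>p\<close>-adic base\<close>

text \<open>
  Integer polynomials are kept as elements of the type \<^typ>\<open>int poly\<close>, where \<open>p\<close> generates a prime
  ideal, and are evaluated in the field record by transporting their coefficients.
\<close>
context rat_embedded begin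

definition int_eval :: "int poly \<Rightarrow> 'a \<Rightarrow> 'a" where
  "int_eval h x = eval (map (\<lambda>n. j (of_int n)) (rev (coeffs h))) x"

lemma int_eval_0 [simp]: "int_eval 0 x = \<zero>"
  by (simp add: int_eval_def)

lemma int_eval_carrier [simp]: "x \<in> carrier R \<Longrightarrow> int_eval h x \<in> carrier R"
  unfolding int_eval_def by (rule eval_in_carrier) auto

lemma int_eval_pCons:
  assumes x: "x \<in> carrier R"
  shows "int_eval (pCons a h) x = j (of_int a) \<oplus> x \<otimes> int_eval h x"
proof (cases "pCons a h = 0")
  case True then show ?thesis using x by simp
next
  case False
  then have "coeffs (pCons a h) = a # coeffs h" by (auto simp: cCons_def)
  then have "int_eval (pCons a h) x = eval (map (\<lambda>n. j (of_int n)) (rev (coeffs h)) @ [j (of_int a)]) x"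
    by (simp add: int_eval_def)
  also have "\<dots> = int_eval h x \<otimes> x \<oplus> j (of_int a)"
    unfolding int_eval_def by (rule eval_append_aux) (use x in auto)
  finally show ?thesis using x by (simp add: m_comm a_comm)
qed

lemma int_eval_1 [simp]: "x \<in> carrier R \<Longrightarrow> int_eval 1 x = \<one>"
  using int_eval_pCons[of x 1 0] by (simp add: one_pCons)

lemma int_eval_Poly: "x \<in> carrier R \<Longrightarrow> int_eval (Poly (rev ns)) x = eval (map (\<lambda>n. j (of_int n)) ns) x"
proof (induction ns rule: rev_induct)
  case (snoc n ns)
  have "eval (map (\<lambda>n. j (of_int n)) (ns @ [n])) x = eval (map (\<lambda>n. j (of_int n)) ns) x \<otimes> x \<oplus> j (of_int n)"
    unfolding map_append list.map by (rule eval_append_aux) (use snoc.prems in auto)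
  then show ?case using snoc int_eval_pCons[of x n "Poly (rev ns)"] int_eval_carrier[of x "Poly (rev ns)"]
    by (simp add: m_comm a_comm)
qed simp

lemma int_eval_add: "x \<in> carrier R \<Longrightarrow> int_eval (g + h) x = int_eval g x \<oplus> int_eval h x"
proof (induction g h rule: poly_induct2)
  case (pCons a p b q)
  then show ?case by (simp add: int_eval_pCons j_add r_distr a_ac)
qed simp

lemma int_eval_smult: "x \<in> carrier R \<Longrightarrow> int_eval (Polynomial.smult a h) x = j (of_int a) \<otimes> int_eval h x"
  by (induction h) (simp_all add: int_eval_pCons j_mult r_distr m_ac)

lemma int_eval_mult: "x \<in> carrier R \<Longrightarrow> int_eval (g * h) x = int_eval g x \<otimes> int_eval h x"
proof (induction g)
  case (pCons a g)
  have "j (of_int a) \<otimes> int_eval h x \<oplus> x \<otimes> (int_eval g x \<otimes> int_eval h x) = (j (of_int a) \<oplus> x \<otimes> int_eval g x) \<otimes> int_eval h x"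
    using pCons.prems by (simp add: l_distr m_assoc)
  then show ?case using pCons by (simp add: int_eval_pCons int_eval_add int_eval_smult)
qed simp

lemma int_eval_power: "x \<in> carrier R \<Longrightarrow> int_eval (h ^ n) x = int_eval h x [^] n"
  by (induction n) (simp_all add: int_eval_mult m_comm)

lemma int_eval_subring:
  assumes V: "subring V R" and x: "x \<in> V"
  shows "int_eval h x \<in> V"
  unfolding int_eval_def by (rule eval_subring[OF V _ x]) (use subring_contains_Ints[OF V] in auto)

text \<open>
  The factor theorem for \<open>h(x) - h(a)\<close>, with a quotient in the same subring.
\<close>
lemma int_eval_congruence:
  assumes V: "subring V R" and x: "x \<in> V" and a: "a \<in> V"
  shows "\<exists>v\<in>V. int_eval h x = int_eval h a \<oplus> (x \<ominus> a) \<otimes> v"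
proof (induction h)
  case 0
  have "x \<ominus> a \<in> carrier R" using x a subringE(1)[OF V] by auto
  then show ?case using subringE(2)[OF V] by (intro bexI[of _ \<zero>]) auto
next
  case (pCons n h)
  note VE = subringE[OF V]
  obtain v where v: "v \<in> V" "int_eval h x = int_eval h a \<oplus> (x \<ominus> a) \<otimes> v" using pCons by auto
  have car: "x \<in> carrier R" "a \<in> carrier R" "v \<in> carrier R" "int_eval h a \<in> carrier R" "j (of_int n) \<in> carrier R"
    using x a v VE(1) by auto
  have "int_eval (pCons n h) x = int_eval (pCons n h) a \<oplus> (x \<ominus> a) \<otimes> (int_eval h a \<oplus> x \<otimes> v)"
    unfolding int_eval_pCons[OF car(1)] int_eval_pCons[OF car(2)] v(2) using car by algebra
  moreover have "int_eval h a \<oplus> x \<otimes> v \<in> V" using int_eval_subring[OF V a] VE(6)[OF x v(1)] VE(7) by blast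
  ultimately show ?case by blast
qed

end

text \<open>
  What the argument needs of an algebraic closure of the \<open>p\<close>-adic field \<open>F\<close> with ring of integers \<open>B\<close>: the
  latter is a valuation ring of \<open>F\<close> in which \<open>p\<close> is not invertible, it has residue field
  \<open>\<int>/p\<int>\<close>, and inverting \<open>p\<close> gives \<open>F\<close>.
\<close>
locale padic_closed = plain_closed_field R + rat_embedded R j
  for R :: "'a ring" (structure) and j +
  fixes p :: nat and F B :: "'a set"
  assumes p_prime: "Factorial_Ring.prime p"
    and F_subfield: "subfield F R"
    and alg: "x \<in> carrier R \<Longrightarrow> (algebraic over F) x"
    and B_subring: "subring B R" and B_subset: "B \<subseteq> F"
    and Z_loc_B: "j ` Z_loc p \<subseteq> B"
    and B_residue: "z \<in> B \<Longrightarrow> \<exists>n d. d \<in> B \<and> z = j (of_int n) \<oplus> j (of_nat p) \<otimes> d"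
    and B_fractions: "x \<in> F \<Longrightarrow> \<exists>e::nat. j (of_nat p ^ e) \<otimes> x \<in> B"
    and B_valuation: "x \<in> F \<Longrightarrow> x \<noteq> \<zero> \<Longrightarrow> x \<in> B \<or> inv x \<in> B"
    and p_nonunit: "j (inverse (of_nat p)) \<notin> B"
begin

lemma p_not_0: "p \<noteq> 0" using p_prime by auto

lemma j_p_inverse: "j (inverse (of_nat p)) \<otimes> j (of_nat p) = \<one>" "j (of_nat p) \<noteq> \<zero>"
  using p_not_0 j_inverse(2)[of "of_nat p"] by (simp_all add: j_mult[symmetric])

text \<open>
  A valuation ring over \<open>B\<close> containing \<open>1/p\<close> contains \<open>F\<close>, over which everything is integral.
\<close>
lemma p_nonunit_valuation:
  assumes V: "valuation_ring V" "B \<subseteq> V" and c: "c \<in> carrier R" "c \<notin> V"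
  shows "j (inverse (of_nat p)) \<notin> V"
proof
  assume ip: "j (inverse (of_nat p)) \<in> V"
  have Vs: "subring V R" using valuation_ringD(1)[OF V(1)] .
  have "F \<subseteq> V"
  proof
    fix x assume x: "x \<in> F"
    then have xc: "x \<in> carrier R" using subfieldE(3)[OF F_subfield] by auto
    obtain e :: nat where e: "j (of_nat p ^ e) \<otimes> x \<in> B" using B_fractions[OF x] ..
    have "j (inverse (of_nat p) ^ e) \<in> V"
      by (induction e) (use ip subringE(3,6)[OF Vs] in \<open>auto simp: j_mult\<close>)
    then have "j (inverse (of_nat p) ^ e) \<otimes> (j (of_nat p ^ e) \<otimes> x) \<in> V"
      using e V(2) subringE(6)[OF Vs] by blast
    also have "j (inverse (of_nat p) ^ e) \<otimes> (j (of_nat p ^ e) \<otimes> x) = j (inverse (of_nat p) ^ e * of_nat p ^ e) \<otimes> x"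
      using xc by (simp add: j_mult m_assoc)
    also have "inverse (of_nat p) ^ e * of_nat p ^ e = (1 :: rat)" using p_not_0 by (simp add: power_inverse)
    finally show "x \<in> V" using xc by simp
  qed
  note I = IrrE[OF F_subfield c(1) alg[OF c(1)]]
  have "Irr F c \<noteq> []" using I(2) pirreducible_degree[OF F_subfield I(1)] by auto
  then have "c \<in> integral_closure R F"
    unfolding integral_closure_def using c(1) I by auto
  then have "c \<in> V" using integral_closure_mono[OF \<open>F \<subseteq> V\<close>] valuation_ring_integrally_closed[OF V(1)] by blast
  then show False using c by simp
qed

text \<open>
  The scalar is the inverse of a nonzero entry that divides all others in \<open>B\<close>.
\<close>
lemma primitive_multiple:
  assumes "set f \<subseteq> F" "\<exists>c\<in>set f. c \<noteq> \<zero>"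
  shows "\<exists>d\<in>F. (\<forall>c\<in>set f. d \<otimes> c \<in> B) \<and> (\<exists>c\<in>set f. d \<otimes> c = \<one>)"
  using assms
proof (induction f)
  case (Cons c f)
  note FE = subringE[OF subfieldE(1)[OF F_subfield]]
  have cF: "c \<in> F" "c \<in> carrier R" using Cons.prems FE(1) by auto
  have inv_c: "inv c \<in> F" "inv c \<in> carrier R" "inv c \<otimes> c = \<one>" if "c \<noteq> \<zero>"
    using subfield_m_inv[OF F_subfield, of c] cF that FE(1) by auto
  show ?case
  proof (cases "\<exists>c\<in>set f. c \<noteq> \<zero>")
    case False
    then have c0: "c \<noteq> \<zero>" using Cons.prems by auto
    show ?thesis
      by (rule bexI[of _ "inv c"]) (use inv_c[OF c0] False subringE(2,3)[OF B_subring] in auto)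
  next
    case True
    then obtain d where d: "d \<in> F" "\<And>c. c\<in>set f \<Longrightarrow> d \<otimes> c \<in> B" "\<exists>c\<in>set f. d \<otimes> c = \<one>"
      using Cons by auto
    have dc: "d \<in> carrier R" "d \<otimes> c \<in> F" using d(1) cF FE(1,6) by auto
    show ?thesis
    proof (cases "d \<otimes> c \<in> B")
      case True then show ?thesis using d by (intro bexI[of _ d]) auto
    next
      case False
      then have dcn: "d \<otimes> c \<noteq> \<zero>" using subringE(2)[OF B_subring] by auto
      then have i: "inv (d \<otimes> c) \<in> B" using B_valuation[OF dc(2)] False by blast
      have n: "d \<noteq> \<zero>" "c \<noteq> \<zero>" using dcn dc cF by auto
      note idc = inverse_props[OF dc(1) n(1)] and ic = inverse_props[OF cF(2) n(2)]
      have "inv c \<otimes> b \<in> B" if b: "b \<in> set f" for b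
      proof -
        have bc: "b \<in> carrier R" using b Cons.prems FE(1) by auto
        have "inv (d \<otimes> c) \<otimes> (d \<otimes> b) = (inv d \<otimes> d) \<otimes> (inv c \<otimes> b)"
          unfolding inverse_mult[OF dc(1) n(1) cF(2) n(2)] using idc(1) ic(1) dc(1) bc by (simp add: m_ac)
        then have "inv (d \<otimes> c) \<otimes> (d \<otimes> b) = inv c \<otimes> b" using idc ic bc by simp
        then show ?thesis using i d(2)[OF b] subringE(6)[OF B_subring] by metis
      qed
      then show ?thesis
        using inv_c[OF n(2)] subringE(3)[OF B_subring] by (intro bexI[of _ "inv c"]) auto
    qed
  qed
qed simp

definition p_multiples :: "'a set \<Rightarrow> 'a set" where
  "p_multiples V = {j (of_nat p) \<otimes> v | v. v \<in> V}"

lemma p_multiples_props: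
  assumes V: "subring V R"
  shows "a \<in> p_multiples V \<Longrightarrow> b \<in> p_multiples V \<Longrightarrow> a \<oplus> b \<in> p_multiples V"
    and "a \<in> p_multiples V \<Longrightarrow> v \<in> V \<Longrightarrow> a \<otimes> v \<in> p_multiples V"
    and "a \<in> p_multiples V \<Longrightarrow> \<ominus> a \<in> p_multiples V"
    and "v \<in> V \<Longrightarrow> j (of_nat p) \<otimes> v \<in> p_multiples V"
proof -
  note VE = subringE[OF V]
  show "v \<in> V \<Longrightarrow> j (of_nat p) \<otimes> v \<in> p_multiples V" by (auto simp: p_multiples_def)
  assume a: "a \<in> p_multiples V"
  then obtain x where x: "x \<in> V" "a = j (of_nat p) \<otimes> x" by (auto simp: p_multiples_def)
  have xc: "x \<in> carrier R" using x VE(1) by auto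
  show "a \<oplus> b \<in> p_multiples V" if b: "b \<in> p_multiples V"
  proof -
    obtain y where y: "y \<in> V" "b = j (of_nat p) \<otimes> y" using b by (auto simp: p_multiples_def)
    then have "a \<oplus> b = j (of_nat p) \<otimes> (x \<oplus> y)" using x xc VE(1) by (auto simp: r_distr)
    then show ?thesis using VE(7)[OF x(1) y(1)] unfolding p_multiples_def by blast
  qed
  show "a \<otimes> v \<in> p_multiples V" if v: "v \<in> V"
  proof -
    have "a \<otimes> v = j (of_nat p) \<otimes> (x \<otimes> v)" using x xc v VE(1) by (auto simp: m_assoc)
    then show ?thesis using VE(6)[OF x(1) v] unfolding p_multiples_def by blast
  qed
  show "\<ominus> a \<in> p_multiples V"
  proof -
    have "\<ominus> a = j (of_nat p) \<otimes> (\<ominus> x)" using x xc by (simp add: r_minus)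
    then show ?thesis using VE(5)[OF x(1)] unfolding p_multiples_def by blast
  qed
qed

lemma p_multiples_subset:
  assumes V: "subring V R" shows "p_multiples V \<subseteq> V"
proof -
  have "j (of_nat p) \<in> V" using subring_contains_Ints[OF V] by auto
  then show ?thesis using subringE(6)[OF V] by (auto simp: p_multiples_def)
qed

lemma one_notin_p_multiples:
  assumes V: "subring V R" "j (inverse (of_nat p)) \<notin> V"
  shows "\<one> \<notin> p_multiples V"
proof
  assume "\<one> \<in> p_multiples V"
  then obtain v where v: "v \<in> V" "\<one> = j (of_nat p) \<otimes> v" by (auto simp: p_multiples_def)
  have vc: "v \<in> carrier R" using v(1) subringE(1)[OF V(1)] by auto
  have "j (inverse (of_nat p)) = j (inverse (of_nat p)) \<otimes> (j (of_nat p) \<otimes> v)" using v(2)[symmetric] by simp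
  also have "\<dots> = v" using vc j_p_inverse by (simp add: m_assoc[symmetric])
  finally show False using v V(2) by simp
qed

text \<open>
  The residue field of \<open>V\<close> is algebraic over \<open>\<int>/p\<int>\<close>: an algebraic equation for \<open>a\<close>
  over \<open>F\<close> is scaled to have coefficients in \<open>B\<close> with one of them equal to 1, and each coefficient is then
  replaced by an integer congruent to it modulo \<open>p\<close>.
\<close>
lemma residue_algebraic:
  assumes V: "subring V R" "B \<subseteq> V" and a: "a \<in> V"
  obtains h where "\<not> [:int p:] dvd h" "int_eval h a \<in> p_multiples V"
proof -
  note VE = subringE[OF V(1)]
  have ac: "a \<in> carrier R" using a VE(1) by auto
  obtain f where f: "f \<in> carrier (F[X])" "f \<noteq> []" "eval f a = \<zero>"
    using algebraicE[OF subfieldE(1)[OF F_subfield] ac alg[OF ac]] .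
  have fF: "set f \<subseteq> F" "hd f \<noteq> \<zero>" using f(1,2) by (auto simp: univ_poly_carrier[symmetric] polynomial_def)
  have "\<exists>c\<in>set f. c \<noteq> \<zero>" using fF(2) f(2) by (intro bexI[of _ "hd f"]) auto
  then obtain d where d: "d \<in> F" "\<And>c. c\<in>set f \<Longrightarrow> d \<otimes> c \<in> B" "\<exists>c\<in>set f. d \<otimes> c = \<one>"
    using primitive_multiple[OF fF(1)] by blast
  define g where "g = map (\<lambda>c. d \<otimes> c) f"
  have fc: "set f \<subseteq> carrier R" "d \<in> carrier R" using fF(1) d(1) subfieldE(3)[OF F_subfield] by auto
  have gB: "set g \<subseteq> B" using d(2) unfolding g_def by auto
  have g1: "\<one> \<in> set g" using d(3) unfolding g_def set_map by (metis imageI)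
  have g0: "eval g a = \<zero>" unfolding g_def eval_scale[OF fc ac] f(3) using fc by simp
  obtain n e where ne: "\<And>z. z \<in> B \<Longrightarrow> e z \<in> B \<and> z = j (of_int (n z)) \<oplus> j (of_nat p) \<otimes> e z"
    using B_residue by metis
  have BE: "B \<subseteq> carrier R" using subringE(1)[OF B_subring] .
  have ev: "eval g a = eval (map (\<lambda>n. j (of_int n)) (map n g)) a \<oplus> j (of_nat p) \<otimes> eval (map e g) a \<and> eval (map e g) a \<in> V"
    if "set g \<subseteq> B" for g
    using that
  proof (induction g)
    case Nil then show ?case using VE by simp
  next
    case (Cons c g)
    define N where "N = eval (map (\<lambda>n. j (of_int n)) (map n g)) a"
    define E where "E = eval (map e g) a"
    have ih: "eval g a = N \<oplus> j (of_nat p) \<otimes> E" "E \<in> V" using Cons unfolding N_def E_def by auto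
    have c: "e c \<in> B" "c = j (of_int (n c)) \<oplus> j (of_nat p) \<otimes> e c" using ne[of c] Cons.prems by auto
    have car: "N \<in> carrier R" "E \<in> carrier R" "e c \<in> carrier R" "a [^] length g \<in> carrier R"
      "j (of_int (n c)) \<in> carrier R" "j (of_nat p) \<in> carrier R"
      using ih(2) VE(1) BE c(1) ac unfolding N_def by (auto intro!: eval_in_carrier)
    have "(j (of_int (n c)) \<oplus> j (of_nat p) \<otimes> e c) \<otimes> a [^] length g \<oplus> (N \<oplus> j (of_nat p) \<otimes> E)
      = (j (of_int (n c)) \<otimes> a [^] length g \<oplus> N) \<oplus> j (of_nat p) \<otimes> (e c \<otimes> a [^] length g \<oplus> E)"
      using car by algebra
    moreover have "eval (c # g) a = c \<otimes> a [^] length g \<oplus> eval g a"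
      "eval (map (\<lambda>n. j (of_int n)) (map n (c # g))) a = j (of_int (n c)) \<otimes> a [^] length g \<oplus> N"
      "eval (map e (c # g)) a = e c \<otimes> a [^] length g \<oplus> E"
      by (simp_all add: N_def E_def)
    ultimately have "eval (c # g) a = eval (map (\<lambda>n. j (of_int n)) (map n (c # g))) a \<oplus> j (of_nat p) \<otimes> eval (map e (c # g)) a"
      using c(2) ih(1) by metis
    moreover have "eval (map e (c # g)) a \<in> V"
      by (rule eval_subring[OF V(1) _ a]) (use ne Cons.prems V(2) in auto)
    ultimately show ?case by blast
  qed
  define h where "h = Poly (rev (map n g))"
  define E where "E = eval (map e g) a"
  have E: "E \<in> V" "int_eval h a \<oplus> j (of_nat p) \<otimes> E = \<zero>"
    using ev[OF gB] g0 unfolding E_def h_def int_eval_Poly[OF ac] by auto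
  have Ec: "E \<in> carrier R" using E(1) VE(1) by auto
  have "int_eval h a = \<ominus> (j (of_nat p) \<otimes> E)"
    using E(2) Ec ac by (simp add: minus_equality[symmetric] a_comm sum_zero_eq_neg)
  then have "int_eval h a \<in> p_multiples V" using p_multiples_props(3,4)[OF V(1)] E(1) by simp
  moreover have "\<not> [:int p:] dvd h"
  proof
    assume "[:int p:] dvd h"
    then have *: "int p dvd poly.coeff h k" for k by (simp add: const_poly_dvd_iff)
    obtain i where i: "i < length g" "g ! i = \<one>" using g1 by (auto simp: in_set_conv_nth)
    have "poly.coeff h (length g - 1 - i) = n (g ! i)"
      unfolding h_def coeff_Poly_eq using i(1) by (simp add: nth_default_def rev_nth)
    then have "int p dvd n \<one>" using * i(2) by metis
    then obtain k where k: "n \<one> = int p * k" by auto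
    have oB: "\<one> \<in> B" using subringE(3)[OF B_subring] .
    then have "\<one> = j (of_int (n \<one>)) \<oplus> j (of_nat p) \<otimes> e \<one>" "e \<one> \<in> B" using ne by auto
    moreover have "j (of_int (n \<one>)) = j (of_nat p) \<otimes> j (of_int k)" unfolding k by (simp add: j_mult)
    moreover have "j (of_int k) \<in> B" using subring_contains_Ints[OF B_subring] by auto
    ultimately have "\<one> \<in> p_multiples B" using p_multiples_props(1,4)[OF B_subring] by metis
    then show False using one_notin_p_multiples[OF B_subring p_nonunit] by simp
  qed
  ultimately show ?thesis using that by blast
qed

text \<open>
  The rank of \<open>V\<close> is one. By residue algebraicity \<open>t\<close> satisfies \<open>h(t) \<equiv> 0\<close> modulo \<open>p\<close> for some \<open>h\<close> that is
  nonzero modulo \<open>p\<close>. Its lowest coefficient prime to \<open>p\<close> is a unit of \<open>V\<close>; adding higher powers of the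
  nonunit \<open>t\<close> leaves a unit, so the corresponding power of \<open>t\<close> is divisible by \<open>p\<close>.
\<close>
lemma nonunit_topologically_nilpotent:
  assumes V: "valuation_ring V" "B \<subseteq> V" and ip: "j (inverse (of_nat p)) \<notin> V"
    and t: "t \<in> V" "\<not> vunit V t"
  obtains M :: nat where "t [^] M \<in> p_multiples V"
proof -
  have Vs: "subring V R" using valuation_ringD(1)[OF V(1)] .
  note VE = subringE[OF Vs]
  have tc: "t \<in> carrier R" using t VE(1) by auto
  \<comment> \<open>The factor \<open>t\<^sup>k\<close> accumulates while low coefficients divisible by \<open>p\<close> are discarded.\<close>
  have "\<exists>M::nat. t [^] M \<in> p_multiples V" if "\<not> [:int p:] dvd h" "t [^] k \<otimes> int_eval h t \<in> p_multiples V" for h and k :: nat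
    using that
  proof (induction h arbitrary: k)
    case 0 then show ?case by simp
  next
    case (pCons a h)
    have tk: "t [^] k \<in> V" "t [^] k \<in> carrier R" for k :: nat
    proof -
      show "t [^] k \<in> V" by (induction k) (use t VE in auto)
      then show "t [^] k \<in> carrier R" using VE(1) by auto
    qed
    have hV: "int_eval h t \<in> V" "int_eval h t \<in> carrier R" using int_eval_subring[OF Vs t(1)] tc by auto
    show ?case
    proof (cases "int p dvd a")
      case True
      then obtain b where b: "a = int p * b" by auto
      have "\<not> [:int p:] dvd h"
      proof
        assume "[:int p:] dvd h"
        then have "[:int p:] dvd pCons a h" using True by (auto simp: const_poly_dvd_iff coeff_pCons split: nat.split)
        then show False using pCons.prems by simp
      qed
      moreover have "t [^] Suc k \<otimes> int_eval h t \<in> p_multiples V"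
      proof -
        have jb: "j (of_int b) \<in> V" using subring_contains_Ints[OF Vs] by auto
        have ja: "j (of_int a) = j (of_nat p) \<otimes> j (of_int b)" unfolding b by (simp add: j_mult)
        have "t [^] Suc k \<otimes> int_eval h t = t [^] k \<otimes> int_eval (pCons a h) t \<oplus> \<ominus> (j (of_int a) \<otimes> t [^] k)"
          unfolding int_eval_pCons[OF tc] nat_pow_Suc using tk(2)[of k] hV(2) tc j_carrier[of "of_int a"] by algebra
        also have "\<dots> \<in> p_multiples V"
          unfolding ja by (intro p_multiples_props(1-4)[OF Vs] pCons.prems tk jb)
        finally show ?thesis .
      qed
      ultimately show ?thesis by (rule pCons.IH)
    next
      case False
      have ia: "inverse (of_int a) \<in> Z_loc p" by (rule Z_locI[OF _ False, of _ 1]) (simp add: field_simps)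
      have a0: "a \<noteq> 0" using False by auto
      have "vunit V (j (of_int a))"
        unfolding vunit_def using subring_contains_Ints[OF Vs] j_inverse[of "of_int a"] a0 ia Z_loc_B V(2)
        by (auto simp: image_subset_iff)
      then have u: "vunit V (j (of_int a) \<oplus> t \<otimes> int_eval h t)"
        using vunit_add_nonunit[OF V(1)] nonunit_mult[OF Vs t hV(1)] by blast
      define w where "w = j (of_int a) \<oplus> t \<otimes> int_eval h t"
      have w: "w \<in> carrier R" "w \<noteq> \<zero>" "inv w \<in> V" using u VE(1) unfolding w_def[symmetric] vunit_def by auto
      note iw = inverse_props[OF w(1,2)]
      have "t [^] k \<otimes> w \<in> p_multiples V" using pCons.prems(2) unfolding int_eval_pCons[OF tc] w_def .
      then have "t [^] k \<otimes> w \<otimes> inv w \<in> p_multiples V" using p_multiples_props(2)[OF Vs] w(3) by blast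
      then have "t [^] k \<in> p_multiples V" using tk(2)[of k] w iw by (simp add: m_assoc)
      then show ?thesis ..
    qed
  qed
  moreover obtain h where "\<not> [:int p:] dvd h" "int_eval h t \<in> p_multiples V" using residue_algebraic[OF Vs V(2) t(1)] .
  moreover have "t [^] (0::nat) \<otimes> int_eval h t = int_eval h t" for h using tc by simp
  ultimately show ?thesis using that by metis
qed

text \<open>
  The product of integer polynomials vanishing at the residues of the individual \<open>a\<close>. It stays nonzero
  modulo \<open>p\<close> because \<open>p\<close> is a prime element of \<open>\<int>[X]\<close>.
\<close>
lemma vanishing_at_residues:
  assumes V: "subring V R" "B \<subseteq> V" and as: "set as \<subseteq> V"
  shows "\<exists>h. \<not> [:int p:] dvd h \<and> (\<forall>x\<in>V. \<exists>v\<in>V. \<exists>w\<in>p_multiples V.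
     int_eval h x = foldr (\<lambda>a y. (x \<ominus> a) \<otimes> y) as \<one> \<otimes> v \<oplus> w)"
  using as
proof (induction as)
  case Nil
  note VE = subringE[OF V(1)]
  have z: "\<zero> \<in> p_multiples V" using p_multiples_props(4)[OF V(1) VE(2)] by simp
  show ?case
  proof (intro exI[of _ 1] conjI ballI)
    show "\<not> [:int p:] dvd 1" 
    proof
      assume "[:int p:] dvd 1"
      then have "int p dvd poly.coeff 1 0" unfolding const_poly_dvd_iff by blast
      then show False using p_prime by (auto dest: not_prime_unit)
    qed
    show "\<exists>v\<in>V. \<exists>w\<in>p_multiples V. int_eval 1 x = foldr (\<lambda>a y. (x \<ominus> a) \<otimes> y) [] \<one> \<otimes> v \<oplus> w" if "x \<in> V" for x
      using that VE(1,3) z by (intro bexI[of _ \<one>] bexI[of _ \<zero>]) auto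
  qed
next
  case (Cons a as)
  note VE = subringE[OF V(1)]
  obtain h where h: "\<not> [:int p:] dvd h"
    "\<And>x. x\<in>V \<Longrightarrow> \<exists>v\<in>V. \<exists>w\<in>p_multiples V. int_eval h x = foldr (\<lambda>a y. (x \<ominus> a) \<otimes> y) as \<one> \<otimes> v \<oplus> w"
    using Cons by auto
  have aV: "a \<in> V" "set as \<subseteq> V" using Cons.prems by auto
  obtain g where g: "\<not> [:int p:] dvd g" "int_eval g a \<in> p_multiples V" using residue_algebraic[OF V aV(1)] .
  have "prime_elem [:int p:]" using p_prime by (simp add: prime_elem_const_poly_iff)
  then have "\<not> [:int p:] dvd g * h" using g(1) h(1) prime_elem_dvd_mult_iff by blast
  moreover have "\<exists>v\<in>V. \<exists>w\<in>p_multiples V. int_eval (g * h) x = foldr (\<lambda>a y. (x \<ominus> a) \<otimes> y) (a # as) \<one> \<otimes> v \<oplus> w"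
    if x: "x \<in> V" for x
  proof -
    obtain v w where v: "v \<in> V" "w \<in> p_multiples V" "int_eval h x = foldr (\<lambda>a y. (x \<ominus> a) \<otimes> y) as \<one> \<otimes> v \<oplus> w"
      using h(2)[OF x] by blast
    obtain u where u: "u \<in> V" "int_eval g x = int_eval g a \<oplus> (x \<ominus> a) \<otimes> u" using int_eval_congruence[OF V(1) x aV(1)] by blast
    define P where "P = foldr (\<lambda>a y. (x \<ominus> a) \<otimes> y) as \<one>"
    note pVc = p_multiples_subset[OF V(1)]
    have xa: "x \<ominus> a \<in> V" if "a \<in> V" for a unfolding a_minus_def using VE(5)[OF that] VE(7)[OF x] by blast
    have P: "P \<in> V" unfolding P_def using aV(2) by (induction as) (use VE(3,6) xa in auto)
    have V3: "int_eval g a \<in> V" "w \<in> V" using g(2) v(2) pVc by auto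
    have car: "x \<ominus> a \<in> carrier R" "P \<in> carrier R" "u \<in> carrier R" "v \<in> carrier R" "w \<in> carrier R" "int_eval g a \<in> carrier R" "x \<in> carrier R"
      using xa[OF aV(1)] P u(1) v(1) V3 x VE(1) by auto
    have "int_eval (g * h) x = (int_eval g a \<oplus> (x \<ominus> a) \<otimes> u) \<otimes> (P \<otimes> v \<oplus> w)"
      unfolding int_eval_mult[OF car(7)] v(3) u(2) P_def ..
    also have "\<dots> = ((x \<ominus> a) \<otimes> P) \<otimes> (u \<otimes> v) \<oplus> (int_eval g a \<otimes> (P \<otimes> v \<oplus> w) \<oplus> w \<otimes> ((x \<ominus> a) \<otimes> u))"
    proof -
      define d where "d = x \<ominus> a"
      have "d \<in> carrier R" using car(1) unfolding d_def .
      then show ?thesis unfolding d_def[symmetric] using car(2-6) by algebra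
    qed
    finally have "int_eval (g * h) x = foldr (\<lambda>a y. (x \<ominus> a) \<otimes> y) (a # as) \<one> \<otimes> (u \<otimes> v) \<oplus> (int_eval g a \<otimes> (P \<otimes> v \<oplus> w) \<oplus> w \<otimes> ((x \<ominus> a) \<otimes> u))"
      unfolding P_def by simp
    moreover have "int_eval g a \<otimes> (P \<otimes> v \<oplus> w) \<oplus> w \<otimes> ((x \<ominus> a) \<otimes> u) \<in> p_multiples V"
      by (intro p_multiples_props(1,2)[OF V(1)] g(2) v(2) VE(6) VE(7) P V3 xa aV u(1) v(1))
    ultimately show ?thesis using VE(6)[OF u(1) v(1)] by blast
  qed
  ultimately show ?case by blast
qed

text \<open>
  With \<open>c\<close> the constant of the factorization of \<open>f\<close> and \<open>t\<close> its inverse, \<open>f(x) \<in> V\<close> makes the product of the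
  \<open>x - a\<close> a multiple of \<open>t\<close>. Hence \<open>h(x)\<close> is a multiple of \<open>t\<close> modulo \<open>p\<close>, and its \<open>M\<close>-th power is a multiple of
  \<open>t\<^sup>M\<close> modulo \<open>p\<close>, thus of \<open>p\<close>, with \<open>M\<close> independent of \<open>x\<close>.
\<close>
lemma separating_polynomial:
  assumes f: "f \<in> carrier (poly_ring R)" "\<not> set f \<subseteq> integral_closure R B"
  obtains V h where "valuation_ring V" "B \<subseteq> V" "j (inverse (of_nat p)) \<notin> V" "\<not> [:int p:] dvd h"
    "\<And>x. x \<in> V \<Longrightarrow> eval f x \<in> V \<Longrightarrow> j (inverse (of_nat p)) \<otimes> int_eval h x \<in> V"
proof -
  have fc: "set f \<subseteq> carrier R" using f(1) by (auto simp: univ_poly_carrier[symmetric] polynomial_def)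
  obtain c0 where c0: "c0 \<in> set f" "c0 \<notin> integral_closure R B" using f(2) by auto
  obtain V where V: "valuation_ring V" "B \<subseteq> V" "c0 \<notin> V" using valuation_ring_avoiding_nonintegral[OF B_subring _ c0(2)] c0(1) fc by blast
  have Vs: "subring V R" using valuation_ringD(1)[OF V(1)] .
  note VE = subringE[OF Vs]
  have ip: "j (inverse (of_nat p)) \<notin> V" using p_nonunit_valuation[OF V(1,2) _ V(3)] c0(1) fc by auto
  obtain n where len: "length f = Suc n" using c0(1) by (cases f) auto
  from valuation_factorization[OF V(1) f(1) len]
  obtain c as where c': "c \<in> carrier R \<and> c \<noteq> \<zero> \<and> set as \<subseteq> V \<and> (c \<in> V \<longrightarrow> set f \<subseteq> V) \<and>
      (\<forall>x\<in>V. \<exists>u. vunit V u \<and> eval f x = c \<otimes> u \<otimes> foldr (\<lambda>a y. (x \<ominus> a) \<otimes> y) as \<one>)"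
    by (elim exE)
  have c: "c \<in> carrier R" "c \<noteq> \<zero>" "set as \<subseteq> V" "c \<in> V \<longrightarrow> set f \<subseteq> V"
    "\<And>x. x\<in>V \<Longrightarrow> \<exists>u. vunit V u \<and> eval f x = c \<otimes> u \<otimes> foldr (\<lambda>a y. (x \<ominus> a) \<otimes> y) as \<one>"
    using c' by auto
  have cV: "c \<notin> V" using c(4) V(3) c0(1) by auto
  define t where "t = inv c"
  have t: "t \<in> V" "\<not> vunit V t" "t \<in> carrier R" "t \<otimes> c = \<one>"
    using inv_nonunit[OF V(1) c(1) cV] inverse_props[OF c(1,2)] unfolding t_def by auto
  obtain M :: nat where M: "t [^] M \<in> p_multiples V" using nonunit_topologically_nilpotent[OF V(1,2) ip t(1,2)] .
  obtain h where h: "\<not> [:int p:] dvd h"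
    "\<And>x. x\<in>V \<Longrightarrow> \<exists>v\<in>V. \<exists>w\<in>p_multiples V. int_eval h x = foldr (\<lambda>a y. (x \<ominus> a) \<otimes> y) as \<one> \<otimes> v \<oplus> w"
    using vanishing_at_residues[OF Vs V(2) c(3)] by blast
  have "prime_elem [:int p:]" using p_prime by (simp add: prime_elem_const_poly_iff)
  then have hM: "\<not> [:int p:] dvd h ^ M" using h(1) prime_elem_dvd_power by blast
  have "j (inverse (of_nat p)) \<otimes> int_eval (h ^ M) x \<in> V" if x: "x \<in> V" and fx: "eval f x \<in> V" for x
  proof -
    have xc: "x \<in> carrier R" using x VE(1) by auto
    define P where "P = foldr (\<lambda>a y. (x \<ominus> a) \<otimes> y) as \<one>"
    have xa: "x \<ominus> a \<in> V" if "a \<in> V" for a unfolding a_minus_def using VE(5)[OF that] VE(7)[OF x] by blast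
    have P: "P \<in> V" unfolding P_def using c(3) by (induction as) (use VE(3,6) xa in auto)
    obtain u where u: "vunit V u" "eval f x = c \<otimes> u \<otimes> P" using c(5)[OF x] unfolding P_def by blast
    obtain v w where v: "v \<in> V" "w \<in> p_multiples V" "int_eval h x = P \<otimes> v \<oplus> w" using h(2)[OF x] unfolding P_def by blast
    note pVV = p_multiples_subset[OF Vs]
    have car: "P \<in> carrier R" "u \<in> carrier R" "u \<noteq> \<zero>" "v \<in> carrier R" "w \<in> carrier R"
      using P u(1) v(1,2) pVV VE(1) by (auto simp: vunit_def)
    note iu = inverse_props[OF car(2,3)]
    define s where "s = inv u \<otimes> eval f x \<otimes> v"
    have s: "s \<in> V" "s \<in> carrier R" using u(1) fx v(1) VE(1,6) unfolding s_def vunit_def by auto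
    have "t \<otimes> s = (t \<otimes> c) \<otimes> (inv u \<otimes> u) \<otimes> P \<otimes> v"
      unfolding s_def u(2) using t(3) c(1) iu(1) car by (simp add: m_ac)
    then have ts: "P \<otimes> v = t \<otimes> s" using t(4) iu car by simp
    have pow: "\<exists>z\<in>p_multiples V. (t \<otimes> s \<oplus> w) [^] n = (t \<otimes> s) [^] n \<oplus> z" for n :: nat
    proof (induction n)
      case 0
      have "\<zero> \<in> p_multiples V" using p_multiples_props(4)[OF Vs VE(2)] by simp
      then show ?case by (intro bexI[of _ \<zero>]) auto
    next
      case (Suc n)
      then obtain z where z: "z \<in> p_multiples V" "(t \<otimes> s \<oplus> w) [^] n = (t \<otimes> s) [^] n \<oplus> z" by blast
      define a where "a = t \<otimes> s"
      define b where "b = a [^] n"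
      have a: "a \<in> V" "a \<in> carrier R" using VE(6)[OF t(1) s(1)] VE(1) unfolding a_def by auto
      have b: "b \<in> V" "b \<in> carrier R"
      proof -
        show "b \<in> V" unfolding b_def by (induction n) (use a VE in auto)
        then show "b \<in> carrier R" using VE(1) by auto
      qed
      have zc: "z \<in> carrier R" "z \<in> V" using z(1) pVV VE(1) by auto
      have "(a \<oplus> w) [^] Suc n = (b \<oplus> z) \<otimes> (a \<oplus> w)" using z(2) unfolding a_def[symmetric] b_def[symmetric] by simp
      also have "\<dots> = b \<otimes> a \<oplus> (z \<otimes> (a \<oplus> w) \<oplus> w \<otimes> b)" using a(2) b(2) zc(1) car(5) by algebra
      finally have "(a \<oplus> w) [^] Suc n = a [^] Suc n \<oplus> (z \<otimes> (a \<oplus> w) \<oplus> w \<otimes> b)" unfolding b_def by simp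
      moreover have "z \<otimes> (a \<oplus> w) \<oplus> w \<otimes> b \<in> p_multiples V"
        using v(2) pVV by (intro p_multiples_props(1,2)[OF Vs] z(1) VE(7) a b) auto
      ultimately show ?case unfolding a_def by blast
    qed
    then obtain z where z: "z \<in> p_multiples V" "(t \<otimes> s \<oplus> w) [^] M = (t \<otimes> s) [^] M \<oplus> z" by blast
    have "(t \<otimes> s) [^] M = t [^] M \<otimes> s [^] M" using t(3) s(2) by (simp add: nat_pow_distrib)
    also have "\<dots> \<in> p_multiples V"
    proof (rule p_multiples_props(2)[OF Vs M])
      show "s [^] M \<in> V" by (induction M) (use s VE in auto)
    qed
    finally have "int_eval (h ^ M) x \<in> p_multiples V"
      unfolding int_eval_power[OF xc] v(3) ts z(2) using z(1) p_multiples_props(1)[OF Vs] by blast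
    then obtain y where y: "y \<in> V" "int_eval (h ^ M) x = j (of_nat p) \<otimes> y" by (auto simp: p_multiples_def)
    have yc: "y \<in> carrier R" using y VE(1) by auto
    have "j (inverse (of_nat p)) \<otimes> int_eval (h ^ M) x = y"
      unfolding y(2) using yc j_p_inverse by (simp add: m_assoc[symmetric])
    then show ?thesis using y by simp
  qed
  then show ?thesis using that[OF V(1,2) ip hM] by blast
qed

end

section \<open>Comparing the rational and the \<open>p\<close>-adic side\<close>

locale padic_comparison = L: rat_embedded L j + K: padic_closed K \<rho> p F B
  for L :: "'a ring" and j and K :: "'b ring" and \<rho> and p F B +
  fixes S :: "'a set" and \<Sigma> :: "'b set"
  assumes L_algebraic: "x \<in> carrier L \<Longrightarrow> (ring.algebraic L over range j) x"
    and S_integral: "S \<subseteq> integral_closure L (j ` \<int>)"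
    and Sigma_eq: "\<Sigma> = {x \<in> integral_closure K B.
          \<exists>f \<in> min_polys L j S. ring.eval K (map \<rho> f) x = \<zero>\<^bsub>K\<^esub>}"
begin

abbreviation "Lp \<equiv> integral_closure L (j ` Z_loc p)"
abbreviation "Kp \<equiv> integral_closure K B"

lemma Lp_subring: "subring Lp L" and Kp_subring: "subring Kp K"
  using L.integral_closure_subring[OF L.subring_Z_loc[OF K.p_prime]]
    K.integral_closure_subring[OF K.B_subring] by auto

lemma S_subset: "S \<subseteq> Lp"
  using S_integral L.integral_closure_mono[OF L.Ints_subset_Z_loc[OF K.p_prime]] by blast

lemma Sigma_subset: "\<Sigma> \<subseteq> Kp"
  unfolding Sigma_eq by auto

definition \<phi> :: "'a \<Rightarrow> 'b" where "\<phi> x = \<rho> (inv_into UNIV j x)"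

lemma phi_j [simp]: "\<phi> (j q) = \<rho> q"
proof -
  have "inj j" using L.j_inj by (auto intro: injI)
  then show ?thesis by (simp add: \<phi>_def)
qed

lemma phi_hom: "\<phi> \<in> ring_hom (L\<lparr>carrier := range j\<rparr>) K"
proof (rule ring_hom_memI)
  fix x y assume "x \<in> carrier (L\<lparr>carrier := range j\<rparr>)" "y \<in> carrier (L\<lparr>carrier := range j\<rparr>)"
  then obtain a b where ab: "x = j a" "y = j b" by auto
  show "\<phi> x \<in> carrier K" unfolding ab by simp
  show "\<phi> (x \<otimes>\<^bsub>L\<lparr>carrier := range j\<rparr>\<^esub> y) = \<phi> x \<otimes>\<^bsub>K\<^esub> \<phi> y"
    using phi_j[of "a * b"] unfolding ab by (simp add: L.j_mult K.j_mult)
  show "\<phi> (x \<oplus>\<^bsub>L\<lparr>carrier := range j\<rparr>\<^esub> y) = \<phi> x \<oplus>\<^bsub>K\<^esub> \<phi> y"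
    using phi_j[of "a + b"] unfolding ab by (simp add: L.j_add K.j_add)
next
  show "\<phi> \<one>\<^bsub>L\<lparr>carrier := range j\<rparr>\<^esub> = \<one>\<^bsub>K\<^esub>" using phi_j[of 1] by simp
qed

lemma map_phi [simp]: "map \<phi> (map j f) = map \<rho> f"
  by simp

lemma min_poly_rat:
  assumes "x \<in> carrier L"
  obtains f where "ring.Irr L (range j) x = map j f"
proof -
  have "set (ring.Irr L (range j) x) \<subseteq> range j"
    using L.IrrE(1)[OF L.subfield_range assms L_algebraic[OF assms]]
    by (auto simp: univ_poly_carrier[symmetric] polynomial_def)
  then have "\<exists>f. ring.Irr L (range j) x = map j f" unfolding ex_map_conv by blast
  then show ?thesis using that by blast
qed

text \<open>
  A rational number that is not \<open>p\<close>-integral has its inverse in \<open>B\<close>, so integrality over \<open>B\<close> would put it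
  in \<open>B\<close> and invert \<open>p\<close> there.
\<close>
lemma rho_not_integral:
  assumes q: "q \<notin> Z_loc p" shows "\<rho> q \<notin> Kp"
proof
  assume a: "\<rho> q \<in> Kp"
  note i = Z_loc_inverse[OF K.p_prime q]
  have "\<rho> (inverse q) \<in> B" using i(3) K.Z_loc_B by auto
  then have "inv\<^bsub>K\<^esub> (\<rho> q) \<in> B" using K.j_inverse(1)[OF i(2)] by simp
  then have "\<rho> q \<in> B" using K.integral_inverse_mem[OF K.B_subring a] K.j_inverse(2)[OF i(2)] by blast
  then show False using K.inverse_p_mem[OF K.p_prime K.B_subring K.Z_loc_B q] K.p_nonunit by blast
qed

text \<open>
  For a conjugate \<open>x\<close> of \<open>s\<close>, the homomorphism \<open>s \<mapsto> x\<close> carries the integral equation of \<open>f(s)\<close> to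
  one for \<open>f(x)\<close>, so the same polynomial works.
\<close>
lemma rational_imp_padic:
  assumes "Int_nontrivial L (range j) S Lp"
  shows "Int_nontrivial K F \<Sigma> Kp"
proof -
  obtain f where f: "f \<in> Int_poly L (range j) S Lp" "\<not> set f \<subseteq> Lp"
    using assms L.Int_nontrivial_iff_coefficient[OF Lp_subring S_subset] by blast
  have fp: "set f \<subseteq> range j" "f \<noteq> [] \<Longrightarrow> hd f \<noteq> \<zero>\<^bsub>L\<^esub>"
    using f(1) unfolding Int_poly_def by (auto simp: univ_poly_carrier[symmetric] polynomial_def)
  then have "\<exists>u. f = map j u" unfolding ex_map_conv by blast
  then obtain u where u: "f = map j u" ..
  define f' where "f' = map \<rho> u"
  have rF: "\<rho> q \<in> F" for q
  proof (cases "q \<in> Z_loc p")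
    case True then show ?thesis using K.Z_loc_B K.B_subset by auto
  next
    case False
    note i = Z_loc_inverse[OF K.p_prime False]
    have "\<rho> (inverse q) \<in> F" using i(3) K.Z_loc_B K.B_subset by auto
    moreover have "\<rho> (inverse q) \<noteq> \<zero>\<^bsub>K\<^esub>" using K.j_inverse(2)[of "inverse q"] i(2) by simp
    ultimately have "inv\<^bsub>K\<^esub> \<rho> (inverse q) \<in> F" using K.subfield_m_inv(1)[OF K.F_subfield] by blast
    then show ?thesis using K.j_inverse(1)[of "inverse q"] i(2) by simp
  qed
  have "f' \<in> Int_poly K F \<Sigma> Kp"
    unfolding Int_poly_def
  proof (intro CollectI conjI ballI)
    have "hd f' \<noteq> \<zero>\<^bsub>K\<^esub>" if "f' \<noteq> []"
    proof -
      from that obtain q v where q: "u = q # v" unfolding f'_def by (cases u) auto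
      then have "q \<noteq> 0" using fp(2) unfolding u by auto
      then show ?thesis using K.j_inverse(2)[of q] q unfolding f'_def by auto
    qed
    then show "f' \<in> carrier (univ_poly K F)"
      using rF by (auto simp: univ_poly_carrier[symmetric] polynomial_def f'_def)
    fix x assume "x \<in> \<Sigma>"
    then obtain P where x: "x \<in> Kp" and P: "P \<in> min_polys L j S" "ring.eval K (map \<rho> P) x = \<zero>\<^bsub>K\<^esub>"
      unfolding Sigma_eq by auto
    obtain s where s: "s \<in> S" "map j P = ring.Irr L (range j) s" using P(1) unfolding min_polys_def by auto
    have sc: "s \<in> carrier L" using s(1) S_subset L.integral_closure_carrier by blast
    have xc: "x \<in> carrier K" using x K.integral_closure_carrier by blast
    have "ring.eval K (map \<phi> (ring.Irr L (range j) s)) x = \<zero>\<^bsub>K\<^esub>"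
      unfolding s(2)[symmetric] map_phi by (rule P(2))
    then obtain \<psi> where psi: "\<psi> \<in> ring_hom (L\<lparr>carrier := ring.simple_extension L (range j) s\<rparr>) K"
      "\<And>a. a \<in> range j \<Longrightarrow> \<psi> a = \<phi> a" "\<psi> s = x"
      using extend_hom_simple_extension[OF L.field_axioms K.field_axioms L.subfield_range sc L_algebraic[OF sc] phi_hom xc] by blast
    let ?E = "ring.simple_extension L (range j) s"
    have rs: "subring (range j) L" using subfieldE(1)[OF L.subfield_range] .
    have E: "subring ?E L" "range j \<subseteq> ?E" "s \<in> ?E"
      using L.simple_extension_is_subring[OF rs sc] L.simple_extension_incl[OF subringE(1)[OF rs] sc]
        L.simple_extension_mem[OF rs sc] by auto
    interpret h: ring_hom_ring "L\<lparr>carrier := ?E\<rparr>" K \<psi>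
      by (rule ring_hom_ringI2[OF L.subring_is_ring[OF E(1)] K.ring_axioms psi(1)])
    have fs: "ring.eval L f s \<in> ?E" "ring.eval L f s \<in> Lp"
      using L.eval_subring[OF E(1) _ E(3), of f] fp(1) E(2) f(1) s(1) unfolding Int_poly_def by auto
    have "\<psi> (ring.eval L f s) \<in> Kp"
      by (rule hom_integral[OF L.field_axioms K.field_axioms E(1) psi(1) _ _ fs(2,1)])
        (use E(2) psi(2) K.Z_loc_B in auto)
    also have "\<psi> (ring.eval L f s) = ring.eval K (map \<psi> f) (\<psi> s)"
      using h.eval_hom'[of s f] fp(1) E by (auto simp: L.eval_consistent[OF E(1)])
    also have "map \<psi> f = f'" unfolding u f'_def using psi(2) by simp
    finally show "ring.eval K f' x \<in> Kp" using psi(3) by simp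
  qed
  moreover have "\<not> set f' \<subseteq> Kp"
  proof -
    obtain q where q: "q \<in> set u" "j q \<notin> Lp" using f(2) unfolding u by auto
    have "q \<notin> Z_loc p" using q(2) L.subring_subset_integral_closure[OF L.subring_Z_loc[OF K.p_prime]] by auto
    then show ?thesis using rho_not_integral q(1) unfolding f'_def by auto
  qed
  ultimately show ?thesis using K.Int_nontrivial_iff_coefficient[OF Kp_subring Sigma_subset] by blast
qed

lemma padic_imp_closure:
  assumes "Int_nontrivial K F \<Sigma> Kp"
  shows "Int_nontrivial K (carrier K) \<Sigma> Kp"
proof -
  have "Int_poly K F \<Sigma> Kp \<subseteq> Int_poly K (carrier K) \<Sigma> Kp"
    using subfieldE(3)[OF K.F_subfield] unfolding Int_poly_def
    by (auto simp: univ_poly_carrier[symmetric] polynomial_def)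
  then show ?thesis using assms unfolding K.Int_nontrivial_iff_coefficient[OF Kp_subring Sigma_subset] by blast
qed

text \<open>
  Let \<open>\<alpha> = g(s)\<close>. Each root of its minimal polynomial in \<open>K\<close> is \<open>g(x)\<close> for a conjugate \<open>x\<close> of \<open>s\<close>, which
  belongs to \<open>\<Sigma>\<close> because \<open>s\<close> is integral over \<open>\<int>\<close>. So all these roots lie in \<open>V\<close>, the rational coefficients
  of the minimal polynomial lie in \<open>V\<close>, and hence they are \<open>p\<close>-integral.
\<close>
lemma integral_if_conjugate_values:
  assumes V: "subring V K" "B \<subseteq> V" "\<rho> (inverse (of_nat p)) \<notin> V"
    and s: "s \<in> S" and g: "set g \<subseteq> range j"
    and val: "\<And>x. x \<in> \<Sigma> \<Longrightarrow> ring.eval K (map \<phi> g) x \<in> V"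
  shows "ring.eval L g s \<in> Lp"
proof -
  have sc: "s \<in> carrier L" using s S_subset L.integral_closure_carrier by blast
  have gc: "set g \<subseteq> carrier L" using g by auto
  define \<alpha> where "\<alpha> = ring.eval L g s"
  have \<alpha>: "\<alpha> \<in> carrier L" unfolding \<alpha>_def by (rule L.eval_in_carrier[OF gc sc])
  obtain r where r: "ring.Irr L (range j) \<alpha> = map j r" using min_poly_rat[OF \<alpha>] .
  obtain P where P: "ring.Irr L (range j) s = map j P" using min_poly_rat[OF sc] .
  note I = L.IrrE[OF L.subfield_range \<alpha> L_algebraic[OF \<alpha>]]
  have Ine: "ring.Irr L (range j) \<alpha> \<noteq> []"
    using L.pirreducible_degree[OF L.subfield_range I(1,2)] by auto
  define D where "D = map \<rho> r"
  have rn: "r \<noteq> []" using Ine r by auto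
  have hr: "hd r = 1" using I(3) rn L.j_inj[of "hd r" 1] unfolding r by (simp add: hd_map)
  have hD: "hd D = \<one>\<^bsub>K\<^esub>" unfolding D_def using rn hr by (simp add: hd_map)
  have Dc: "D \<in> carrier (poly_ring K)"
    using hD by (auto simp: univ_poly_carrier[symmetric] polynomial_def D_def)
  have roots: "y \<in> V" if y: "y \<in> carrier K" "ring.eval K D y = \<zero>\<^bsub>K\<^esub>" for y
  proof -
    have "ring.eval K (map \<phi> (ring.Irr L (range j) \<alpha>)) y = \<zero>\<^bsub>K\<^esub>" unfolding r map_phi using y(2) D_def by simp
    then obtain E \<psi> where E: "subring E L" "range j \<subseteq> E" "s \<in> E" "\<alpha> \<in> E" "\<psi> \<in> ring_hom (L\<lparr>carrier := E\<rparr>) K"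
      "\<And>a. a \<in> range j \<Longrightarrow> \<psi> a = \<phi> a" "\<psi> \<alpha> = y"
      using extend_hom_root[OF L.field_axioms K.algebraically_closed_axioms L.subfield_range sc L_algebraic[OF sc]
          \<alpha> L_algebraic[OF \<alpha>] phi_hom y(1)] by blast
    interpret h: ring_hom_ring "L\<lparr>carrier := E\<rparr>" K \<psi>
      by (rule ring_hom_ringI2[OF L.subring_is_ring[OF E(1)] K.ring_axioms E(5)])
    have ev: "\<psi> (ring.eval L f s) = ring.eval K (map \<phi> f) (\<psi> s)" if f: "set f \<subseteq> range j" for f
    proof -
      have mp: "map \<psi> f = map \<phi> f" using f E(6) by auto
      have "\<psi> (ring.eval L f s) = ring.eval K (map \<psi> f) (\<psi> s)"
        using h.eval_hom'[of s f] f E(2,3) by (auto simp: L.eval_consistent[OF E(1)])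
      then show ?thesis by (simp only: mp)
    qed
    have "\<psi> s \<in> Kp"
      by (rule hom_integral[OF L.field_axioms K.field_axioms E(1,5) _ _ subsetD[OF S_integral s] E(3)])
        (use E(2,6) K.subring_contains_Ints[OF K.B_subring] in auto)
    moreover have "ring.eval K (map \<rho> P) (\<psi> s) = \<zero>\<^bsub>K\<^esub>"
    proof -
      have "set (map j P) \<subseteq> range j" by auto
      from ev[OF this] show ?thesis
        using L.IrrE(4)[OF L.subfield_range sc L_algebraic[OF sc]] h.hom_zero unfolding P map_phi by simp
    qed
    moreover have "P \<in> min_polys L j S" unfolding min_polys_def using P[symmetric] s by blast
    ultimately have "\<psi> s \<in> \<Sigma>" unfolding Sigma_eq by blast
    then have "ring.eval K (map \<phi> g) (\<psi> s) \<in> V" by (rule val)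
    then show ?thesis using ev[OF g] E(7) unfolding \<alpha>_def by simp
  qed
  obtain n where "length D = Suc n" using rn unfolding D_def by (cases r) auto
  then have DV: "set D \<subseteq> V" by (rule K.monic_coeffs_from_roots[OF V(1) Dc _ hD roots])
  have "set r \<subseteq> Z_loc p"
  proof
    fix q assume "q \<in> set r"
    then have "\<rho> q \<in> V" using DV unfolding D_def by auto
    then show "q \<in> Z_loc p"
      using K.inverse_p_mem[OF K.p_prime V(1)] K.Z_loc_B V(2,3) by blast
  qed
  then have "polynomial\<^bsub>L\<^esub> (j ` Z_loc p) (ring.Irr L (range j) \<alpha>)"
    using I(3) r rn by (auto simp: polynomial_def)
  then show ?thesis
    using I(3,4) Ine \<alpha> unfolding integral_closure_def \<alpha>_def[symmetric] univ_poly_carrier by blast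
qed

text \<open>
  The new polynomial is the separating polynomial divided by \<open>p\<close>; it is nontrivial because the separating
  polynomial has a coefficient prime to \<open>p\<close>.
\<close>
lemma closure_imp_rational:
  assumes "Int_nontrivial K (carrier K) \<Sigma> Kp"
  shows "Int_nontrivial L (range j) S Lp"
proof -
  obtain f where f: "f \<in> Int_poly K (carrier K) \<Sigma> Kp" "\<not> set f \<subseteq> Kp"
    using assms K.Int_nontrivial_iff_coefficient[OF Kp_subring Sigma_subset] by blast
  then have fc: "f \<in> carrier (poly_ring K)" unfolding Int_poly_def by auto
  obtain V h where V: "K.valuation_ring V" "B \<subseteq> V" "\<rho> (inverse (of_nat p)) \<notin> V"
    and h: "\<not> [:int p:] dvd h"
    "\<And>x. x \<in> V \<Longrightarrow> ring.eval K f x \<in> V \<Longrightarrow> \<rho> (inverse (of_nat p)) \<otimes>\<^bsub>K\<^esub> K.int_eval h x \<in> V"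
    by (rule K.separating_polynomial[OF fc f(2)]) blast
  have KpV: "Kp \<subseteq> V"
    using K.integral_closure_mono[OF V(2)] K.valuation_ring_integrally_closed[OF V(1)] by blast
  define g where "g = map (\<lambda>n. j (of_int n / of_nat p)) (rev (coeffs h))"
  have g: "set g \<subseteq> range j" unfolding g_def by auto
  have h0: "h \<noteq> 0" using h(1) by auto
  have "hd (rev (coeffs h)) \<noteq> 0" using h0 by (simp add: hd_rev last_coeffs_eq_coeff_degree)
  then have "hd g \<noteq> \<zero>\<^bsub>L\<^esub>" using h0 K.p_not_0 L.j_inj[of _ 0] unfolding g_def by (simp add: hd_map)
  then have gp: "g \<in> carrier (univ_poly L (range j))"
    using g by (auto simp: univ_poly_carrier[symmetric] polynomial_def)
  have "g \<in> Int_poly L (range j) S Lp"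
    unfolding Int_poly_def
  proof (intro CollectI conjI ballI)
    show "g \<in> carrier (univ_poly L (range j))" by fact
    fix s assume s: "s \<in> S"
    show "ring.eval L g s \<in> Lp"
    proof (rule integral_if_conjugate_values[OF K.valuation_ringD(1)[OF V(1)] V(2,3) s g])
      fix x assume x: "x \<in> \<Sigma>"
      then have xV: "x \<in> Kp" "x \<in> V" using Sigma_subset KpV by auto
      then have xc: "x \<in> carrier K" using K.integral_closure_carrier by blast
      have "ring.eval K f x \<in> V" using f(1) x KpV unfolding Int_poly_def by auto
      then have "\<rho> (inverse (of_nat p)) \<otimes>\<^bsub>K\<^esub> K.int_eval h x \<in> V" by (rule h(2)[OF xV(2)])
      also have "\<rho> (inverse (of_nat p)) \<otimes>\<^bsub>K\<^esub> K.int_eval h x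
        = ring.eval K (map (\<lambda>c. \<rho> (inverse (of_nat p)) \<otimes>\<^bsub>K\<^esub> c) (map (\<lambda>n. \<rho> (of_int n)) (rev (coeffs h)))) x"
        unfolding K.int_eval_def by (rule K.eval_scale[symmetric]) (use xc in auto)
      also have "map (\<lambda>c. \<rho> (inverse (of_nat p)) \<otimes>\<^bsub>K\<^esub> c) (map (\<lambda>n. \<rho> (of_int n)) (rev (coeffs h))) = map \<phi> g"
        unfolding g_def by (simp add: K.j_mult[symmetric] divide_inverse mult.commute)
      finally show "ring.eval K (map \<phi> g) x \<in> V" .
    qed
  qed
  moreover have "\<not> set g \<subseteq> Lp"
  proof -
    obtain i where i: "\<not> int p dvd poly.coeff h i" using h(1) by (auto simp: const_poly_dvd_iff)
    then have "poly.coeff h i \<noteq> 0" by auto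
    then have "poly.coeff h i \<in> set (coeffs h)" by (metis coeff_in_coeffs h0 le_degree)
    then have "j (of_int (poly.coeff h i) / of_nat p) \<in> set g" unfolding g_def by auto
    then show ?thesis using L.not_integral_if_not_Z_loc[OF K.p_prime int_div_prime_notin_Z_loc[OF K.p_prime i]] by blast
  qed
  ultimately show ?thesis using L.Int_nontrivial_iff_coefficient[OF Lp_subring S_subset] by blast
qed

end

section \<open>The \<open>p\<close>-adic numbers\<close>

locale padic =
  fixes p :: nat
  assumes p_prime: "Factorial_Ring.prime p"
begin

abbreviation pabs :: "rat \<Rightarrow> real" where "pabs \<equiv> padic_abs p"

lemma p_pos: "p > 0" "real p > 1" "p \<noteq> 0"
  using p_prime prime_gt_1_nat[OF p_prime] by auto

lemma padic_val_frac:
  assumes "a \<noteq> 0" "b \<noteq> 0"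
  shows "padic_val p (of_int a / of_int b) = int (multiplicity (int p) a) - int (multiplicity (int p) b)"
proof -
  obtain c d where cd: "quotient_of (of_int a / of_int b) = (c, d)" by force
  then have q: "of_int a / of_int b = (of_int c / of_int d :: rat)" "d > 0"
    using quotient_of_div quotient_of_denom_pos by auto
  have "(of_int (a * d) :: rat) = of_int (c * b)" using q assms by (simp add: field_simps)
  then have e: "a * d = c * b" by (simp only: of_int_eq_iff)
  then have c: "c \<noteq> 0" using assms q(2) by auto
  have pe: "prime_elem (int p)" using p_prime by (auto intro: prime_imp_prime_elem)
  have "multiplicity (int p) a + multiplicity (int p) d = multiplicity (int p) c + multiplicity (int p) b"
    using arg_cong[OF e, of "multiplicity (int p)"] assms c q(2) prime_elem_multiplicity_mult_distrib[OF pe] by simp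
  then show ?thesis using cd by (simp add: padic_val_def)
qed

lemma padic_val_mult:
  assumes "x \<noteq> 0" "y \<noteq> 0" shows "padic_val p (x * y) = padic_val p x + padic_val p y"
proof -
  obtain a b where ab: "quotient_of x = (a, b)" by force
  obtain c d where cd: "quotient_of y = (c, d)" by force
  have x: "x = of_int a / of_int b" "b \<noteq> 0" "a \<noteq> 0"
    using quotient_of_div[OF ab] quotient_of_denom_pos[OF ab] assms by auto
  have y: "y = of_int c / of_int d" "d \<noteq> 0" "c \<noteq> 0"
    using quotient_of_div[OF cd] quotient_of_denom_pos[OF cd] assms by auto
  have pe: "prime_elem (int p)" using p_prime by (auto intro: prime_imp_prime_elem)
  have "x * y = of_int (a * c) / of_int (b * d)" using x y by simp
  then show ?thesis
    using padic_val_frac[of "a * c" "b * d"] padic_val_frac[OF x(3,2)] padic_val_frac[OF y(3,2)] x y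
      prime_elem_multiplicity_mult_distrib[OF pe] by simp
qed

lemma pabs_0 [simp]: "pabs 0 = 0"
  and pabs_nonneg [simp]: "pabs x \<ge> 0"
  and pabs_eq_0 [simp]: "pabs x = 0 \<longleftrightarrow> x = 0"
  using p_pos by (auto simp: padic_abs_def)

lemma pabs_pos: "x \<noteq> 0 \<Longrightarrow> pabs x > 0"
  using pabs_nonneg[of x] pabs_eq_0[of x] by linarith

lemma pabs_mult: "pabs (x * y) = pabs x * pabs y"
  using p_pos by (auto simp: padic_abs_def padic_val_mult power_int_add power_int_minus power_int_diff field_simps)

lemma pabs_1 [simp]: "pabs 1 = 1"
  using pabs_mult[of 1 1] by auto

lemma pabs_inverse: "pabs (inverse x) = inverse (pabs x)"
proof (cases "x = 0")
  case False
  then have "pabs x * pabs (inverse x) = 1" using pabs_mult[of x "inverse x"] by simp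
  then show ?thesis by (simp add: inverse_unique)
qed simp

lemma pabs_minus [simp]: "pabs (- x) = pabs x"
proof -
  have "pabs (- 1) * pabs (- 1) = 1" using pabs_mult[of "-1" "-1"] by simp
  then have "pabs (- 1) = 1" using pabs_nonneg[of "-1"] by (metis abs_of_nonneg abs_mult_self_eq real_sqrt_abs2 real_sqrt_one)
  then show ?thesis using pabs_mult[of "-1" x] by simp
qed

text \<open>
  Identifies the unit ball with the localisation, so that its closure under addition becomes
  the ultrametric inequality below.
\<close>
lemma pabs_le_1_iff: "pabs x \<le> 1 \<longleftrightarrow> x \<in> Z_loc p"
proof (cases "x = 0")
  case True
  then show ?thesis using Z_loc_of_int[OF p_prime, of 0] by simp
next
  case False
  obtain c d where cd: "quotient_of x = (c, d)" by force
  then have x: "x = of_int c / of_int d" "d > 0" "coprime c d"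
    using quotient_of_div quotient_of_denom_pos quotient_of_coprime by auto
  have ab: "pabs x = real p powi (- padic_val p x)" using False by (simp add: padic_abs_def)
  show ?thesis
  proof (cases "int p dvd d")
    case True
    have "\<not> int p dvd c"
    proof
      assume "int p dvd c"
      then have "int p dvd 1" using True x(3) coprime_common_divisor by blast
      then show False using p_prime by (auto dest: not_prime_unit)
    qed
    moreover have "multiplicity (int p) d > 0"
      using True x(2) p_prime by (intro prime_multiplicity_gt_zero_iff[THEN iffD2]) auto
    ultimately have "padic_val p x < 0" using cd by (simp add: padic_val_def not_dvd_imp_multiplicity_0)
    then have "pabs x > 1"
      unfolding ab power_int_def using p_pos(2) one_less_power[of "real p" "nat (- padic_val p x)"] by simp
    then show ?thesis using True cd by (simp add: Z_loc_def)
  next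
    case False
    then have v: "padic_val p x \<ge> 0" using cd by (simp add: padic_val_def not_dvd_imp_multiplicity_0)
    have "pabs x = inverse (real p ^ nat (padic_val p x))"
      unfolding ab power_int_minus power_int_def using v by (simp add: power_inverse)
    also have "\<dots> \<le> 1" using p_pos by (simp add: inverse_le_1_iff)
    finally show ?thesis using False cd by (simp add: Z_loc_def)
  qed
qed

lemma pabs_add: "pabs (x + y) \<le> max (pabs x) (pabs y)"
proof -
  have *: "pabs (x + y) \<le> pabs y" if "pabs x \<le> pabs y" "y \<noteq> 0" for x y
  proof -
    have y: "pabs y > 0" using that(2) by (rule pabs_pos)
    have "pabs (x / y) = pabs x / pabs y" unfolding divide_inverse by (simp only: pabs_mult pabs_inverse)
    then have "pabs (x / y) \<le> 1" using that(1) y by simp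
    then have "pabs (1 + x / y) \<le> 1"
      unfolding pabs_le_1_iff using Z_loc_closed(1)[OF p_prime] Z_loc_of_int[OF p_prime, of 1] by simp
    then have "pabs (1 + x / y) * pabs y \<le> pabs y" using y by simp
    moreover have "(1 + x / y) * y = x + y" using that(2) by (simp add: field_simps)
    ultimately show ?thesis by (simp add: pabs_mult[symmetric])
  qed
  show ?thesis
  proof (cases "x = 0 \<or> y = 0")
    case True then show ?thesis by (auto simp: max_def)
  next
    case False
    show ?thesis using *[of x y] *[of y x] False by (cases "pabs x \<le> pabs y") (auto simp: add.commute)
  qed
qed

lemma pabs_diff: "pabs (x - y) \<le> max (pabs x) (pabs y)"
  using pabs_add[of x "- y"] by simp

lemma pabs_diff_commute: "pabs (x - y) = pabs (y - x)"
  using pabs_minus[of "x - y"] by simp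

lemma pabs_isosceles:
  assumes "pabs (x - y) < pabs y" shows "pabs x = pabs y"
  using pabs_add[of "x - y" y] pabs_diff[of x "x - y"] assms by (auto simp: max_def split: if_splits)

text \<open>
  The absolute value takes no value strictly between \<open>1/p\<close> and 1.
\<close>
lemma pabs_less_1: assumes "pabs x < 1" shows "x / of_nat p \<in> Z_loc p"
proof (rule ccontr)
  assume n: "x / of_nat p \<notin> Z_loc p"
  then have "inverse x \<in> Z_loc p" "x \<noteq> 0" using Z_loc_inverse(1,2)[OF p_prime n] p_pos by auto
  then have "inverse (pabs x) \<le> 1" by (simp add: pabs_le_1_iff[symmetric] pabs_inverse)
  moreover have "pabs x > 0" using \<open>x \<noteq> 0\<close> by (rule pabs_pos)
  ultimately show False using assms by (simp add: field_simps)
qed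

lemma pabs_p: "pabs (of_nat p) = inverse (real p)"
proof -
  have "padic_val p (of_int (int p) / of_int 1) = 1"
    using padic_val_frac[of "int p" 1] p_pos by (simp add: multiplicity_self p_prime)
  then show ?thesis using p_pos by (simp add: padic_abs_def power_int_minus)
qed

lemma pabs_power: "pabs (x ^ n) = pabs x ^ n"
  by (induction n) (simp_all add: pabs_mult)

abbreviation cauchy where "cauchy \<equiv> padic_cauchy p"
abbreviation null where "null \<equiv> null_seqs p"

lemma cauchy_const: "cauchy (\<lambda>n. q)"
  by (auto simp: padic_cauchy_def)

lemma cauchy_bounded:
  assumes "cauchy a" obtains b where "b > 0" "\<And>n. pabs (a n) \<le> b"
proof -
  obtain N where N: "\<And>m n. m \<ge> N \<Longrightarrow> n \<ge> N \<Longrightarrow> pabs (a m - a n) < 1"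
    using assms unfolding padic_cauchy_def by (metis zero_less_one)
  define b where "b = 1 + (\<Sum>i\<le>N. pabs (a i))"
  have s: "pabs (a n) \<le> (\<Sum>i\<le>N. pabs (a i))" if "n \<le> N" for n
    using that by (intro member_le_sum) auto
  have "pabs (a n) \<le> b" for n
  proof (cases "n \<le> N")
    case True then show ?thesis using s[OF True] by (simp add: b_def)
  next
    case False
    then have "pabs (a n) \<le> max 1 (pabs (a N))" using pabs_add[of "a n - a N" "a N"] N[of n N] by auto
    moreover have "0 \<le> (\<Sum>i\<le>N. pabs (a i))" by (rule sum_nonneg) simp
    ultimately show ?thesis using s[of N] unfolding b_def by (simp add: max_def split: if_splits)
  qed
  moreover have "b > 0" unfolding b_def by (intro add_pos_nonneg sum_nonneg) auto
  ultimately show ?thesis using that by blast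
qed

lemma cauchy_add:
  assumes a: "cauchy a" and b: "cauchy b" shows "cauchy (\<lambda>n. a n + b n)"
  unfolding padic_cauchy_def
proof (intro allI impI)
  fix e :: real assume e: "e > 0"
  obtain M where M: "\<And>m n. m \<ge> M \<Longrightarrow> n \<ge> M \<Longrightarrow> pabs (a m - a n) < e" using a e unfolding padic_cauchy_def by blast
  obtain N where N: "\<And>m n. m \<ge> N \<Longrightarrow> n \<ge> N \<Longrightarrow> pabs (b m - b n) < e" using b e unfolding padic_cauchy_def by blast
  have "pabs (a m + b m - (a n + b n)) < e" if "m \<ge> max M N" "n \<ge> max M N" for m n
    using pabs_add[of "a m - a n" "b m - b n"] M[of m n] N[of m n] that by (simp add: algebra_simps)
  then show "\<exists>N. \<forall>m\<ge>N. \<forall>n\<ge>N. pabs (a m + b m - (a n + b n)) < e" by blast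
qed

lemma cauchy_mult:
  assumes a: "cauchy a" and b: "cauchy b" shows "cauchy (\<lambda>n. a n * b n)"
  unfolding padic_cauchy_def
proof (intro allI impI)
  fix e :: real assume e: "e > 0"
  obtain A where A: "A > 0" "\<And>n. pabs (a n) \<le> A" using cauchy_bounded[OF a] by blast
  obtain C where C: "C > 0" "\<And>n. pabs (b n) \<le> C" using cauchy_bounded[OF b] by blast
  obtain M where M: "\<And>m n. m \<ge> M \<Longrightarrow> n \<ge> M \<Longrightarrow> pabs (a m - a n) < e / C"
    using a divide_pos_pos[OF e C(1)] unfolding padic_cauchy_def by blast
  obtain N where N: "\<And>m n. m \<ge> N \<Longrightarrow> n \<ge> N \<Longrightarrow> pabs (b m - b n) < e / A"
    using b divide_pos_pos[OF e A(1)] unfolding padic_cauchy_def by blast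
  have "pabs (a m * b m - a n * b n) < e" if mn: "m \<ge> max M N" "n \<ge> max M N" for m n
  proof -
    have "a m * b m - a n * b n = (a m - a n) * b m + a n * (b m - b n)" by (simp add: algebra_simps)
    then have "pabs (a m * b m - a n * b n) \<le> max (pabs (a m - a n) * pabs (b m)) (pabs (a n) * pabs (b m - b n))"
      using pabs_add by (metis pabs_mult)
    moreover have "pabs (a m - a n) * pabs (b m) < e"
    proof -
      have "pabs (a m - a n) * pabs (b m) \<le> pabs (a m - a n) * C" using C(2) by (intro mult_left_mono) auto
      also have "\<dots> < e" using M[of m n] mn C(1) by (simp add: field_simps)
      finally show ?thesis .
    qed
    moreover have "pabs (a n) * pabs (b m - b n) < e"
    proof -
      have "pabs (a n) * pabs (b m - b n) \<le> A * pabs (b m - b n)" using A(2) by (intro mult_right_mono) auto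
      also have "\<dots> < e" using N[of m n] mn A(1) by (simp add: field_simps)
      finally show ?thesis .
    qed
    ultimately show ?thesis by simp
  qed
  then show "\<exists>N. \<forall>m\<ge>N. \<forall>n\<ge>N. pabs (a m * b m - a n * b n) < e" by blast
qed

lemma cauchy_minus: "cauchy a \<Longrightarrow> cauchy (\<lambda>n. - a n)"
  using cauchy_mult[OF cauchy_const[of "-1"]] by simp

lemma cauchy_shift: "cauchy a \<Longrightarrow> cauchy (\<lambda>n. a (max n N))"
  unfolding padic_cauchy_def by (meson max.coboundedI1)

lemma cauchy_inverse_unit:
  assumes a: "cauchy a" and u: "\<And>n. pabs (a n) = 1"
  shows "cauchy (\<lambda>n. inverse (a n))" "\<And>n. pabs (inverse (a n)) = 1" "\<And>n. a n \<noteq> 0"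
proof -
  show n0: "a n \<noteq> 0" for n using u[of n] by auto
  show "pabs (inverse (a n)) = 1" for n by (simp add: pabs_inverse u)
  have "pabs (inverse (a m) - inverse (a n)) = pabs (a m - a n)" for m n
  proof -
    have "inverse (a m) - inverse (a n) = (a n - a m) * (inverse (a m) * inverse (a n))"
      using n0[of m] n0[of n] by (simp add: field_simps)
    then show ?thesis by (simp add: pabs_mult pabs_inverse u pabs_diff_commute)
  qed
  then show "cauchy (\<lambda>n. inverse (a n))" using a by (simp add: padic_cauchy_def)
qed

lemma null_iff: "a \<in> null \<longleftrightarrow> (\<forall>e>0. \<exists>N. \<forall>n\<ge>N. pabs (a n) < e)"
  by (auto simp: null_seqs_def LIMSEQ_iff)

lemma null_cauchy: "a \<in> null \<Longrightarrow> cauchy a"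
  unfolding padic_cauchy_def
proof (intro allI impI)
  fix e :: real assume "a \<in> null" "e > 0"
  then obtain N where N: "\<And>n. n \<ge> N \<Longrightarrow> pabs (a n) < e" unfolding null_iff by blast
  have "pabs (a m - a n) < e" if "m \<ge> N" "n \<ge> N" for m n
    using pabs_diff[of "a m" "a n"] N[OF that(1)] N[OF that(2)] by linarith
  then show "\<exists>N. \<forall>m\<ge>N. \<forall>n\<ge>N. pabs (a m - a n) < e" by blast
qed

lemma null_add:
  assumes "a \<in> null" "b \<in> null" shows "(\<lambda>n. a n + b n) \<in> null"
  unfolding null_iff
proof (intro allI impI)
  fix e :: real assume e: "e > 0"
  obtain M where M: "\<And>n. n \<ge> M \<Longrightarrow> pabs (a n) < e" using assms(1) e unfolding null_iff by blast
  obtain N where N: "\<And>n. n \<ge> N \<Longrightarrow> pabs (b n) < e" using assms(2) e unfolding null_iff by blast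
  have "pabs (a n + b n) < e" if "n \<ge> max M N" for n
    using pabs_add[of "a n" "b n"] M[of n] N[of n] that by linarith
  then show "\<exists>N. \<forall>n\<ge>N. pabs (a n + b n) < e" by blast
qed

lemma null_mult:
  assumes "a \<in> null" "cauchy b" shows "(\<lambda>n. b n * a n) \<in> null"
  unfolding null_iff
proof (intro allI impI)
  fix e :: real assume e: "e > 0"
  obtain C where C: "C > 0" "\<And>n. pabs (b n) \<le> C" using cauchy_bounded[OF assms(2)] by blast
  obtain N where N: "\<And>n. n \<ge> N \<Longrightarrow> pabs (a n) < e / C"
    using assms(1) divide_pos_pos[OF e C(1)] unfolding null_iff by blast
  have "pabs (b n * a n) < e" if "n \<ge> N" for n
  proof -
    have "pabs (b n) * pabs (a n) \<le> C * pabs (a n)" using C(2) by (intro mult_right_mono) auto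
    also have "\<dots> < e" using N[OF that] C(1) by (simp add: field_simps)
    finally show ?thesis by (simp add: pabs_mult)
  qed
  then show "\<exists>N. \<forall>n\<ge>N. pabs (b n * a n) < e" by blast
qed

lemma null_eventually_0: "(\<And>n. n \<ge> N \<Longrightarrow> a n = 0) \<Longrightarrow> a \<in> null"
  unfolding null_iff by (metis pabs_0)

lemma null_minus: "a \<in> null \<Longrightarrow> (\<lambda>n. - a n) \<in> null"
  by (simp add: null_iff)

text \<open>
  By the isosceles property the absolute value of a Cauchy sequence that is not null is eventually constant, so up to
  finitely many terms the sequence is a rational number times one of absolute value 1.
\<close>
lemma not_null_unit:
  assumes a: "cauchy a" "a \<notin> null"
  obtains q u where "q \<noteq> 0" "cauchy u" "\<And>n. pabs (u n) = 1" "(\<lambda>n. a n - q * u n) \<in> null"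
proof -
  obtain e where e: "e > 0" "\<And>N. \<exists>n\<ge>N. \<not> pabs (a n) < e" using a(2) unfolding null_iff by blast
  obtain N where N: "\<And>m n. m \<ge> N \<Longrightarrow> n \<ge> N \<Longrightarrow> pabs (a m - a n) < e"
    using a(1) e(1) unfolding padic_cauchy_def by blast
  obtain m where m: "m \<ge> N" "pabs (a m) \<ge> e" using e(2)[of N] by auto
  have am: "a m \<noteq> 0" using m(2) e(1) by auto
  have eq: "pabs (a n) = pabs (a m)" if "n \<ge> N" for n
    by (rule pabs_isosceles) (use N[OF that m(1)] m(2) in linarith)
  define u where "u n = inverse (a m) * a (max n N)" for n
  have "cauchy u" unfolding u_def by (intro cauchy_mult cauchy_const cauchy_shift a)
  moreover have "pabs (u n) = 1" for n
    using eq[of "max n N"] am by (simp add: u_def pabs_mult pabs_inverse)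
  moreover have "(\<lambda>n. a n - a m * u n) \<in> null"
    by (rule null_eventually_0[of N]) (use am in \<open>simp add: u_def max_absorb1\<close>)
  ultimately show ?thesis using that am by blast
qed

lemma cauchy_ring_simps [simp]:
  "carrier (cauchy_ring p) = {a. cauchy a}"
  "a \<otimes>\<^bsub>cauchy_ring p\<^esub> b = (\<lambda>n. a n * b n)" "\<one>\<^bsub>cauchy_ring p\<^esub> = (\<lambda>n. 1)"
  "a \<oplus>\<^bsub>cauchy_ring p\<^esub> b = (\<lambda>n. a n + b n)" "\<zero>\<^bsub>cauchy_ring p\<^esub> = (\<lambda>n. 0)"
  by (simp_all add: cauchy_ring_def)

lemma cring_cauchy: "cring (cauchy_ring p)"
proof (rule cringI)
  show "abelian_group (cauchy_ring p)"
  proof (rule abelian_groupI)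
    show "\<exists>y\<in>carrier (cauchy_ring p). y \<oplus>\<^bsub>cauchy_ring p\<^esub> x = \<zero>\<^bsub>cauchy_ring p\<^esub>"
      if "x \<in> carrier (cauchy_ring p)" for x
      using that cauchy_minus[of x] by (intro bexI[of _ "\<lambda>n. - x n"]) auto
  qed (auto simp: cauchy_add cauchy_const algebra_simps)
  show "Group.comm_monoid (cauchy_ring p)"
    by (rule comm_monoidI) (auto simp: cauchy_mult cauchy_const algebra_simps)
qed (auto simp: algebra_simps)

lemma minus_cauchy: assumes "cauchy a" shows "\<ominus>\<^bsub>cauchy_ring p\<^esub> a = (\<lambda>n. - a n)"
proof -
  interpret cring "cauchy_ring p" by (rule cring_cauchy)
  show ?thesis by (rule minus_equality) (use assms cauchy_minus in auto)
qed

lemma ideal_null: "ideal null (cauchy_ring p)"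
proof -
  interpret cring "cauchy_ring p" by (rule cring_cauchy)
  show ?thesis
  proof (rule idealI[OF ring_axioms])
    show "subgroup null (add_monoid (cauchy_ring p))"
    proof (rule add.subgroupI)
      show "null \<subseteq> carrier (cauchy_ring p)" using null_cauchy by auto
      show "null \<noteq> {}" using null_eventually_0[of 0 "\<lambda>n. 0"] by auto
      show "\<ominus>\<^bsub>cauchy_ring p\<^esub> a \<in> null" if "a \<in> null" for a
        using null_minus[OF that] minus_cauchy[OF null_cauchy[OF that]] by simp
      show "a \<oplus>\<^bsub>cauchy_ring p\<^esub> b \<in> null" if "a \<in> null" "b \<in> null" for a b
        using null_add[OF that] by simp
    qed
    show "x \<otimes>\<^bsub>cauchy_ring p\<^esub> a \<in> null" if "a \<in> null" "x \<in> carrier (cauchy_ring p)" for a x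
      using null_mult[OF that(1), of x] that(2) by simp
    show "a \<otimes>\<^bsub>cauchy_ring p\<^esub> x \<in> null" if "a \<in> null" "x \<in> carrier (cauchy_ring p)" for a x
      using null_mult[OF that(1), of x] that(2) by (simp add: mult.commute)
  qed
qed

lemma carrier_padic_field: "carrier (padic_field p) = (\<lambda>a. null +>\<^bsub>cauchy_ring p\<^esub> a) ` {a. cauchy a}"
  unfolding padic_field_def FactRing_def A_RCOSETS_def' by auto

text \<open>
  A class with one representative in the unit ball is the class of that representative.
\<close>
lemma padic_integers_eq:
  "padic_integers p = (\<lambda>a. null +>\<^bsub>cauchy_ring p\<^esub> a) ` {a. cauchy a \<and> (\<forall>n. a n \<in> Z_loc p)}"
proof -
  interpret I: ideal null "cauchy_ring p" by (rule ideal_null)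
  show ?thesis
  proof safe
    fix x assume "x \<in> padic_integers p"
    then obtain a b where a: "a \<in> x" "\<forall>n. pabs (a n) \<le> 1" and b: "cauchy b" "x = null +>\<^bsub>cauchy_ring p\<^esub> b"
      unfolding padic_integers_def carrier_padic_field by auto
    have ac: "cauchy a" using a(1) b I.a_elemrcos_carrier[of b a] by auto
    have "x = null +>\<^bsub>cauchy_ring p\<^esub> a" using I.a_repr_independence'[of a b] a(1) b by auto
    then show "x \<in> (\<lambda>a. null +>\<^bsub>cauchy_ring p\<^esub> a) ` {a. cauchy a \<and> (\<forall>n. a n \<in> Z_loc p)}"
      using a(2) ac by (auto simp: pabs_le_1_iff)
  next
    fix a assume a: "cauchy a" "\<forall>n. a n \<in> Z_loc p"
    have "a \<in> null +>\<^bsub>cauchy_ring p\<^esub> a" using I.a_rcos_self[of a] a by auto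
    then show "null +>\<^bsub>cauchy_ring p\<^esub> a \<in> padic_integers p"
      unfolding padic_integers_def carrier_padic_field using a by (auto simp: pabs_le_1_iff)
  qed
qed

lemma Z_loc_residue:
  assumes "q \<in> Z_loc p" obtains n where "(q - of_int n) / of_nat p \<in> Z_loc p"
proof -
  obtain a b where ab: "q = of_int a / of_int b" "\<not> int p dvd b" "b \<noteq> 0" using Z_locE[OF assms] .
  have "coprime (int p) b" using ab(2) p_prime by (simp add: prime_imp_coprime)
  then obtain u v where uv: "u * int p + v * b = 1" using bezout_int[of "int p" b] by (auto simp: coprime_iff_gcd_eq_1)
  have "(of_int (u * int p + v * b) :: rat) = 1" unfolding uv by simp
  then have 1: "of_int u * of_nat p + of_int v * of_int b = (1 :: rat)" by simp
  have "(q - of_int (a * v)) / of_nat p = of_int (a * u) / of_int b"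
  proof -
    have "q = of_int a * (of_int u * of_nat p + of_int v * of_int b) / of_int b" unfolding 1 ab(1) by simp
    then have "q - of_int (a * v) = of_int (a * u) / of_int b * of_nat p" using ab(3) by (simp add: field_simps)
    then show ?thesis using p_pos by simp
  qed
  then have "(q - of_int (a * v)) / of_nat p \<in> Z_loc p" using Z_locI[OF _ ab(2)] by blast
  then show ?thesis using that by blast
qed

text \<open>
  Every property is checked on rational sequences, through the composite \<open>\<kappa>\<close> of \<open>k\<close> with the quotient map. The
  residue of a \<open>p\<close>-adic integer is read off from a late term of the sequence. If \<open>1/p\<close> were the class of an
  integral sequence \<open>a\<close>, then \<open>p a - 1\<close>, whose terms have absolute value 1, would be both a unit and zero.
\<close>
lemma padic_closedI:
  fixes K :: "'b ring" and k
  assumes "is_alg_closure (padic_field p) K k"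
  shows "padic_closed K (\<lambda>q. k (rat_to_padic p q)) p (k ` carrier (padic_field p)) (k ` padic_integers p)"
proof -
  let ?F = "k ` carrier (padic_field p)" and ?B = "k ` padic_integers p"
  have kh: "k \<in> ring_hom (padic_field p) K" and ac: "algebraic_closure K ?F"
    using assms by (auto simp: is_alg_closure_def)
  interpret K: algebraic_closure K ?F by (rule ac)
  interpret I: ideal null "cauchy_ring p" by (rule ideal_null)
  interpret C: cring "cauchy_ring p" by (rule cring_cauchy)
  define \<kappa> where "\<kappa> a = k (null +>\<^bsub>cauchy_ring p\<^esub> a)" for a
  have qh: "(\<lambda>a. null +>\<^bsub>cauchy_ring p\<^esub> a) \<in> ring_hom (cauchy_ring p) (padic_field p)"
    unfolding padic_field_def by (rule I.rcos_ring_hom)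
  have "\<kappa> = k \<circ> (\<lambda>a. null +>\<^bsub>cauchy_ring p\<^esub> a)" by (auto simp: \<kappa>_def)
  then have "\<kappa> \<in> ring_hom (cauchy_ring p) K" using ring_hom_trans[OF qh kh] by simp
  then interpret h: ring_hom_ring "cauchy_ring p" K \<kappa>
    by (intro ring_hom_ringI2 cring.axioms(1)[OF cring_cauchy] K.ring_axioms)
  \<comment> \<open>The map \<open>k\<close> is a homomorphism out of the quotient, so sequences that differ by a null sequence have
    the same image.\<close>
  have k_null: "\<kappa> a = \<zero>\<^bsub>K\<^esub>" if "a \<in> null" for a
  proof -
    have z: "\<zero>\<^bsub>cauchy_ring p\<^esub> \<in> null" using null_eventually_0[of 0 "\<lambda>n. 0"] by simp
    have "null +>\<^bsub>cauchy_ring p\<^esub> a = null +>\<^bsub>cauchy_ring p\<^esub> \<zero>\<^bsub>cauchy_ring p\<^esub>"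
      using I.a_rcos_const[OF that] I.a_rcos_const[OF z] by simp
    then have "\<kappa> a = \<kappa> \<zero>\<^bsub>cauchy_ring p\<^esub>" by (simp add: \<kappa>_def del: cauchy_ring_simps)
    then show ?thesis using h.hom_zero by simp
  qed
  have k_mult: "\<kappa> (\<lambda>n. a n * b n) = \<kappa> a \<otimes>\<^bsub>K\<^esub> \<kappa> b" and k_add: "\<kappa> (\<lambda>n. a n + b n) = \<kappa> a \<oplus>\<^bsub>K\<^esub> \<kappa> b"
    and k_car: "\<kappa> a \<in> carrier K" if "cauchy a" "cauchy b" for a b
    using h.hom_mult[of a b] h.hom_add[of a b] h.hom_closed[of a] that by simp_all
  have k_one: "\<kappa> (\<lambda>n. 1) = \<one>\<^bsub>K\<^esub>" using h.hom_one by simp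
  have k_eq: "\<kappa> a = \<kappa> b" if "cauchy a" "cauchy b" "(\<lambda>n. a n - b n) \<in> null" for a b
  proof -
    have "\<kappa> (\<lambda>n. (a n - b n) + b n) = \<kappa> (\<lambda>n. a n - b n) \<oplus>\<^bsub>K\<^esub> \<kappa> b"
      using k_add[of "\<lambda>n. a n - b n" b] that null_cauchy by blast
    then show ?thesis using k_null[OF that(3)] k_car[OF that(2) that(2)] by simp
  qed
  have F_eq: "?F = \<kappa> ` {a. cauchy a}" unfolding carrier_padic_field \<kappa>_def by auto
  have B_eq: "?B = \<kappa> ` {a. cauchy a \<and> (\<forall>n. a n \<in> Z_loc p)}" unfolding padic_integers_eq \<kappa>_def by auto
  have \<rho>_eq: "k (rat_to_padic p q) = \<kappa> (\<lambda>n. q)" for q by (simp add: rat_to_padic_def \<kappa>_def)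
  have unit: "\<kappa> u \<otimes>\<^bsub>K\<^esub> \<kappa> (\<lambda>n. inverse (u n)) = \<one>\<^bsub>K\<^esub>" if "cauchy u" "\<And>n. pabs (u n) = 1" for u
  proof -
    note iu = cauchy_inverse_unit[OF that]
    have "\<kappa> u \<otimes>\<^bsub>K\<^esub> \<kappa> (\<lambda>n. inverse (u n)) = \<kappa> (\<lambda>n. u n * inverse (u n))"
      using k_mult[OF that(1) iu(1)] by simp
    then show ?thesis using iu(3) k_one by simp
  qed
  have rat_hom: "(\<lambda>q. k (rat_to_padic p q)) \<in> ring_hom rat_ring K"
    unfolding \<rho>_eq using k_mult[OF cauchy_const cauchy_const] k_add[OF cauchy_const cauchy_const] k_one k_car[OF cauchy_const cauchy_const]
    by (intro ring_hom_memI) (auto simp: ring_of_type_algebra_def)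
  interpret KK: plain_closed_field K
    by (intro plain_closed_field.intro plain_field.intro K.field_axioms K.algebraically_closed_axioms)
  interpret E: rat_embedded K "\<lambda>q. k (rat_to_padic p q)"
    by (intro rat_embedded.intro KK.plain_field_axioms rat_embedded_axioms.intro rat_hom)
  have B_sub: "subring ?B K"
  proof -
    have "subring {a. cauchy a \<and> (\<forall>n. a n \<in> Z_loc p)} (cauchy_ring p)"
    proof (rule ring.subringI[OF cring.axioms(1)[OF cring_cauchy]])
      show "\<ominus>\<^bsub>cauchy_ring p\<^esub> a \<in> {a. cauchy a \<and> (\<forall>n. a n \<in> Z_loc p)}"
        if "a \<in> {a. cauchy a \<and> (\<forall>n. a n \<in> Z_loc p)}" for a
        using that minus_cauchy cauchy_minus Z_loc_minus by auto
    qed (use cauchy_const cauchy_add cauchy_mult Z_loc_closed[OF p_prime] Z_loc_of_int[OF p_prime, of 1] in auto)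
    then show ?thesis unfolding B_eq by (rule h.img_is_subring)
  qed
  show ?thesis
  proof (intro padic_closed.intro padic_closed_axioms.intro)
    show "Factorial_Ring.prime p" by (rule p_prime)
    show "(K.algebraic over ?F) x" if "x \<in> carrier K" for x by (rule K.algebraic_extension[OF that])
    show "?B \<subseteq> ?F" unfolding F_eq B_eq by auto
    show "(\<lambda>q. k (rat_to_padic p q)) ` Z_loc p \<subseteq> ?B" unfolding B_eq \<rho>_eq using cauchy_const by blast
    show "\<exists>n d. d \<in> ?B \<and> z = k (rat_to_padic p (of_int n)) \<oplus>\<^bsub>K\<^esub> k (rat_to_padic p (of_nat p)) \<otimes>\<^bsub>K\<^esub> d"
      if "z \<in> ?B" for z
    proof -
      obtain a where a: "z = \<kappa> a" "cauchy a" "\<And>n. a n \<in> Z_loc p" using \<open>z \<in> ?B\<close> unfolding B_eq by auto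
      obtain N where N: "\<And>m n. m \<ge> N \<Longrightarrow> n \<ge> N \<Longrightarrow> pabs (a m - a n) < 1"
        using a(2) unfolding padic_cauchy_def by (metis zero_less_one)
      obtain c where c: "(a N - of_int c) / of_nat p \<in> Z_loc p" using Z_loc_residue[OF a(3)] .
      define d where "d n = (a (max n N) - of_int c) / of_nat p" for n
      have dZ: "d n \<in> Z_loc p" for n
      proof -
        have "(a (max n N) - a N) / of_nat p \<in> Z_loc p" by (rule pabs_less_1[OF N]) auto
        then have "(a (max n N) - a N) / of_nat p + (a N - of_int c) / of_nat p \<in> Z_loc p"
          using c by (rule Z_loc_closed(1)[OF p_prime])
        then show ?thesis unfolding d_def by (simp add: add_divide_distrib[symmetric])
      qed
      have dc: "cauchy d"
      proof -
        have "cauchy (\<lambda>n. inverse (of_nat p) * (a (max n N) + - of_int c))"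
          by (rule cauchy_mult[OF cauchy_const cauchy_add[OF cauchy_shift[OF a(2)] cauchy_const]])
        moreover have "d = (\<lambda>n. inverse (of_nat p) * (a (max n N) + - of_int c))"
          by (auto simp: d_def fun_eq_iff divide_inverse)
        ultimately show ?thesis by (simp only:)
      qed
      have cp: "cauchy (\<lambda>n. of_nat p * d n)" by (intro cauchy_mult cauchy_const dc)
      have "\<kappa> a = \<kappa> (\<lambda>n. of_int c + of_nat p * d n)"
        by (rule k_eq[OF a(2) cauchy_add[OF cauchy_const cp] null_eventually_0[of N]])
          (use p_pos in \<open>simp add: d_def max_absorb1\<close>)
      also have "\<dots> = \<kappa> (\<lambda>n. of_int c) \<oplus>\<^bsub>K\<^esub> \<kappa> (\<lambda>n. of_nat p) \<otimes>\<^bsub>K\<^esub> \<kappa> d"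
        using k_add[OF cauchy_const cp] k_mult[OF cauchy_const dc] by simp
      finally show ?thesis unfolding a(1) \<rho>_eq B_eq using dc dZ by blast
    qed
    show "\<exists>e::nat. k (rat_to_padic p (of_nat p ^ e)) \<otimes>\<^bsub>K\<^esub> x \<in> ?B" if "x \<in> ?F" for x
    proof -
      obtain a where a: "x = \<kappa> a" "cauchy a" using \<open>x \<in> ?F\<close> unfolding F_eq by auto
      obtain b where b: "b > 0" "\<And>n. pabs (a n) \<le> b" using cauchy_bounded[OF a(2)] by blast
      obtain e :: nat where e: "b < real p ^ e" using real_arch_pow[OF p_pos(2)] by blast
      have "pabs (of_nat p ^ e * a n) \<le> 1" for n
        using b(2)[of n] e p_pos by (simp add: pabs_mult pabs_power pabs_p power_inverse field_simps)
      then have "\<kappa> (\<lambda>n. of_nat p ^ e * a n) \<in> ?B"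
        unfolding B_eq using cauchy_mult[OF cauchy_const a(2)] by (auto simp: pabs_le_1_iff)
      then show ?thesis unfolding a(1) \<rho>_eq using k_mult[OF cauchy_const a(2)] by metis
    qed
    show "x \<in> ?B \<or> inv\<^bsub>K\<^esub> x \<in> ?B" if "x \<in> ?F" "x \<noteq> \<zero>\<^bsub>K\<^esub>" for x
    proof -
      obtain a where a: "x = \<kappa> a" "cauchy a" using \<open>x \<in> ?F\<close> unfolding F_eq by auto
      then have "a \<notin> null" using k_null \<open>x \<noteq> \<zero>\<^bsub>K\<^esub>\<close> by auto
      then obtain q u where qu: "q \<noteq> 0" "cauchy u" "\<And>n. pabs (u n) = 1" "(\<lambda>n. a n - q * u n) \<in> null"
        using not_null_unit[OF a(2)] by blast
      note iu = cauchy_inverse_unit[OF qu(2,3)]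
      have cq: "cauchy (\<lambda>n. q * u n)" "cauchy (\<lambda>n. inverse q * inverse (u n))"
        by (intro cauchy_mult cauchy_const qu(2) iu(1))+
      have x: "x = \<kappa> (\<lambda>n. q * u n)" unfolding a(1) by (rule k_eq[OF a(2) cq(1) qu(4)])
      show ?thesis
      proof (cases "pabs q \<le> 1")
        case True
        then have "pabs (q * u n) \<le> 1" for n by (simp add: pabs_mult qu(3))
        then show ?thesis unfolding x B_eq using cq(1) by (auto simp: pabs_le_1_iff)
      next
        case False
        then have "pabs (inverse q * inverse (u n)) \<le> 1" for n
          by (simp add: pabs_mult pabs_inverse qu(3) inverse_le_1_iff)
        then have "\<kappa> (\<lambda>n. inverse q * inverse (u n)) \<in> ?B"
          unfolding B_eq using cq(2) by (auto simp: pabs_le_1_iff)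
        moreover have "x \<otimes>\<^bsub>K\<^esub> \<kappa> (\<lambda>n. inverse q * inverse (u n)) = \<one>\<^bsub>K\<^esub>"
        proof -
          have "q * u n * (inverse q * inverse (u n)) = 1" for n using qu(1) iu(3)[of n] by (simp add: field_simps)
          then show ?thesis unfolding x using k_mult[OF cq] k_one by simp
        qed
        then have "inv\<^bsub>K\<^esub> x = \<kappa> (\<lambda>n. inverse q * inverse (u n))"
          using K.comm_inv_char[of x] k_car[OF cq(2) cq(2)] k_car[OF cq(1) cq(1)] x by blast
        ultimately show ?thesis by simp
      qed
    qed
    show "k (rat_to_padic p (inverse (of_nat p))) \<notin> ?B"
    proof
      assume "k (rat_to_padic p (inverse (of_nat p))) \<in> ?B"
      then obtain a where a: "k (rat_to_padic p (inverse (of_nat p))) = \<kappa> a" "cauchy a" "\<And>n. a n \<in> Z_loc p"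
        unfolding B_eq by auto
      define u where "u n = of_nat p * a n + (- 1)" for n
      have ca: "cauchy (\<lambda>n. of_nat p * a n)" by (intro cauchy_mult cauchy_const a(2))
      have cu: "cauchy u" unfolding u_def by (intro cauchy_add cauchy_const ca)
      have "pabs (u n) = 1" for n
      proof -
        have "pabs (a n) \<le> 1" using a(3) by (simp add: pabs_le_1_iff)
        then have "pabs (of_nat p * a n) < 1" using p_pos by (simp add: pabs_mult pabs_p field_simps)
        then show ?thesis using pabs_isosceles[of "u n" "- 1"] by (simp add: u_def)
      qed
      then have un: "\<kappa> u \<otimes>\<^bsub>K\<^esub> \<kappa> (\<lambda>n. inverse (u n)) = \<one>\<^bsub>K\<^esub>" "cauchy (\<lambda>n. inverse (u n))"
        using unit[OF cu] cauchy_inverse_unit[OF cu] by auto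
      have "\<kappa> u = \<kappa> (\<lambda>n. of_nat p) \<otimes>\<^bsub>K\<^esub> \<kappa> a \<oplus>\<^bsub>K\<^esub> \<kappa> (\<lambda>n. - 1)"
        unfolding u_def by (simp only: k_add[OF ca cauchy_const] k_mult[OF cauchy_const a(2)])
      also have "\<kappa> a = \<kappa> (\<lambda>n. inverse (of_nat p))" using a(1) \<rho>_eq by simp
      also have "\<kappa> (\<lambda>n. of_nat p) \<otimes>\<^bsub>K\<^esub> \<kappa> (\<lambda>n. inverse (of_nat p)) \<oplus>\<^bsub>K\<^esub> \<kappa> (\<lambda>n. - 1) = \<kappa> (\<lambda>n. of_nat p * inverse (of_nat p) + - 1)"
        by (simp only: k_add[OF cauchy_const cauchy_const] k_mult[OF cauchy_const cauchy_const])
      also have "\<dots> = \<zero>\<^bsub>K\<^esub>" by (rule k_null[OF null_eventually_0[of 0]]) (use p_pos in simp)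
      finally have "\<zero>\<^bsub>K\<^esub> \<otimes>\<^bsub>K\<^esub> \<kappa> (\<lambda>n. inverse (u n)) = \<one>\<^bsub>K\<^esub>" using un(1) by simp
      then show False using k_car[OF un(2) un(2)] by simp
    qed
  qed (fact B_sub K.subfield_axioms KK.plain_closed_field_axioms E.rat_embedded_axioms)+
qed

end

section \<open>The four notions of nontriviality\<close>

theorem theorem3p2:
  fixes Qbar :: "'a ring" and j :: "rat \<Rightarrow> 'a"
    and Qpbar :: "nat \<Rightarrow> 'b ring" and k :: "nat \<Rightarrow> (nat \<Rightarrow> rat) set \<Rightarrow> 'b"
    and S :: "'a set"
  assumes Qbar: "is_alg_closure rat_ring Qbar j"
    and Qpbar: "\<And>p. Factorial_Ring.prime p \<Longrightarrow> is_alg_closure (padic_field p) (Qpbar p) (k p)"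
    and S: "S \<subseteq> integral_closure Qbar (j ` \<int>)"
  shows
    "(Int_nontrivial Qbar (range j) S (integral_closure Qbar (j ` \<int>))
      \<longleftrightarrow>
      (\<exists>p. Factorial_Ring.prime p \<and>
         Int_nontrivial Qbar (range j) S (integral_closure Qbar (j ` Z_loc p))))
     \<and>
     ((\<exists>p. Factorial_Ring.prime p \<and>
         Int_nontrivial Qbar (range j) S (integral_closure Qbar (j ` Z_loc p)))
      \<longleftrightarrow>
      (\<exists>p. Factorial_Ring.prime p \<and>
         Int_nontrivial (Qpbar p) (k p ` carrier (padic_field p))
           (Sigma_p Qbar j p (Qpbar p) (k p) S)
           (integral_closure (Qpbar p) (k p ` padic_integers p))))
     \<and>
     ((\<exists>p. Factorial_Ring.prime p \<and>
         Int_nontrivial (Qpbar p) (k p ` carrier (padic_field p))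
           (Sigma_p Qbar j p (Qpbar p) (k p) S)
           (integral_closure (Qpbar p) (k p ` padic_integers p)))
      \<longleftrightarrow>
      (\<exists>p. Factorial_Ring.prime p \<and>
         Int_nontrivial (Qpbar p) (carrier (Qpbar p))
           (Sigma_p Qbar j p (Qpbar p) (k p) S)
           (integral_closure (Qpbar p) (k p ` padic_integers p))))"
proof -
  have j: "j \<in> ring_hom rat_ring Qbar" and ac: "algebraic_closure Qbar (range j)"
    using Qbar by (auto simp: is_alg_closure_def ring_of_type_algebra_def)
  interpret L: algebraic_closure Qbar "range j" by (rule ac)
  interpret Q: rat_embedded Qbar j
    by (intro rat_embedded.intro plain_field.intro rat_embedded_axioms.intro L.field_axioms j)
  have cmp: "padic_comparison Qbar j (Qpbar p) (\<lambda>q. k p (rat_to_padic p q)) p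
      (k p ` carrier (padic_field p)) (k p ` padic_integers p) S (Sigma_p Qbar j p (Qpbar p) (k p) S)"
    if p: "Factorial_Ring.prime p" for p
  proof (rule padic_comparison.intro[OF Q.rat_embedded_axioms])
    show "padic_closed (Qpbar p) (\<lambda>q. k p (rat_to_padic p q)) p (k p ` carrier (padic_field p)) (k p ` padic_integers p)"
      by (rule padic.padic_closedI[OF padic.intro[OF p] Qpbar[OF p]])
    show "padic_comparison_axioms Qbar j (Qpbar p) (\<lambda>q. k p (rat_to_padic p q)) (k p ` padic_integers p) S
      (Sigma_p Qbar j p (Qpbar p) (k p) S)"
      by unfold_locales (use L.algebraic_extension S in \<open>auto simp: Sigma_p_def\<close>)
  qed
  note impl = padic_comparison.rational_imp_padic[OF cmp] padic_comparison.padic_imp_closure[OF cmp]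
    padic_comparison.closure_imp_rational[OF cmp]
  show ?thesis
    using Q.Int_nontrivial_iff_local[OF S] impl by blast
qed

end
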